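(* For every integer $k\ge 2$ and every forest $H$ there exists $\epsilon>0$ such that the following holds. Let $(G_1,\ldots,G_k)$ be a $k$-multicolouring of a complete graph $K_n$ with $n\ge 2$. Then there exist distinct $i,j\in\{1,\ldots,k\}$ such that either \begin{itemize} \item there is a set $X\subseteq V(K_n)$ such that every edge of $K_n[X]$ belongs to $G_i\cup G_j$ and $G_i[X]$ is isomorphic to $H$; or \item there are two disjoint sets $X,Y\subseteq V(K_n)$ with $|X|,|Y|\ge\epsilon n$ such that every vertex of $X$ is adjacent in $G_j$ to every vertex of $Y$. \end{itemize}
   Context: A $k$-multicolouring of a complete graph $K_n$ is a tuple $(G_1,\ldots,G_k)$ of graphs, each with vertex set $V(K_n)$, whose edge sets form a partition of $E(K_n)$ into $k$ sets. For a graph $F$ and $X\subseteq V(F)$, $F[X]$ denotes the induced subgraph on $X$. *)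

theory Defs
  imports Complex_Main
begin

definition simple_graph :: "'a set \<Rightarrow> 'a set set \<Rightarrow> bool" where
  "simple_graph V E \<longleftrightarrow> finite V \<and> (\<forall>e\<in>E. \<exists>u v. u \<in> V \<and> v \<in> V \<and> u \<noteq> v \<and> e = {u, v})"

definition is_cycle :: "'a set set \<Rightarrow> 'a list \<Rightarrow> bool" where
  "is_cycle E vs \<longleftrightarrow> length vs \<ge> 3 \<and> distinct vs \<and>
     (\<forall>i < length vs - 1. {vs ! i, vs ! (i+1)} \<in> E) \<and> {last vs, hd vs} \<in> E"

definition forest :: "'a set \<Rightarrow> 'a set set \<Rightarrow> bool" where
  "forest V E \<longleftrightarrow> simple_graph V E \<and> \<not> (\<exists>vs. set vs \<subseteq> V \<and> is_cycle E vs)"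

definition complete_edges :: "nat \<Rightarrow> nat set set" where
  "complete_edges n = {{u, v} | u v. u < n \<and> v < n \<and> u \<noteq> v}"

definition multicolouring :: "nat \<Rightarrow> nat \<Rightarrow> (nat \<Rightarrow> nat set set) \<Rightarrow> bool" where
  "multicolouring k n G \<longleftrightarrow>
     (\<forall>i\<in>{1..k}. G i \<subseteq> complete_edges n) \<and>
     (\<forall>i\<in>{1..k}. \<forall>j\<in>{1..k}. i \<noteq> j \<longrightarrow> G i \<inter> G j = {}) \<and>
     (\<Union>i\<in>{1..k}. G i) = complete_edges n"

definition induced_edges :: "'a set set \<Rightarrow> 'a set \<Rightarrow> 'a set set" where
  "induced_edges E X = {e \<in> E. e \<subseteq> X}"

definition graph_iso :: "'a set \<Rightarrow> 'a set set \<Rightarrow> 'b set \<Rightarrow> 'b set set \<Rightarrow> bool" where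
  "graph_iso V E W F \<longleftrightarrow> (\<exists>f. bij_betw f V W \<and>
     (\<forall>u\<in>V. \<forall>v\<in>V. {u, v} \<in> E \<longleftrightarrow> {f u, f v} \<in> F))"

end

theory Submission
  imports Defs "HOL-Library.Ramsey" "HOL-Library.Infinite_Set"
begin

text \<open>A Roedl type argument (iterated embedding of \<open>H\<close> or passing to a sparse pair, then Ramsey's theorem
  for pairs) either yields a copy of \<open>H\<close> in two colours, or many linear blocks such that all colours
  but one, renamed to \<open>0\<close>, are sparse between blocks. If no two linear parts of blocks are complete to
  each other in colour \<open>0\<close>, then a copy of \<open>H\<close> with edges of a single colour \<open>\<kappa>\<close> and nonedges of colour \<open>0\<close>
  is found as follows. By Ramsey's theorem and passing to subsets, whether a given small tree occurs
  with one vertex in each block of a given family depends on the family only through its size and the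
  position of the root, and is not affected by further shrinking. Choose a vertex \<open>x\<close> of block \<open>u\<close>
  and a block \<open>v\<close> such that the relative degree of \<open>x\<close> in \<open>v\<close> is essentially maximal. If many other
  blocks have comparable degree to \<open>v\<close>, then leaves in \<open>v\<close> can be attached to arbitrary vertices of a
  tree, and \<open>H\<close> is built leaf by leaf. If many other blocks have much smaller degree to \<open>v\<close>, then trees
  with root in \<open>u\<close> meet \<open>v\<close> almost only through their root, so that they can be joined to trees with
  root in \<open>v\<close>; hence the trees that occur are closed under joining roots by an edge, and \<open>H\<close> extended
  by a root is among them.\<close>

subsection \<open>Ramsey's theorem and stabilisation\<close>

text \<open>Between sparse blocks the degrees in the nonzero colours may differ by unbounded
  factors, so no fixed threshold regularises them, and every restriction to neighbourhoods may
  destroy copies found before. The way out is an indirect argument in a stabilised family: each item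
  either survives all \<open>\<kappa>f\<close>-shrinkings or does not occur at all, so it is enough
  to build, once and after any allowed shrinking, an item that was declared impossible. There are
  boundedly many items, hence boundedly many shrinkings, and all constants depend on
  \<open>k\<close> and \<open>H\<close> only. Ramsey's theorem makes the answer depend on the size
  of an index set and on nothing but the order inside it. A root or a new leaf must therefore sit in
  an extreme block, which is why the sides on which other blocks lie are recorded together with
  their degrees. The gap factor \<open>K\<close> is about \<open>2 * k * sz r\<close>: the root of a
  tree sees a \<open>1/k\<close> share of its neighbourhood in one colour, and the remaining at most
  \<open>sz r\<close> vertices must not spoil more than half of that share.\<close>

lemma ramsey_colours:
  assumes "finite C"
  shows "\<exists>N::nat. \<forall>V::nat set. finite V \<longrightarrow> N \<le> card V \<longrightarrow>
    (\<forall>f. (\<forall>A\<in>nsets V r. f A \<in> C) \<longrightarrow>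
      (\<exists>Q\<subseteq>V. card Q = m \<and> (\<forall>A\<in>nsets Q r. \<forall>A'\<in>nsets Q r. f A = f A')))"
proof -
  \<comment> \<open>\<open>ramsey_full\<close> speaks of numbered colours on an initial segment, so
    colours are transported by \<open>h\<close> and vertices by \<open>g\<close>.\<close>
  obtain h where h: "bij_betw h C {0..<card C}"
    using ex_bij_betw_finite_nat[OF assms] by blast
  obtain N :: nat where N: "partn_lst {..<N} (replicate (card C) m) r"
    using ramsey_full by blast
  show ?thesis
  proof (intro exI[of _ N] allI impI)
    fix V :: "nat set" and f
    assume V: "finite V" "N \<le> card V" and f: "\<forall>A\<in>nsets V r. f A \<in> C"
    obtain V0 where V0: "V0 \<subseteq> V" "card V0 = N" "finite V0"
      using V obtain_subset_with_card_n by metis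
    obtain g where g: "bij_betw g {..<N} V0"
      using V0 by (metis bij_betw_iff_card card_lessThan finite_lessThan)
    have inj: "inj_on g {..<N}" and img: "g ` {..<N} = V0"
      using g by (auto simp: bij_betw_def)
    have gA: "g ` A \<in> nsets V r" if "A \<in> nsets {..<N} r" for A
    proof -
      have "A \<subseteq> {..<N}" "finite A" "card A = r" using that by (auto simp: nsets_def)
      then have "card (g ` A) = r" using card_image inj_on_subset[OF inj] by metis
      moreover have "g ` A \<subseteq> V" using img V0 \<open>A \<subseteq> {..<N}\<close> by blast
      ultimately show ?thesis using \<open>finite A\<close> by (simp add: nsets_def)
    qed
    have "(\<lambda>A. h (f (g ` A))) \<in> nsets {..<N} r \<rightarrow> {..<length (replicate (card C) m)}"
    proof
      fix A assume "A \<in> nsets {..<N} r"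
      then have "f (g ` A) \<in> C" using f gA by blast
      then show "h (f (g ` A)) \<in> {..<length (replicate (card C) m)}"
        using h by (auto simp: bij_betw_def)
    qed
    then obtain i H where i: "i < card C" and H: "H \<in> nsets {..<N} (replicate (card C) m ! i)"
      and mono: "(\<lambda>A. h (f (g ` A))) ` nsets H r \<subseteq> {i}"
      using partn_lstE[OF N] by (metis length_replicate)
    have H': "H \<subseteq> {..<N}" "card H = m" "finite H"
      using H i by (auto simp: nsets_def)
    show "\<exists>Q\<subseteq>V. card Q = m \<and> (\<forall>A\<in>nsets Q r. \<forall>A'\<in>nsets Q r. f A = f A')"
    proof (intro exI[of _ "g ` H"] conjI ballI)
      show "g ` H \<subseteq> V" using H' img V0 by blast
      show "card (g ` H) = m" using H' card_image inj_on_subset[OF inj] by metis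
      fix A A' assume "A \<in> nsets (g ` H) r" "A' \<in> nsets (g ` H) r"
      moreover have "\<exists>D\<in>nsets H r. D' = g ` D" if "D' \<in> nsets (g ` H) r" for D'
      proof -
        have D': "D' \<subseteq> g ` H" "card D' = r" "finite D'" using that by (auto simp: nsets_def)
        then obtain D where "D \<subseteq> H" "D' = g ` D" by (meson subset_image_iff)
        moreover have "card D = r" using D' calculation H' inj
          by (metis card_image inj_on_subset)
        ultimately show ?thesis using H' by (auto simp: nsets_def intro: finite_subset)
      qed
      ultimately obtain D D' where DD: "D \<in> nsets H r" "A = g ` D" "D' \<in> nsets H r" "A' = g ` D'"
        by metis
      have "h (f A) = h (f A')" using mono DD by blast
      moreover have "f A \<in> C" "f A' \<in> C"
        using DD gA f nsets_mono[OF H'(1)] by blast+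
      ultimately show "f A = f A'" using h by (auto simp: bij_betw_def dest: inj_onD)
    qed
  qed
qed

text \<open>In the application \<open>f A\<close> is the set of items realised on the blocks with
  index in \<open>A\<close>, and \<open>s\<close> bounds the number of blocks an item
  occupies.\<close>

definition homogeneous :: "(nat set \<Rightarrow> 'c) \<Rightarrow> nat \<Rightarrow> nat set \<Rightarrow> bool" where
  "homogeneous f s Q \<longleftrightarrow> (\<forall>A A'. A \<subseteq> Q \<longrightarrow> A' \<subseteq> Q \<longrightarrow> card A = card A' \<longrightarrow> card A \<le> s \<longrightarrow> f A = f A')"

lemma homogeneousD:
  "homogeneous f s Q \<Longrightarrow> A \<subseteq> Q \<Longrightarrow> A' \<subseteq> Q \<Longrightarrow> card A = card A' \<Longrightarrow> card A \<le> s \<Longrightarrow> f A = f A'"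
  unfolding homogeneous_def by (elim allE impE)

text \<open>Large sizes are treated first: Ramsey's theorem for \<open>Suc s\<close>-sets is applied
  with the number \<open>N\<close> that the induction hypothesis for sizes up to \<open>s\<close>
  asks for, and constancy on \<open>Suc s\<close>-sets is inherited by the subset chosen
  afterwards.\<close>

lemma ramsey_uniform:
  fixes C :: "'c set"
  assumes "finite C"
  shows "\<exists>N::nat. \<forall>V::nat set. finite V \<longrightarrow> N \<le> card V \<longrightarrow>
    (\<forall>f. (\<forall>A. A \<subseteq> V \<longrightarrow> f A \<in> C) \<longrightarrow> (\<exists>Q\<subseteq>V. card Q = m \<and> homogeneous f s Q))"
proof (induction s)
  case 0
  show ?case
  proof (intro exI[of _ m] allI impI)
    fix V :: "nat set" and f :: "nat set \<Rightarrow> 'c" assume V: "finite V" "m \<le> card V"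
    then obtain Q where Q: "Q \<subseteq> V" "card Q = m" "finite Q"
      using obtain_subset_with_card_n by metis
    have "homogeneous f 0 Q"
      unfolding homogeneous_def
    proof (intro allI impI)
      fix A A' assume A: "A \<subseteq> Q" "A' \<subseteq> Q" "card A = card A'" "card A \<le> 0"
      have "finite A" "finite A'" using A Q finite_subset by auto
      then show "f A = f A'" using A by simp
    qed
    then show "\<exists>Q\<subseteq>V. card Q = m \<and> homogeneous f 0 Q"
      using Q by blast
  qed
next
  case (Suc s)
  then obtain N where N: "\<forall>V::nat set. finite V \<longrightarrow> N \<le> card V \<longrightarrow>
    (\<forall>f. (\<forall>A. A \<subseteq> V \<longrightarrow> f A \<in> C) \<longrightarrow> (\<exists>Q\<subseteq>V. card Q = m \<and> homogeneous f s Q))" ..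
  obtain N' where N': "\<forall>V::nat set. finite V \<longrightarrow> N' \<le> card V \<longrightarrow>
    (\<forall>f. (\<forall>A\<in>nsets V (Suc s). f A \<in> C) \<longrightarrow>
      (\<exists>Q\<subseteq>V. card Q = N \<and> (\<forall>A\<in>nsets Q (Suc s). \<forall>A'\<in>nsets Q (Suc s). f A = f A')))"
    using ramsey_colours[OF assms, of "Suc s" N] ..
  show ?case
  proof (intro exI[of _ N'] allI impI)
    fix V :: "nat set" and f :: "nat set \<Rightarrow> 'c"
    assume V: "finite V" "N' \<le> card V" and f: "\<forall>A. A \<subseteq> V \<longrightarrow> f A \<in> C"
    have fV: "\<forall>A\<in>nsets V (Suc s). f A \<in> C" using f by (auto simp: nsets_def)
    obtain Q where Q: "Q \<subseteq> V" "card Q = N"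
      and homQ: "\<And>A A'. A\<in>nsets Q (Suc s) \<Longrightarrow> A'\<in>nsets Q (Suc s) \<Longrightarrow> f A = f A'"
      using N'[rule_format, OF V, of f] fV by (auto simp only:)
    have finQ: "finite Q" using Q V finite_subset by auto
    have "N \<le> card Q" and fQ: "\<forall>A. A \<subseteq> Q \<longrightarrow> f A \<in> C" using Q f by auto
    from N[THEN spec, of Q, THEN mp, OF finQ, THEN mp, OF this(1), THEN spec, of f, THEN mp, OF fQ]
    obtain Q' where Q': "Q' \<subseteq> Q" "card Q' = m" and homQ': "homogeneous f s Q'" by blast
    have "homogeneous f (Suc s) Q'"
      unfolding homogeneous_def
    proof (intro allI impI)
      fix A A' assume A: "A \<subseteq> Q'" "A' \<subseteq> Q'" "card A = card A'" "card A \<le> Suc s"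
      show "f A = f A'"
      proof (cases "card A \<le> s")
        case True then show ?thesis using A homogeneousD[OF homQ'] by blast
      next
        case False
        then have "card A = Suc s" "card A' = Suc s" using A by auto
        then have "A \<in> nsets Q (Suc s)" "A' \<in> nsets Q (Suc s)"
          using A Q' finQ by (auto simp: nsets_def intro: finite_subset)
        then show ?thesis by (rule homQ)
      qed
    qed
    then show "\<exists>Q\<subseteq>V. card Q = m \<and> homogeneous f (Suc s) Q"
      using Q(1) Q' by blast
  qed
qed

text \<open>The smaller family comes first. The factors of successive restrictions multiply, and
  each must be paid for in the constants.\<close>

definition contr :: "real \<Rightarrow> 'i set \<Rightarrow> ('i \<Rightarrow> 'a set) \<Rightarrow> ('i \<Rightarrow> 'a set) \<Rightarrow> bool" where
  "contr \<kappa> Q B' B \<longleftrightarrow> (\<forall>i\<in>Q. B' i \<subseteq> B i \<and> \<kappa> * real (card (B i)) \<le> real (card (B' i)))"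

lemma contr_refl: "\<kappa> \<le> 1 \<Longrightarrow> contr \<kappa> Q B B"
  by (auto simp: contr_def mult_left_le_one_le intro: order_trans[OF mult_right_mono])

lemma contr_weaken: "contr \<kappa> Q B' B \<Longrightarrow> \<kappa>' \<le> \<kappa> \<Longrightarrow> contr \<kappa>' Q B' B"
  unfolding contr_def by (meson mult_right_mono of_nat_0_le_iff order_trans)

lemma contr_trans:
  assumes "contr a Q C B" "contr b Q D C" "0 \<le> b"
  shows "contr (a * b) Q D B"
  unfolding contr_def
proof (intro ballI conjI)
  fix i assume i: "i \<in> Q"
  show "D i \<subseteq> B i" using assms i by (auto simp: contr_def)
  have "a * b * card (B i) = b * (a * card (B i))" by simp
  also have "\<dots> \<le> b * card (C i)" using assms i by (auto simp: contr_def intro: mult_left_mono)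
  also have "\<dots> \<le> card (D i)" using assms i by (auto simp: contr_def)
  finally show "a * b * card (B i) \<le> card (D i)" .
qed

text \<open>The number of true \<open>F j\<close> is a potential. While some true property can be
  destroyed by a \<open>\<kappa>\<close>-shrinking, that shrinking is carried out; by monotonicity
  no false property becomes true, so there are at most \<open>card J\<close> rounds. The total loss
  thus does not depend on \<open>B\<close>.\<close>

lemma stabilise:
  fixes F :: "'j \<Rightarrow> ('i \<Rightarrow> 'a set) \<Rightarrow> bool"
  assumes J: "finite J" and \<kappa>: "0 < \<kappa>" "\<kappa> \<le> 1"
    and mono: "\<And>j B B'. j \<in> J \<Longrightarrow> (\<forall>i\<in>Q. B' i \<subseteq> B i) \<Longrightarrow> F j B' \<Longrightarrow> F j B"
  shows "\<exists>B'. contr (\<kappa> ^ card J) Q B' B \<and>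
    (\<forall>j\<in>J. \<not> F j B' \<or> (\<forall>C. contr \<kappa> Q C B' \<longrightarrow> F j C))"
proof -
  have "\<exists>B'. contr (\<kappa> ^ card {j\<in>J. F j B}) Q B' B \<and>
    (\<forall>j\<in>J. \<not> F j B' \<or> (\<forall>C. contr \<kappa> Q C B' \<longrightarrow> F j C))" for B
  proof (induction "card {j\<in>J. F j B}" arbitrary: B rule: less_induct)
    case less
    show ?case
    proof (cases "\<forall>j\<in>J. \<not> F j B \<or> (\<forall>C. contr \<kappa> Q C B \<longrightarrow> F j C)")
      case True
      then show ?thesis
        using contr_refl[of "\<kappa> ^ card {j\<in>J. F j B}" Q B] \<kappa> by (auto simp: power_le_one)
    next
      case False
      then obtain j C where j: "j \<in> J" "F j B" and C: "contr \<kappa> Q C B" "\<not> F j C" by blast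
      have sub: "\<forall>i\<in>Q. C i \<subseteq> B i" using C by (auto simp: contr_def)
      have "{j\<in>J. F j C} \<subset> {j\<in>J. F j B}"
        using mono[OF _ sub] j C by blast
      then have lt: "card {j\<in>J. F j C} < card {j\<in>J. F j B}"
        using J by (simp add: psubset_card_mono)
      from less[OF lt] obtain B' where B': "contr (\<kappa> ^ card {j\<in>J. F j C}) Q B' C"
        "\<forall>j\<in>J. \<not> F j B' \<or> (\<forall>C. contr \<kappa> Q C B' \<longrightarrow> F j C)" by blast
      have "contr (\<kappa> * \<kappa> ^ card {j\<in>J. F j C}) Q B' B"
        using contr_trans[OF C(1) B'(1)] \<kappa> by simp
      moreover have "\<kappa> ^ card {j\<in>J. F j B} \<le> \<kappa> * \<kappa> ^ card {j\<in>J. F j C}"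
        using lt \<kappa> power_decreasing[of "Suc (card {j\<in>J. F j C})" "card {j\<in>J. F j B}" \<kappa>] by simp
      ultimately show ?thesis using B'(2) contr_weaken by blast
    qed
  qed
  then obtain B' where B': "contr (\<kappa> ^ card {j\<in>J. F j B}) Q B' B"
    "\<forall>j\<in>J. \<not> F j B' \<or> (\<forall>C. contr \<kappa> Q C B' \<longrightarrow> F j C)" by blast
  have "\<kappa> ^ card J \<le> \<kappa> ^ card {j\<in>J. F j B}"
    using \<kappa> J by (intro power_decreasing card_mono) auto
  then show ?thesis using B' contr_weaken by blast
qed

subsection \<open>Relative degrees\<close>

lemma sum_card_swap:
  assumes "finite A" "finite B"
  shows "(\<Sum>x\<in>A. card {y\<in>B. P x y}) = (\<Sum>y\<in>B. card {x\<in>A. P x y})"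
proof -
  have c: "card {y\<in>B. R y} = (\<Sum>y\<in>B. if R y then 1 else 0)" if "finite B" for B and R :: "'z \<Rightarrow> bool"
    using that by (simp add: sum.If_cases Int_def)
  show ?thesis
    using assms by (simp add: c sum.swap[of _ A B])
qed

text \<open>Averaging: if every \<open>x\<close> of positive gain lost more than \<open>L\<close>
  times its gain, so would the sum. Positive gain is kept in the conclusion because the element
  found has to enlarge a maximal collection strictly.\<close>

lemma exists_good_ratio:
  fixes g l :: "'a \<Rightarrow> real"
  assumes "finite A" "0 < (\<Sum>x\<in>A. g x)" "(\<Sum>x\<in>A. l x) \<le> L * (\<Sum>x\<in>A. g x)"
    and "\<And>x. x \<in> A \<Longrightarrow> 0 \<le> g x" "\<And>x. x \<in> A \<Longrightarrow> 0 \<le> l x" "0 \<le> L"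
  shows "\<exists>x\<in>A. 0 < g x \<and> l x \<le> L * g x"
proof (rule ccontr)
  assume "\<not> ?thesis"
  then have n: "\<And>x. x \<in> A \<Longrightarrow> 0 < g x \<Longrightarrow> L * g x < l x" by force
  obtain x where x: "x \<in> A" "0 < g x"
    using assms(2) sum_nonpos[of A g] by (metis linorder_not_less)
  have "(\<Sum>x\<in>A. L * g x) < (\<Sum>x\<in>A. l x)"
  proof (rule sum_strict_mono_ex1[OF assms(1)])
    show "\<forall>x\<in>A. L * g x \<le> l x"
      using n assms(4,5) by (metis less_eq_real_def mult_zero_right)
    show "\<exists>x\<in>A. L * g x < l x" using x n by blast
  qed
  then show False using assms(3) by (simp add: sum_distrib_left)
qed

locale coloured =
  fixes c :: "'a \<Rightarrow> 'a \<Rightarrow> nat"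
  assumes sym: "c x y = c y x"
begin

definition nb :: "'a \<Rightarrow> 'a set \<Rightarrow> 'a set" where "nb x A = {y\<in>A. c x y \<noteq> 0}"
definition rd :: "'a \<Rightarrow> 'a set \<Rightarrow> real" where "rd x A = card (nb x A) / card A"

lemma nb_subset: "nb x A \<subseteq> A" by (auto simp: nb_def)

lemma rd_nonneg: "0 \<le> rd x A" by (simp add: rd_def)

text \<open>Averaging yields a vertex \<open>z\<close> whose relative loss in the other blocks is at most \<open>L\<close>
  times its relative gain; \<open>X\<close> is a maximal set built from such vertices.\<close>

lemma selective_cover:
  fixes F L0 L :: real
  assumes fin: "finite Cv" "Cv \<noteq> {}" "finite Du" "Du \<noteq> {}" "finite W"
    and D: "\<And>w. w \<in> W \<Longrightarrow> finite (D w) \<and> D w \<noteq> {}"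
    and pos: "0 < F" "0 < L0" "1 \<le> L" "2 * L0 * card W \<le> L"
    and low: "\<And>y. y \<in> Du \<Longrightarrow> F / L0 * card Cv \<le> card {z\<in>Cv. c y z = \<kappa>}"
    and upp: "\<And>w y. w \<in> W \<Longrightarrow> y \<in> D w \<Longrightarrow> card {z\<in>Cv. c y z \<noteq> 0} \<le> F * card Cv"
    and small: "\<And>z. z \<in> Cv \<Longrightarrow> card {y\<in>Du. c y z = \<kappa>} \<le> card Du / (4 * L)"
  shows "\<exists>X\<subseteq>Cv. card Du / (4 * L) \<le> card {y\<in>Du. \<exists>z\<in>X. c y z = \<kappa>} \<and>
    (\<forall>w\<in>W. card {y\<in>D w. \<exists>z\<in>X. c y z \<noteq> 0} \<le> card (D w) / 2)"
proof -
  define gain where "gain X = card {y\<in>Du. \<exists>z\<in>X. c y z = \<kappa>} / card Du" for X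
  define loss where "loss X = (\<Sum>w\<in>W. card {y\<in>D w. \<exists>z\<in>X. c y z \<noteq> 0} / card (D w))" for X
  \<comment> \<open>The cap on \<open>gain\<close> turns the ratio bound into a total loss of at
    most 1/2. By \<open>small\<close> a single vertex gains at most \<open>1 / (4 * L)\<close>, so a
    collection below half of the cap can be extended without exceeding it.\<close>
  define XX where "XX = {X. X \<subseteq> Cv \<and> loss X \<le> L * gain X \<and> gain X \<le> 1 / (2 * L)}"
  have cDu: "0 < real (card Du)" using fin by (simp add: card_gt_0_iff)
  have cCv: "0 < real (card Cv)" using fin by (simp add: card_gt_0_iff)
  have cD: "0 < real (card (D w))" if "w \<in> W" for w using D[OF that] by (simp add: card_gt_0_iff)
  have "finite XX" using fin(1) by (auto simp: XX_def)
  moreover have "{} \<in> XX" using pos by (simp add: XX_def gain_def loss_def)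
  ultimately obtain X where X: "X \<in> XX" and max: "\<And>Y. Y \<in> XX \<Longrightarrow> X \<subseteq> Y \<Longrightarrow> X = Y"
    using finite_has_maximal[of XX] by blast
  have Xs: "X \<subseteq> Cv" "loss X \<le> L * gain X" "gain X \<le> 1 / (2 * L)" using X by (auto simp: XX_def)
  have "1 / (4 * L) \<le> gain X"
  proof (rule ccontr)
    assume "\<not> ?thesis"
    then have gX: "gain X < 1 / (4 * L)" by simp
    define U where "U = {y\<in>Du. \<not> (\<exists>z\<in>X. c y z = \<kappa>)}"
    define g where "g z = card {y\<in>U. c y z = \<kappa>} / card Du" for z
    define l where "l z = (\<Sum>w\<in>W. card {y\<in>D w. c y z \<noteq> 0} / card (D w))" for z
    have finU: "finite U" using fin by (simp add: U_def)
    \<comment> \<open>Averaging takes place over the uncovered part \<open>U\<close> only.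
      Restricting to it costs a factor 2 in the gain, which is the 2 in
      \<open>2 * L0 * card W \<le> L\<close>; the other factors are the ratio \<open>L0\<close>
      between upper and lower degree bounds and the number of blocks that may lose.\<close>
    have cardU: "card Du / 2 \<le> card U"
    proof -
      have eq: "card Du = card {y\<in>Du. \<exists>z\<in>X. c y z = \<kappa>} + card U"
        unfolding U_def using fin(3)
        by (subst card_Un_disjoint[symmetric]) (auto intro: arg_cong[where f=card])
      have "1 / (4 * L) \<le> 1 / 2" using pos by (simp add: field_simps)
      then have "gain X \<le> 1/2" using gX by simp
      then have "real (card {y\<in>Du. \<exists>z\<in>X. c y z = \<kappa>}) \<le> card Du / 2"
        using cDu by (simp add: gain_def field_simps)
      then show ?thesis using eq by linarith
    qed
    have "(\<Sum>z\<in>Cv. g z) = real (\<Sum>z\<in>Cv. card {y\<in>U. c y z = \<kappa>}) / card Du"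
      by (simp add: g_def sum_divide_distrib)
    also have "(\<Sum>z\<in>Cv. card {y\<in>U. c y z = \<kappa>}) = (\<Sum>y\<in>U. card {z\<in>Cv. c y z = \<kappa>})"
      by (rule sum_card_swap[OF fin(1) finU])
    finally have gs: "(\<Sum>z\<in>Cv. g z) = (\<Sum>y\<in>U. real (card {z\<in>Cv. c y z = \<kappa>})) / card Du" by simp
    have "card U * (F / L0 * card Cv) \<le> (\<Sum>y\<in>U. real (card {z\<in>Cv. c y z = \<kappa>}))"
      using low by (intro sum_bounded_below) (auto simp: U_def)
    moreover have "card Du / 2 * (F / L0 * card Cv) \<le> card U * (F / L0 * card Cv)"
      using cardU pos by (intro mult_right_mono) auto
    ultimately have "card Du / 2 * (F / L0 * card Cv) / card Du \<le> (\<Sum>z\<in>Cv. g z)"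
      unfolding gs using cDu by (intro divide_right_mono) auto
    then have glow: "F / L0 * card Cv / 2 \<le> (\<Sum>z\<in>Cv. g z)" using cDu by simp
    have "(\<Sum>z\<in>Cv. l z) = (\<Sum>w\<in>W. real (\<Sum>z\<in>Cv. card {y\<in>D w. c y z \<noteq> 0}) / card (D w))"
      by (simp add: l_def sum.swap[of _ W Cv] sum_divide_distrib)
    also have "\<dots> \<le> (\<Sum>w\<in>W. F * card Cv)"
    proof (rule sum_mono)
      fix w assume w: "w \<in> W"
      have "(\<Sum>z\<in>Cv. card {y\<in>D w. c y z \<noteq> 0}) = (\<Sum>y\<in>D w. card {z\<in>Cv. c y z \<noteq> 0})"
        using D[OF w] by (intro sum_card_swap[OF fin(1)]) auto
      then have "real (\<Sum>z\<in>Cv. card {y\<in>D w. c y z \<noteq> 0}) = (\<Sum>y\<in>D w. real (card {z\<in>Cv. c y z \<noteq> 0}))"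
        by simp
      also have "\<dots> \<le> card (D w) * (F * card Cv)"
        using upp[OF w] by (intro sum_bounded_above) auto
      finally show "real (\<Sum>z\<in>Cv. card {y\<in>D w. c y z \<noteq> 0}) / card (D w) \<le> F * card Cv"
        using cD[OF w] by (simp add: field_simps)
    qed
    also have "\<dots> = (2 * L0 * card W) * (F / L0 * card Cv / 2)" using pos by simp
    also have "\<dots> \<le> L * (F / L0 * card Cv / 2)"
      using pos by (intro mult_right_mono) auto
    also have "\<dots> \<le> L * (\<Sum>z\<in>Cv. g z)"
      using glow pos by (intro mult_left_mono) auto
    finally have lle: "(\<Sum>z\<in>Cv. l z) \<le> L * (\<Sum>z\<in>Cv. g z)" .
    have "0 < F / L0 * card Cv / 2" using pos cCv by simp
    then have "0 < (\<Sum>z\<in>Cv. g z)" using glow by linarith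
    moreover have "0 \<le> g z" "0 \<le> l z" for z by (auto simp: g_def l_def intro!: sum_nonneg)
    ultimately obtain z where z: "z \<in> Cv" "0 < g z" "l z \<le> L * g z"
      using exists_good_ratio[OF fin(1) _ lle] pos by (meson order_trans zero_le_one)
    have g_eq: "gain (insert z X) = gain X + g z"
    proof -
      have "{y\<in>Du. \<exists>z'\<in>insert z X. c y z' = \<kappa>} = {y\<in>Du. \<exists>z\<in>X. c y z = \<kappa>} \<union> {y\<in>U. c y z = \<kappa>}"
        by (auto simp: U_def)
      moreover have "card \<dots> = card {y\<in>Du. \<exists>z\<in>X. c y z = \<kappa>} + card {y\<in>U. c y z = \<kappa>}"
        using fin(3) finU by (intro card_Un_disjoint) (auto simp: U_def)
      ultimately show ?thesis by (simp add: gain_def g_def add_divide_distrib)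
    qed
    have l_le: "loss (insert z X) \<le> loss X + l z"
      unfolding loss_def l_def sum.distrib[symmetric]
    proof (rule sum_mono)
      fix w assume w: "w \<in> W"
      have "{y\<in>D w. \<exists>z'\<in>insert z X. c y z' \<noteq> 0} = {y\<in>D w. \<exists>z\<in>X. c y z \<noteq> 0} \<union> {y\<in>D w. c y z \<noteq> 0}"
        by auto
      then have "card {y\<in>D w. \<exists>z'\<in>insert z X. c y z' \<noteq> 0} \<le>
          card {y\<in>D w. \<exists>z\<in>X. c y z \<noteq> 0} + card {y\<in>D w. c y z \<noteq> 0}"
        by (simp only: card_Un_le)
      then have "real (card {y\<in>D w. \<exists>z'\<in>insert z X. c y z' \<noteq> 0}) \<le>
          real (card {y\<in>D w. \<exists>z\<in>X. c y z \<noteq> 0}) + real (card {y\<in>D w. c y z \<noteq> 0})"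
        by linarith
      then show "card {y\<in>D w. \<exists>z'\<in>insert z X. c y z' \<noteq> 0} / card (D w) \<le>
          card {y\<in>D w. \<exists>z\<in>X. c y z \<noteq> 0} / card (D w) + card {y\<in>D w. c y z \<noteq> 0} / card (D w)"
        unfolding add_divide_distrib[symmetric] by (intro divide_right_mono) auto
    qed
    have "card {y\<in>U. c y z = \<kappa>} \<le> card {y\<in>Du. c y z = \<kappa>}"
      using fin(3) by (intro card_mono) (auto simp: U_def)
    then have "real (card {y\<in>U. c y z = \<kappa>}) \<le> card Du / (4 * L)"
      using small[OF z(1)] by linarith
    then have "g z \<le> 1 / (4 * L)" using cDu pos by (simp add: g_def field_simps)
    then have "gain (insert z X) \<le> 1 / (2 * L)" using gX g_eq by (simp add: field_simps)
    moreover have "loss (insert z X) \<le> L * gain (insert z X)"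
      using l_le g_eq z Xs by (simp add: algebra_simps)
    ultimately have "insert z X \<in> XX" using z Xs by (simp add: XX_def)
    then have "insert z X = X" using max by blast
    then show False using g_eq z by simp
  qed
  then have "card Du / (4 * L) \<le> card {y\<in>Du. \<exists>z\<in>X. c y z = \<kappa>}"
    using cDu by (simp add: gain_def field_simps)
  moreover have "card {y\<in>D w. \<exists>z\<in>X. c y z \<noteq> 0} \<le> card (D w) / 2" if w: "w \<in> W" for w
  proof -
    have "card {y\<in>D w. \<exists>z\<in>X. c y z \<noteq> 0} / card (D w) \<le> loss X"
      unfolding loss_def using w fin(5) by (intro member_le_sum) auto
    also have "\<dots> \<le> L * (1 / (2 * L))"
      using Xs pos mult_left_mono[of "gain X" "1 / (2 * L)" L] by linarith
    also have "\<dots> = 1/2" using pos by simp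
    finally show ?thesis using cD[OF w] by (simp add: field_simps)
  qed
  ultimately show ?thesis using Xs by blast
qed

end

section \<open>Pigeonhole, medians and separation of degrees\<close>

lemma popular:
  assumes "finite A" "finite I" "I \<noteq> {}" "\<And>x. x \<in> A \<Longrightarrow> \<exists>i\<in>I. P i x"
  shows "\<exists>i\<in>I. card A \<le> card I * card {x\<in>A. P i x}"
proof (rule ccontr)
  assume "\<not> ?thesis"
  then have n: "\<And>i. i \<in> I \<Longrightarrow> card I * card {x\<in>A. P i x} < card A" by force
  have "card A \<le> card (\<Union>i\<in>I. {x\<in>A. P i x})"
    using assms by (intro card_mono) auto
  also have "\<dots> \<le> (\<Sum>i\<in>I. card {x\<in>A. P i x})"
    by (rule card_UN_le[OF assms(2)])
  finally have "card I * card A \<le> (\<Sum>i\<in>I. card I * card {x\<in>A. P i x})"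
    by (simp add: sum_distrib_left[symmetric])
  also have "\<dots> < (\<Sum>i\<in>I. card A)"
    using assms n by (intro sum_strict_mono) auto
  finally show False by simp
qed

text \<open>The threshold is the largest value with at least half of \<open>A\<close> at or above
  it. If more than half of \<open>A\<close> lay strictly above it, the next larger value would
  qualify too.\<close>

lemma median:
  fixes f :: "'a \<Rightarrow> real"
  assumes "finite A" "A \<noteq> {}"
  shows "\<exists>t. card A \<le> 2 * card {x\<in>A. t \<le> f x} \<and> card A \<le> 2 * card {x\<in>A. f x \<le> t}"
proof -
  define T where "T = {t\<in>f ` A. card A \<le> 2 * card {x\<in>A. t \<le> f x}}"
  have "finite T" using assms by (simp add: T_def)
  have "{x\<in>A. Min (f ` A) \<le> f x} = A" using assms by auto
  then have "Min (f ` A) \<in> T" using assms by (auto simp: T_def)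
  then have T: "Max T \<in> T" using \<open>finite T\<close> Max_in by blast
  define t where "t = Max T"
  have "card A \<le> 2 * card {x\<in>A. f x \<le> t}"
  proof (rule ccontr)
    assume n: "\<not> ?thesis"
    have eq: "card A = card {x\<in>A. f x \<le> t} + card {x\<in>A. t < f x}"
      using assms by (subst card_Un_disjoint[symmetric]) (auto intro: arg_cong[where f=card])
    then have gt: "card A \<le> 2 * card {x\<in>A. t < f x}" using n by linarith
    have "0 < card A" using assms by (simp add: card_gt_0_iff)
    then have "0 < card {x\<in>A. t < f x}" using gt by linarith
    then have ne: "{x\<in>A. t < f x} \<noteq> {}" by (auto simp only: card.empty)
    define s where "s = Min (f ` {x\<in>A. t < f x})"
    have s: "s \<in> f ` {x\<in>A. t < f x}" unfolding s_def using ne assms by (intro Min_in) auto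
    have "s \<le> f x" if "x \<in> A" "t < f x" for x
      unfolding s_def using that assms by (intro Min_le) auto
    then have "{x\<in>A. t < f x} \<subseteq> {x\<in>A. s \<le> f x}" by auto
    then have "card {x\<in>A. t < f x} \<le> card {x\<in>A. s \<le> f x}" using assms by (intro card_mono) auto
    then have "s \<in> T" using s gt by (auto simp: T_def)
    then have "s \<le> t" unfolding t_def using \<open>finite T\<close> by simp
    then show False using s by auto
  qed
  then show ?thesis using T by (auto simp: T_def t_def)
qed

text \<open>Let \<open>a0\<close>, \<open>a\<close>, \<open>a1\<close> be quartiles of
  \<open>f\<close> and \<open>b0\<close>, \<open>b\<close>, \<open>b1\<close> those of
  \<open>g\<close>. If \<open>K * b0 \<le> a1\<close>, the top quarter of \<open>A\<close> dominates
  the bottom quarter of \<open>B\<close>; the case \<open>K * a0 \<le> b1\<close> is symmetric.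
  Otherwise the quarters just below the medians are comparable, since there
  \<open>f x \<le> a \<le> a1 < K * b0 \<le> K * g y\<close>, and likewise with the roles
  exchanged.\<close>

lemma separate_or_flat:
  fixes f :: "'a \<Rightarrow> real" and g :: "'b \<Rightarrow> real"
  assumes "finite A" "A \<noteq> {}" "finite B" "B \<noteq> {}" and K: "0 \<le> K"
  shows "\<exists>A' B'. A' \<subseteq> A \<and> B' \<subseteq> B \<and> card A \<le> 4 * card A' \<and> card B \<le> 4 * card B' \<and>
    ((\<forall>x\<in>A'. \<forall>y\<in>B'. K * g y \<le> f x) \<or> (\<forall>x\<in>A'. \<forall>y\<in>B'. K * f x \<le> g y) \<or>
     (\<forall>x\<in>A'. \<forall>y\<in>B'. f x < K * g y \<and> g y < K * f x))"
proof -
  have quarters: "\<exists>a a0 a1. a \<le> a1 \<and> card A \<le> 4 * card {x\<in>A. a1 \<le> f x} \<and> card A \<le> 4 * card {x\<in>A. f x \<le> a0} \<and>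
      card A \<le> 4 * card {x\<in>A. a0 \<le> f x \<and> f x \<le> a}"
    if A: "finite A" "A \<noteq> {}" for A :: "'z set" and f :: "'z \<Rightarrow> real"
  proof -
    obtain a where a: "card A \<le> 2 * card {x\<in>A. a \<le> f x}" "card A \<le> 2 * card {x\<in>A. f x \<le> a}"
      using median[OF A] by blast
    let ?H = "{x\<in>A. a \<le> f x}" and ?L = "{x\<in>A. f x \<le> a}"
    have cA: "0 < card A" using A by (simp add: card_gt_0_iff)
    have "0 < card ?H" "0 < card ?L" using a cA by linarith+
    then have ne: "?H \<noteq> {}" "?L \<noteq> {}" by (auto simp only: card.empty)
    obtain a1 where a1: "card ?H \<le> 2 * card {x\<in>?H. a1 \<le> f x}" "card ?H \<le> 2 * card {x\<in>?H. f x \<le> a1}"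
      using median[of ?H f] ne A by auto
    obtain a0 where a0: "card ?L \<le> 2 * card {x\<in>?L. a0 \<le> f x}" "card ?L \<le> 2 * card {x\<in>?L. f x \<le> a0}"
      using median[of ?L f] ne A by auto
    have "0 < card {x\<in>?H. f x \<le> a1}" using a1(2) \<open>0 < card ?H\<close> by linarith
    then have "{x\<in>?H. f x \<le> a1} \<noteq> {}" by (auto simp only: card.empty)
    then have "a \<le> a1" by auto
    moreover have "card {x\<in>?H. a1 \<le> f x} \<le> card {x\<in>A. a1 \<le> f x}" using A by (intro card_mono) auto
    moreover have "card {x\<in>?L. f x \<le> a0} \<le> card {x\<in>A. f x \<le> a0}" using A by (intro card_mono) auto
    moreover have "card {x\<in>?L. a0 \<le> f x} \<le> card {x\<in>A. a0 \<le> f x \<and> f x \<le> a}" using A by (intro card_mono) auto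
    ultimately show ?thesis using a a0 a1 by (intro exI[of _ a] exI[of _ a0] exI[of _ a1]) linarith
  qed
  obtain a a0 a1 where a: "a \<le> a1" "card A \<le> 4 * card {x\<in>A. a1 \<le> f x}" "card A \<le> 4 * card {x\<in>A. f x \<le> a0}"
      "card A \<le> 4 * card {x\<in>A. a0 \<le> f x \<and> f x \<le> a}"
    using quarters[OF assms(1,2), of f] by blast
  obtain b b0 b1 where b: "b \<le> b1" "card B \<le> 4 * card {x\<in>B. b1 \<le> g x}" "card B \<le> 4 * card {x\<in>B. g x \<le> b0}"
      "card B \<le> 4 * card {x\<in>B. b0 \<le> g x \<and> g x \<le> b}"
    using quarters[OF assms(3,4), of g] by blast
    consider "K * b0 \<le> a1" | "K * a0 \<le> b1" | "a1 < K * b0" "b1 < K * a0" by linarith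
    then show ?thesis
    proof cases
      case 1
      have "\<forall>x\<in>{x\<in>A. a1 \<le> f x}. \<forall>y\<in>{x\<in>B. g x \<le> b0}. K * g y \<le> f x"
        using 1 K by (auto intro: order_trans[OF mult_left_mono])
      then show ?thesis using a b
        by (intro exI[of _ "{x\<in>A. a1 \<le> f x}"] exI[of _ "{x\<in>B. g x \<le> b0}"]) auto
    next
      case 2
      have "\<forall>x\<in>{x\<in>A. f x \<le> a0}. \<forall>y\<in>{x\<in>B. b1 \<le> g x}. K * f x \<le> g y"
        using 2 K by (auto intro: order_trans[OF mult_left_mono])
      then show ?thesis using a b
        by (intro exI[of _ "{x\<in>A. f x \<le> a0}"] exI[of _ "{x\<in>B. b1 \<le> g x}"]) auto
    next
      case 3
      have "f x < K * g y \<and> g y < K * f x" if "a0 \<le> f x" "f x \<le> a" "b0 \<le> g y" "g y \<le> b" for x y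
        using that 3 a(1) b(1) mult_left_mono[OF that(1) K] mult_left_mono[OF that(3) K] by linarith
      then show ?thesis using a b
        by (intro exI[of _ "{x\<in>A. a0 \<le> f x \<and> f x \<le> a}"] exI[of _ "{x\<in>B. b0 \<le> g x \<and> g x \<le> b}"]) auto
    qed
qed


context coloured
begin

lemma majority_colour:
  assumes "finite A" "1 \<le> k" "\<And>y. y \<in> A \<Longrightarrow> c x y \<le> k"
  shows "\<exists>\<kappa>\<in>{1..k}. card (nb x A) \<le> k * card {y\<in>A. c x y = \<kappa>}"
proof -
  have "\<exists>\<kappa>\<in>{1..k}. c x y = \<kappa>" if "y \<in> nb x A" for y
    using that assms(3) by (auto simp: nb_def)
  then obtain \<kappa> where "\<kappa> \<in> {1..k}" "card (nb x A) \<le> card {1..k} * card {y\<in>nb x A. c x y = \<kappa>}"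
    using popular[of "nb x A" "{1..k}" "\<lambda>i y. c x y = i"] assms by (auto simp: nb_def)
  moreover have "card {y\<in>nb x A. c x y = \<kappa>} \<le> card {y\<in>A. c x y = \<kappa>}"
    using assms by (intro card_mono) (auto simp: nb_def)
  ultimately have "card (nb x A) \<le> k * card {y\<in>A. c x y = \<kappa>}"
    by (simp add: le_trans[OF _ mult_le_mono2])
  then show ?thesis using \<open>\<kappa> \<in> {1..k}\<close> by blast
qed

text \<open>The cases are those of \<open>separate_or_flat\<close>; from the last one only the
  inequality is kept that is wanted when \<open>A\<close> belongs to the block of largest
  degree.\<close>

definition comparable :: "real \<Rightarrow> ('a \<Rightarrow> real) \<Rightarrow> 'a set \<Rightarrow> 'a set \<Rightarrow> bool" where
  "comparable K f A B \<longleftrightarrow> (\<forall>x\<in>A. \<forall>y\<in>B. K * f y \<le> f x) \<or> (\<forall>x\<in>A. \<forall>y\<in>B. K * f x \<le> f y) \<or>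
    (\<forall>x\<in>A. \<forall>y\<in>B. f x < K * f y)"

lemma comparable_mono: "comparable K f A B \<Longrightarrow> A' \<subseteq> A \<Longrightarrow> comparable K f A' B"
  unfolding comparable_def by (elim disjE) auto

lemma separate:
  assumes "finite A" "A \<noteq> {}" "finite B" "B \<noteq> {}" "0 \<le> K"
  shows "\<exists>A' B'. A' \<subseteq> A \<and> B' \<subseteq> B \<and> card A \<le> 4 * card A' \<and> card B \<le> 4 * card B' \<and> comparable K f A' B'"
proof -
  obtain A' B' where "A' \<subseteq> A" "B' \<subseteq> B" "card A \<le> 4 * card A'" "card B \<le> 4 * card B'"
    "((\<forall>x\<in>A'. \<forall>y\<in>B'. K * f y \<le> f x) \<or> (\<forall>x\<in>A'. \<forall>y\<in>B'. K * f x \<le> f y) \<or>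
     (\<forall>x\<in>A'. \<forall>y\<in>B'. f x < K * f y \<and> f y < K * f x))"
    using separate_or_flat[OF assms, of f f] by (elim exE conjE) (rule that)
  moreover from this(5) have "comparable K f A' B'" unfolding comparable_def by (elim disjE) auto
  ultimately show ?thesis by blast
qed

text \<open>Each \<open>w\<close> cuts \<open>Du\<close> once more by a factor of at most 4, whereas
  every \<open>D w\<close> is cut once. Comparisons made earlier survive because
  \<open>comparable\<close> passes to subsets of its first set.\<close>

lemma separate_all:
  fixes f :: "'a \<Rightarrow> real"
  assumes "finite W" "finite Du" "Du \<noteq> {}" "0 \<le> K"
    and D: "\<And>w. w \<in> W \<Longrightarrow> finite (D w) \<and> D w \<noteq> {}"
  shows "\<exists>Du' D'. Du' \<subseteq> Du \<and> card Du \<le> 4 ^ card W * card Du' \<and>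
    (\<forall>w\<in>W. D' w \<subseteq> D w \<and> card (D w) \<le> 4 * card (D' w) \<and> comparable K f Du' (D' w))"
  using assms(1) D
proof (induction W)
  case empty
  then show ?case by (intro exI[of _ Du]) auto
next
  case (insert w W)
  then have "\<exists>Du' D'. Du' \<subseteq> Du \<and> card Du \<le> 4 ^ card W * card Du' \<and>
    (\<forall>w\<in>W. D' w \<subseteq> D w \<and> card (D w) \<le> 4 * card (D' w) \<and> comparable K f Du' (D' w))" by simp
  then obtain E D' where E: "E \<subseteq> Du" "card Du \<le> 4 ^ card W * card E"
    and D': "\<And>w. w \<in> W \<Longrightarrow> D' w \<subseteq> D w \<and> card (D w) \<le> 4 * card (D' w) \<and> comparable K f E (D' w)"
    by blast
  have "0 < card Du" using assms by (simp add: card_gt_0_iff)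
  then have E0: "E \<noteq> {}" "finite E" using E assms finite_subset by auto
  have Dw: "finite (D w)" "D w \<noteq> {}" using insert.prems by auto
  obtain E' F where F: "E' \<subseteq> E" "F \<subseteq> D w" "card E \<le> 4 * card E'" "card (D w) \<le> 4 * card F"
    "comparable K f E' F"
    using separate[OF E0(2,1) Dw assms(4), of f] by blast
  have "card Du \<le> 4 ^ card W * (4 * card E')"
    using E(2) F(3) by (meson le_trans mult_le_mono2)
  then have 1: "card Du \<le> 4 ^ card (insert w W) * card E'"
    using insert.hyps by (simp add: ac_simps)
  have 2: "(D'(w := F)) v \<subseteq> D v \<and> card (D v) \<le> 4 * card ((D'(w := F)) v) \<and> comparable K f E' ((D'(w := F)) v)"
    if "v \<in> insert w W" for v
    using D'[of v] F that comparable_mono[OF _ F(1)] by (cases "v = w") auto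
  have "E' \<subseteq> Du" using F E by blast
  then show ?case using 1 2 by blast
qed

text \<open>Medians make different blocks comparable. For each block take the median of the maximal
  relative degree of its vertices into the other blocks, and let \<open>u\<close> be the block with
  the largest median. Keeping the upper half of \<open>u\<close> and the lower halves of all other
  blocks places every degree out of the latter below the degrees from \<open>D u\<close> into
  \<open>C v\<close>, where \<open>v\<close> is a block at which many vertices of \<open>u\<close>
  attain their maximum. The factor \<open>2 * card Q * k * 4 ^ card Q\<close> collects the cuts for
  the median, the common \<open>v\<close>, the majority colour into \<open>C v\<close> and the
  separation at ratio \<open>K\<close>.\<close>

lemma slice:
  assumes Q: "finite Q" "2 \<le> card Q" and K: "1 < K" and k: "1 \<le> k"
    and C: "\<And>w. w \<in> Q \<Longrightarrow> finite (C w) \<and> C w \<noteq> {}"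
    and pos: "\<And>w j. w \<in> Q \<Longrightarrow> j \<in> Q \<Longrightarrow> w \<noteq> j \<Longrightarrow> 2 * card {x\<in>C w. nb x (C j) = {}} < card (C w)"
    and col: "\<And>x y. c x y \<le> k"
  shows "\<exists>u v D g. u \<in> Q \<and> v \<in> Q \<and> u \<noteq> v \<and>
    (\<forall>w\<in>Q. D w \<subseteq> C w \<and> card (C w) \<le> 2 * card Q * k * 4 ^ card Q * card (D w)) \<and>
    (\<forall>x\<in>D u. 0 < rd x (C v)) \<and>
    (\<forall>x\<in>D u. \<forall>w\<in>Q - {u}. \<forall>y\<in>D w. \<forall>j\<in>Q-{w}. rd y (C j) \<le> rd x (C v)) \<and>
    (\<forall>x\<in>D u. \<forall>j\<in>Q-{u}. rd x (C j) \<le> rd x (C v)) \<and>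
    (\<forall>w\<in>Q-{v}. g w \<in> {1..k} \<and> (\<forall>x\<in>D w. card (nb x (C v)) \<le> k * card {z\<in>C v. c x z = g w})) \<and>
    (\<forall>w\<in>Q-{u,v}. (\<forall>x\<in>D u. \<forall>y\<in>D w. K * rd y (C v) \<le> rd x (C v)) \<or>
                  (\<forall>x\<in>D u. \<forall>y\<in>D w. rd x (C v) < K * rd y (C v)))"
proof -
  define R where "R w x = Max ((\<lambda>j. rd x (C j)) ` (Q - {w}))" for w x
  have Qw: "Q - {w} \<noteq> {}" for w
  proof
    assume "Q - {w} = {}"
    then have "Q \<subseteq> {w}" by auto
    then have "card Q \<le> card {w}" by (intro card_mono) auto
    then show False using Q by simp
  qed
  have R_ge: "rd x (C j) \<le> R w x" if "j \<in> Q - {w}" for w x j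
    unfolding R_def using that Q by (intro Max_ge) auto
  have R_eq: "\<exists>j\<in>Q - {w}. R w x = rd x (C j)" for w x
  proof -
    have "R w x \<in> (\<lambda>j. rd x (C j)) ` (Q - {w})"
      unfolding R_def using Qw Q by (intro Max_in) auto
    then show ?thesis by auto
  qed
  have "\<forall>w\<in>Q. \<exists>t. card (C w) \<le> 2 * card {x\<in>C w. t \<le> R w x} \<and> card (C w) \<le> 2 * card {x\<in>C w. R w x \<le> t}"
  proof
    fix w assume "w \<in> Q"
    then show "\<exists>t. card (C w) \<le> 2 * card {x\<in>C w. t \<le> R w x} \<and> card (C w) \<le> 2 * card {x\<in>C w. R w x \<le> t}"
      using C by (intro median) auto
  qed
  from bchoice[OF this] obtain a where
    "\<forall>w\<in>Q. card (C w) \<le> 2 * card {x\<in>C w. a w \<le> R w x} \<and> card (C w) \<le> 2 * card {x\<in>C w. R w x \<le> a w}" ..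
  then have a: "\<And>w. w \<in> Q \<Longrightarrow> card (C w) \<le> 2 * card {x\<in>C w. a w \<le> R w x}"
    "\<And>w. w \<in> Q \<Longrightarrow> card (C w) \<le> 2 * card {x\<in>C w. R w x \<le> a w}" by simp_all
  \<comment> \<open>Were the median not positive, the lower half of \<open>C w\<close> would have no
    neighbours in another block \<open>C j\<close>, against \<open>pos\<close>.\<close>
  have a_pos: "0 < a w" if w: "w \<in> Q" for w
  proof (rule ccontr)
    assume n: "\<not> ?thesis"
    obtain j where j: "j \<in> Q - {w}" using Qw by blast
    have "{x\<in>C w. R w x \<le> a w} \<subseteq> {x\<in>C w. nb x (C j) = {}}"
    proof
      fix x assume x: "x \<in> {x\<in>C w. R w x \<le> a w}"
      then have "rd x (C j) \<le> 0" using R_ge[OF j, of x] n by auto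
      moreover have "0 < card (C j)" using C j by (simp add: card_gt_0_iff)
      ultimately have "card (nb x (C j)) = 0" by (simp add: rd_def divide_le_0_iff)
      moreover have "finite (nb x (C j))" using C j nb_subset finite_subset by (metis DiffD1)
      ultimately show "x \<in> {x\<in>C w. nb x (C j) = {}}" using x by auto
    qed
    then have "card {x\<in>C w. R w x \<le> a w} \<le> card {x\<in>C w. nb x (C j) = {}}"
      using C[OF w] by (intro card_mono) auto
    then show False using a(2)[OF w] pos[of w j] w j by auto
  qed
  have "Q \<noteq> {}" using Q by auto
  then have "Max (a ` Q) \<in> a ` Q" using Q by (intro Max_in) auto
  then obtain u where u: "u \<in> Q" "a u = Max (a ` Q)" by (metis imageE)
  have au: "a w \<le> a u" if "w \<in> Q" for w using that Q u by simp
  obtain v where v: "v \<in> Q - {u}" and cv: "card {x\<in>C u. a u \<le> R u x} \<le> card (Q - {u}) *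
      card {x\<in>{x\<in>C u. a u \<le> R u x}. R u x = rd x (C v)}"
    using popular[of "{x\<in>C u. a u \<le> R u x}" "Q - {u}" "\<lambda>j x. R u x = rd x (C j)"] R_eq[of u] Qw[of u] C[OF u(1)] Q
    by auto
  define D1 where "D1 w = (if w = u then {x\<in>C u. a u \<le> R u x \<and> R u x = rd x (C v)} else {x\<in>C w. R w x \<le> a w})" for w
  have D1s: "D1 w \<subseteq> C w" for w by (auto simp: D1_def)
  have finD1: "finite (D1 w)" if "w \<in> Q" for w using C[OF that] D1s finite_subset by metis
  have D1c: "card (C w) \<le> 2 * card Q * card (D1 w)" if w: "w \<in> Q" for w
  proof (cases "w = u")
    case True
    have "card (Q - {u}) \<le> card Q" using Q by (simp add: card_mono)
    moreover have "D1 u = {x\<in>{x\<in>C u. a u \<le> R u x}. R u x = rd x (C v)}" by (auto simp: D1_def)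
    ultimately have "card {x\<in>C u. a u \<le> R u x} \<le> card Q * card (D1 u)"
      using cv by (simp add: le_trans[OF _ mult_le_mono1])
    then show ?thesis using a(1)[OF u(1)] True by simp
  next
    case False
    then have "card (C w) \<le> 2 * card (D1 w)" using a(2)[OF w] by (simp add: D1_def)
    also have "\<dots> \<le> 2 * card Q * card (D1 w)" using Q by simp
    finally show ?thesis .
  qed
  have "\<forall>w\<in>Q. \<exists>\<kappa>\<in>{1..k}. card (D1 w) \<le> k * card {x\<in>D1 w. card (nb x (C v)) \<le> k * card {z\<in>C v. c x z = \<kappa>}}"
  proof
    fix w assume w: "w \<in> Q"
    have "\<exists>\<kappa>\<in>{1..k}. card (nb x (C v)) \<le> k * card {z\<in>C v. c x z = \<kappa>}" for x
      using majority_colour[of "C v" k x] C v k col by auto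
    then show "\<exists>\<kappa>\<in>{1..k}. card (D1 w) \<le> k * card {x\<in>D1 w. card (nb x (C v)) \<le> k * card {z\<in>C v. c x z = \<kappa>}}"
      using popular[of "D1 w" "{1..k}" "\<lambda>\<kappa> x. card (nb x (C v)) \<le> k * card {z\<in>C v. c x z = \<kappa>}"]
        finD1[OF w] k by simp
  qed
  then have "\<forall>w\<in>Q. \<exists>\<kappa>. \<kappa>\<in>{1..k} \<and> card (D1 w) \<le> k * card {x\<in>D1 w. card (nb x (C v)) \<le> k * card {z\<in>C v. c x z = \<kappa>}}"
    by blast
  from bchoice[OF this] obtain g where
    "\<forall>w\<in>Q. g w\<in>{1..k} \<and> card (D1 w) \<le> k * card {x\<in>D1 w. card (nb x (C v)) \<le> k * card {z\<in>C v. c x z = g w}}" ..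
  then have g: "\<And>w. w \<in> Q \<Longrightarrow> g w \<in> {1..k}"
    "\<And>w. w \<in> Q \<Longrightarrow> card (D1 w) \<le> k * card {x\<in>D1 w. card (nb x (C v)) \<le> k * card {z\<in>C v. c x z = g w}}"
    by simp_all
  define D2 where "D2 w = {x\<in>D1 w. card (nb x (C v)) \<le> k * card {z\<in>C v. c x z = g w}}" for w
  have D2c: "card (C w) \<le> 2 * card Q * k * card (D2 w)" if w: "w \<in> Q" for w
  proof -
    have "2 * card Q * card (D1 w) \<le> 2 * card Q * (k * card (D2 w))"
      using g(2)[OF w] unfolding D2_def by (rule mult_le_mono2)
    also have "\<dots> = 2 * card Q * k * card (D2 w)" by (simp only: ac_simps)
    finally show ?thesis using D1c[OF w] by (rule le_trans[rotated])
  qed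
  have D2n: "finite (D2 w) \<and> D2 w \<noteq> {}" if w: "w \<in> Q" for w
  proof -
    have "0 < card (C w)" using C[OF w] by (simp add: card_gt_0_iff)
    then have "0 < 2 * card Q * k * card (D2 w)" using D2c[OF w] by linarith
    then have "0 < card (D2 w)" by simp
    then show ?thesis by (simp add: card_gt_0_iff)
  qed
  have "\<exists>Du' D'. Du' \<subseteq> D2 u \<and> card (D2 u) \<le> 4 ^ card (Q - {u,v}) * card Du' \<and>
    (\<forall>w\<in>Q - {u,v}. D' w \<subseteq> D2 w \<and> card (D2 w) \<le> 4 * card (D' w) \<and> comparable K (\<lambda>x. rd x (C v)) Du' (D' w))"
    by (rule separate_all) (use Q D2n u K in auto)
  then obtain Du D' where Du: "Du \<subseteq> D2 u" "card (D2 u) \<le> 4 ^ card (Q - {u,v}) * card Du" and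
    D': "\<And>w. w \<in> Q - {u,v} \<Longrightarrow> D' w \<subseteq> D2 w \<and> card (D2 w) \<le> 4 * card (D' w) \<and> comparable K (\<lambda>x. rd x (C v)) Du (D' w)"
    by blast
  define D where "D w = (if w = u then Du else if w = v then D2 v else D' w)" for w
  have DD2: "D w \<subseteq> D2 w" if "w \<in> Q" for w using that Du D' by (auto simp: D_def)
  have DC: "D w \<subseteq> C w" if "w \<in> Q" for w using DD2[OF that] D1s by (auto simp: D2_def)
  have four: "card (D2 w) \<le> 4 ^ card Q * card (D w)" if w: "w \<in> Q" for w
  proof -
    have "(4::nat) ^ card (Q - {u,v}) \<le> 4 ^ card Q" using Q by (intro power_increasing card_mono) auto
    moreover have "(4::nat) ^ 1 \<le> 4 ^ card Q" using Q by (intro power_increasing) auto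
    moreover have "(4::nat) ^ 0 \<le> 4 ^ card Q" by (intro power_increasing) auto
    ultimately show ?thesis
      using Du(2) D'[of w] w unfolding D_def by (auto intro: le_trans[OF _ mult_le_mono1])
  qed
  have card_D: "card (C w) \<le> 2 * card Q * k * 4 ^ card Q * card (D w)" if w: "w \<in> Q" for w
    using le_trans[OF D2c[OF w] mult_le_mono2[OF four[OF w]]] by (simp add: ac_simps)
  have top: "a u \<le> rd x (C v) \<and> (\<forall>j\<in>Q-{u}. rd x (C j) \<le> rd x (C v))" if "x \<in> D u" for x
  proof -
    have "x \<in> D1 u" using that DD2[OF u(1)] by (auto simp: D2_def)
    then show ?thesis using R_ge[of _ u x] by (auto simp: D1_def)
  qed
  have below: "rd y (C j) \<le> a u" if "w \<in> Q - {u}" "y \<in> D w" "j \<in> Q - {w}" for w y j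
  proof -
    have "y \<in> D1 w" using that DD2 by (auto simp: D2_def)
    then have "R w y \<le> a w" using that by (simp add: D1_def)
    then show ?thesis using R_ge[OF that(3), of y] au[of w] that by simp
  qed
  have upos: "0 < rd x (C v)" if "x \<in> D u" for x using top[OF that] a_pos[OF u(1)] by linarith
  have uv: "v \<in> Q" "u \<noteq> v" using v by auto
  have dich: "(\<forall>x\<in>D u. \<forall>y\<in>D w. K * rd y (C v) \<le> rd x (C v)) \<or>
              (\<forall>x\<in>D u. \<forall>y\<in>D w. rd x (C v) < K * rd y (C v))" if w: "w \<in> Q - {u,v}" for w
  proof -
    have Du': "D u = Du" and Dw: "D w = D' w" using w by (auto simp: D_def)
    \<comment> \<open>The middle case of \<open>comparable\<close> would make degrees out of
      \<open>D w\<close> at least \<open>K > 1\<close> times those out of \<open>D u\<close>, which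
      are positive and maximal.\<close>
    have "\<not> (\<forall>x\<in>D u. \<forall>y\<in>D w. K * rd x (C v) \<le> rd y (C v)) \<or> D u = {} \<or> D w = {}"
    proof (rule ccontr)
      assume n: "\<not> ?thesis"
      then obtain x y where xy: "x \<in> D u" "y \<in> D w" "K * rd x (C v) \<le> rd y (C v)" by blast
      have "rd y (C v) \<le> rd x (C v)" using below[of w y v] top[OF xy(1)] w xy uv by fastforce
      moreover have "rd x (C v) < K * rd x (C v)" using K upos[OF xy(1)] by simp
      ultimately show False using xy by linarith
    qed
    then show ?thesis using D'[OF w] unfolding Du' Dw comparable_def by blast
  qed
  show ?thesis
  proof (rule exI[of _ u], rule exI[of _ v], rule exI[of _ D], rule exI[of _ g], intro conjI ballI)
    show "u \<in> Q" "v \<in> Q" "u \<noteq> v" using u uv by auto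
    fix w assume w: "w \<in> Q"
    show "D w \<subseteq> C w" "card (C w) \<le> 2 * card Q * k * 4 ^ card Q * card (D w)"
      using DC card_D w by auto
  next
    fix x assume "x \<in> D u" then show "0 < rd x (C v)" by (rule upos)
  next
    fix x w y j assume "x \<in> D u" "w \<in> Q - {u}" "y \<in> D w" "j \<in> Q - {w}"
    then show "rd y (C j) \<le> rd x (C v)" using below top by (meson order_trans)
  next
    fix x j assume "x \<in> D u" "j \<in> Q - {u}" then show "rd x (C j) \<le> rd x (C v)" using top by blast
  next
    fix w assume "w \<in> Q - {v}" then show "g w \<in> {1..k}" using g by blast
  next
    fix w x assume "w \<in> Q - {v}" "x \<in> D w"
    then show "card (nb x (C v)) \<le> k * card {z\<in>C v. c x z = g w}" using DD2 by (auto simp: D2_def)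
  next
    fix w assume "w \<in> Q - {u,v}"
    then show "(\<forall>x\<in>D u. \<forall>y\<in>D w. K * rd y (C v) \<le> rd x (C v)) \<or>
               (\<forall>x\<in>D u. \<forall>y\<in>D w. rd x (C v) < K * rd y (C v))" by (rule dich)
  qed
qed

end

subsection \<open>Joining rooted trees\<close>

text \<open>Rooted trees: \<open>Join s t\<close> makes the root of \<open>t\<close> a new child of the root of \<open>s\<close>.\<close>

datatype rtree = Leaf | Join rtree rtree

primrec sz :: "rtree \<Rightarrow> nat" where
  "sz Leaf = 1"
| "sz (Join s t) = sz s + sz t"

lemma sz_pos: "1 \<le> sz t"
  by (induction t) auto

context coloured
begin

text \<open>Only root and vertex set are recorded, which is all that joining needs; the embedding is
  recovered at the end, in \<open>tree_from_copy\<close>, along the recursion that produced the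
  tree.\<close>

inductive rcopy :: "nat \<Rightarrow> rtree \<Rightarrow> 'a \<Rightarrow> 'a set \<Rightarrow> bool" for \<kappa> where
  leaf: "rcopy \<kappa> Leaf x {x}"
| join: "rcopy \<kappa> s x S \<Longrightarrow> rcopy \<kappa> t y U \<Longrightarrow> S \<inter> U = {} \<Longrightarrow> c x y = \<kappa> \<Longrightarrow>
    (\<And>a b. a \<in> S \<Longrightarrow> b \<in> U \<Longrightarrow> (a, b) \<noteq> (x, y) \<Longrightarrow> c a b = 0) \<Longrightarrow> rcopy \<kappa> (Join s t) x (S \<union> U)"

lemma rcopy_card: "rcopy \<kappa> t x S \<Longrightarrow> finite S \<and> x \<in> S \<and> card S = sz t"
  by (induction rule: rcopy.induct) (auto simp: card_Un_disjoint)

text \<open>Only the root is tied to a block. The other vertices may share blocks of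
  \<open>Z\<close>: to join two copies it is enough that they use disjoint sets of blocks.\<close>

definition titem :: "nat \<Rightarrow> rtree \<Rightarrow> (nat \<Rightarrow> 'a set) \<Rightarrow> nat \<Rightarrow> nat set \<Rightarrow> bool" where
  "titem \<kappa> t B v Z \<longleftrightarrow> (\<exists>x S. rcopy \<kappa> t x S \<and> x \<in> B v \<and> S - {x} \<subseteq> (\<Union>i\<in>Z. B i))"

lemma titem_mono:
  assumes "titem \<kappa> t B' v Z" "B' v \<subseteq> B v" "\<And>i. i \<in> Z \<Longrightarrow> B' i \<subseteq> B i"
  shows "titem \<kappa> t B v Z"
proof -
  obtain x S where "rcopy \<kappa> t x S" "x \<in> B' v" "S - {x} \<subseteq> (\<Union>i\<in>Z. B' i)"
    using assms(1) by (auto simp: titem_def)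
  moreover have "(\<Union>i\<in>Z. B' i) \<subseteq> (\<Union>i\<in>Z. B i)" using assms(3) by (rule UN_mono[OF order_refl])
  ultimately show ?thesis using assms(2) unfolding titem_def by blast
qed

text \<open>Copies of the trees \<open>ta l\<close> are collected one by one. A vertex of the block of \<open>lv l\<close> is good
  if it sees one of these copies through its root only, while the blocks of \<open>Zv l\<close> lose little.
  As long as every block keeps half of its vertices, another copy can be added.\<close>

lemma join_copies:
  fixes B :: "nat \<Rightarrow> 'a set" and Lab :: "'l set" and kap :: "'l \<Rightarrow> nat" and ta tb :: "'l \<Rightarrow> rtree"
    and lu lv :: "'l \<Rightarrow> nat" and Zu Zv :: "'l \<Rightarrow> nat set" and K \<theta> \<kappa>s \<kappa>f :: real and k s L :: nat
  assumes Q: "finite Q"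
    and disj: "\<And>i j. i \<in> Q \<Longrightarrow> j \<in> Q \<Longrightarrow> i \<noteq> j \<Longrightarrow> B i \<inter> B j = {}"
    and finB: "\<And>i. i \<in> Q \<Longrightarrow> finite (B i) \<and> B i \<noteq> {}"
    and Lab: "finite Lab" "card Lab \<le> L"
    and lab: "\<And>l. l \<in> Lab \<Longrightarrow> lu l \<in> Q \<and> lv l \<in> Q \<and> lu l \<noteq> lv l \<and> Zu l \<subseteq> Q \<and> Zv l \<subseteq> Q \<and>
      lu l \<notin> Zu l \<and> lu l \<notin> Zv l \<and> lv l \<notin> Zu l \<and> lv l \<notin> Zv l \<and> Zu l \<inter> Zv l = {} \<and>
      sz (ta l) \<le> s \<and> 1 \<le> kap l"
    and sparse: "\<And>i j x. i \<in> Q \<Longrightarrow> j \<in> Q \<Longrightarrow> i \<noteq> j \<Longrightarrow> x \<in> B i \<Longrightarrow> card (nb x (B j)) \<le> \<theta> * card (B j)"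
    and par: "1 \<le> s" "1 \<le> k" "1 \<le> L" "8 * s * \<theta> \<le> 1" "2 * real k * s \<le> K"
      "0 < \<kappa>f" "\<kappa>f \<le> 1/4" "\<kappa>f \<le> \<kappa>s / 2" "\<kappa>f \<le> 1 / (8 * real k * s * L)"
    and alw_a: "\<And>l C. l \<in> Lab \<Longrightarrow> contr \<kappa>f Q C B \<Longrightarrow> titem (kap l) (ta l) C (lu l) (Zu l)"
    and alw_b: "\<And>l C. l \<in> Lab \<Longrightarrow> contr \<kappa>f Q C B \<Longrightarrow> titem (kap l) (tb l) C (lv l) (Zv l)"
    and step: "\<And>C. contr (1/2) Q C B \<Longrightarrow> \<exists>l\<in>Lab. \<exists>D. contr \<kappa>s Q D C \<and>
      (\<forall>x\<in>D (lu l). 0 < rd x (C (lv l)) \<and>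
         card (nb x (C (lv l))) \<le> k * card {z\<in>C (lv l). c x z = kap l} \<and>
         (\<forall>j\<in>Zv l. rd x (C j) \<le> rd x (C (lv l))) \<and>
         (\<forall>w\<in>Zu l. \<forall>y\<in>D w. K * rd y (C (lv l)) \<le> rd x (C (lv l)) \<and>
            (\<forall>j\<in>Zv l. rd y (C j) \<le> rd x (C (lv l)))))"
  shows "\<exists>l\<in>Lab. \<exists>x S y U. rcopy (kap l) (ta l) x S \<and> rcopy (kap l) (tb l) y U \<and>
    x \<in> B (lu l) \<and> S - {x} \<subseteq> (\<Union>i\<in>Zu l. B i) \<and> y \<in> B (lv l) \<and> U - {y} \<subseteq> (\<Union>i\<in>Zv l. B i) \<and>
    c x y = kap l \<and> (\<forall>a\<in>S. \<forall>b\<in>U. (a, b) \<noteq> (x, y) \<longrightarrow> c a b = 0)"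
proof -
  define V where "V = (\<Union>i\<in>Q. B i)"
  define Univ where "Univ = {(l, x, S). l \<in> Lab \<and> rcopy (kap l) (ta l) x S \<and> x \<in> B (lu l) \<and> S - {x} \<subseteq> (\<Union>i\<in>Zu l. B i)}"
  \<comment> \<open>A copy labelled \<open>l\<close> charges only those blocks that a copy of
    \<open>tb l\<close> may use later, namely \<open>lv l\<close> and the blocks of
    \<open>Zv l\<close>.\<close>
  define hit where "hit \<C> j = {b\<in>B j. \<exists>l x S. (l, x, S) \<in> \<C> \<and> (j = lv l \<or> j \<in> Zv l) \<and> (\<exists>y\<in>S. c y b \<noteq> 0)}"
    for \<C> :: "('l \<times> 'a \<times> 'a set) set" and j
  define good where "good \<C> l = {b\<in>B (lv l). \<exists>x S. (l, x, S) \<in> \<C> \<and> c x b = kap l \<and> (\<forall>y\<in>S-{x}. c y b = 0)}"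
    for \<C> :: "('l \<times> 'a \<times> 'a set) set" and l
  define tot where "tot \<C> = (\<Sum>l\<in>Lab. card (good \<C> l) / card (B (lv l)))" for \<C>
  \<comment> \<open>Two invariants: a quarter of every block stays unhit, and all damage is paid for
    by good vertices. A new copy whose relative degrees are at most \<open>\<rho>\<close> hits a
    share of at most \<open>s * \<rho>\<close> of a block and adds at least
    \<open>\<rho> / (4 * k)\<close> to \<open>tot\<close>; the quotient of the two is the factor
    \<open>4 * k * s\<close>.\<close>
  define CC where "CC = {\<C>. \<C> \<subseteq> Univ \<and> (\<forall>j\<in>Q. card (hit \<C> j) \<le> 3/4 * card (B j) \<and>
     card (hit \<C> j) \<le> 4 * real k * s * tot \<C> * card (B j))}"
  have finV: "finite V" using Q finB by (auto simp: V_def)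
  have "Univ \<subseteq> Lab \<times> V \<times> Pow V"
    using lab by (fastforce simp: Univ_def V_def)
  then have finU: "finite Univ" using Lab finV by (meson finite_Pow_iff finite_SigmaI finite_subset)
  have cB: "0 < real (card (B i))" if "i \<in> Q" for i using finB[OF that] by (simp add: card_gt_0_iff)
  have "finite CC" using finU by (auto simp: CC_def)
  moreover have "{} \<in> CC" by (simp add: CC_def hit_def tot_def good_def)
  ultimately obtain \<C> where \<C>: "\<C> \<in> CC" and max: "\<And>\<D>. \<D> \<in> CC \<Longrightarrow> \<C> \<subseteq> \<D> \<Longrightarrow> \<C> = \<D>"
    using finite_has_maximal[of CC] by blast
  have CU: "\<C> \<subseteq> Univ" and h34: "\<And>j. j \<in> Q \<Longrightarrow> card (hit \<C> j) \<le> 3/4 * card (B j)"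
    and htot: "\<And>j. j \<in> Q \<Longrightarrow> card (hit \<C> j) \<le> 4 * real k * s * tot \<C> * card (B j)"
    using \<C> by (auto simp: CC_def)
  have hitB: "hit \<C> j \<subseteq> B j" for \<C> j by (auto simp: hit_def)
  have finhit: "finite (hit \<C> j)" if "j \<in> Q" for \<C> j using finite_subset[OF hitB] finB[OF that] by blast
  have goodB: "good \<C> l \<subseteq> B (lv l)" for \<C> l by (auto simp: good_def)
  have xS: "x \<in> S" "finite S" "card S \<le> s" "l \<in> Lab" if "(l, x, S) \<in> Univ" for l x S
    using that rcopy_card lab by (auto simp: Univ_def)
  have goodhit: "good \<C> l \<subseteq> hit \<C> (lv l)" if "\<C> \<subseteq> Univ" "l \<in> Lab" for \<C> l
  proof
    fix b assume "b \<in> good \<C> l"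
    then obtain x S where b: "b \<in> B (lv l)" "(l, x, S) \<in> \<C>" "c x b = kap l" by (auto simp: good_def)
    have "x \<in> S" using xS(1) b that by blast
    moreover have "c x b \<noteq> 0" using b lab[OF that(2)] by simp
    ultimately show "b \<in> hit \<C> (lv l)" unfolding hit_def mem_Collect_eq using b by blast
  qed
  have "\<exists>j\<in>Q. card (B j) / 2 < card (hit \<C> j)"
  proof (rule ccontr)
    assume "\<not> ?thesis"
    then have half: "\<And>j. j \<in> Q \<Longrightarrow> card (hit \<C> j) \<le> card (B j) / 2" by force
    define C where "C j = B j - hit \<C> j" for j
    have CB: "C j \<subseteq> B j" for j by (auto simp: C_def)
    have finC: "finite (C j)" if "j \<in> Q" for j using finB[OF that] finite_subset[OF CB] by simp
    have cC: "card (B j) / 2 \<le> card (C j)" if j: "j \<in> Q" for j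
    proof -
      have "card (C j) = card (B j) - card (hit \<C> j)"
        unfolding C_def using hitB finhit[OF j] by (intro card_Diff_subset)
      moreover have "card (hit \<C> j) \<le> card (B j)" using hitB finB[OF j] by (intro card_mono) auto
      ultimately show ?thesis using half[OF j] by (simp add: of_nat_diff)
    qed
    have cC0: "0 < real (card (C j))" if "j \<in> Q" for j using cC[OF that] cB[OF that] by linarith
    have cCB: "real (card (C j)) \<le> card (B j)" if "j \<in> Q" for j
      using CB[of j] finB[OF that] by (simp add: card_mono)
    have contrC: "contr (1/2) Q C B" using CB cC by (auto simp: contr_def)
    obtain l D where l: "l \<in> Lab" and D: "contr \<kappa>s Q D C" and DD:
      "\<forall>x\<in>D (lu l). 0 < rd x (C (lv l)) \<and>
         card (nb x (C (lv l))) \<le> k * card {z\<in>C (lv l). c x z = kap l} \<and>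
         (\<forall>j\<in>Zv l. rd x (C j) \<le> rd x (C (lv l))) \<and>
         (\<forall>w\<in>Zu l. \<forall>y\<in>D w. K * rd y (C (lv l)) \<le> rd x (C (lv l)) \<and>
            (\<forall>j\<in>Zv l. rd y (C j) \<le> rd x (C (lv l))))"
      using step[OF contrC] by (elim bexE exE conjE) (rule that)
    have Dx: "0 < rd x (C (lv l))" "card (nb x (C (lv l))) \<le> k * card {z\<in>C (lv l). c x z = kap l}"
        "\<And>j. j \<in> Zv l \<Longrightarrow> rd x (C j) \<le> rd x (C (lv l))" if "x \<in> D (lu l)" for x
      using DD[THEN bspec, OF that] by simp_all
    have Dw: "K * rd y (C (lv l)) \<le> rd x (C (lv l))" "\<And>j. j \<in> Zv l \<Longrightarrow> rd y (C j) \<le> rd x (C (lv l))"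
      if "x \<in> D (lu l)" "w \<in> Zu l" "y \<in> D w" for x w y
      using DD[THEN bspec, OF that(1)] that(2,3) by simp_all
    define v where "v = lv l"
    have labl: "lu l \<in> Q" "v \<in> Q" "lu l \<noteq> v" "Zu l \<subseteq> Q" "Zv l \<subseteq> Q" "sz (ta l) \<le> s" "v \<notin> Zu l" "v \<notin> Zv l" "1 \<le> kap l"
      using lab[OF l] by (auto simp: v_def)
    have ks: "0 \<le> \<kappa>s" using par by linarith
    have "contr (1/2 * \<kappa>s) Q D B" using contr_trans[OF contrC D ks] .
    then have "contr \<kappa>f Q D B" using par by (auto intro: contr_weaken)
    from alw_a[OF l this] obtain x S where S: "rcopy (kap l) (ta l) x S" "x \<in> D (lu l)" "S - {x} \<subseteq> (\<Union>i\<in>Zu l. D i)"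
      by (auto simp: titem_def)
    have DB: "D i \<subseteq> B i" if "i \<in> Q" for i using D CB that by (fastforce simp: contr_def)
    have eU: "(l, x, S) \<in> Univ"
      unfolding Univ_def using l S DB labl by fastforce
    have fS: "finite S" "x \<in> S" "card S \<le> s" using xS[OF eU] by auto
    define \<rho> where "\<rho> = rd x (C v)"
    have K1: "1 \<le> K" 
    proof -
      have "1 * 1 \<le> real k * real s" using par by (intro mult_mono) auto
      then show ?thesis using par by linarith
    qed
    have \<rho>0: "0 < \<rho>" using Dx(1)[OF S(2)] by (simp add: \<rho>_def v_def)
    have rdK: "K * rd y (C v) \<le> \<rho>" if "y \<in> S - {x}" for y
      using that S Dw(1) by (auto simp: \<rho>_def v_def)
    have rd_le: "rd y (C j) \<le> \<rho>" if y: "y \<in> S" and j: "j = v \<or> j \<in> Zv l" for y j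
    proof (cases "y = x")
      case True
      then show ?thesis using j Dx(3)[OF S(2)] by (auto simp: \<rho>_def v_def)
    next
      case False
      then have yS: "y \<in> S - {x}" using y by blast
      show ?thesis
      proof (cases "j = v")
        case True
        have "rd y (C v) \<le> K * rd y (C v)" using K1 rd_nonneg[of y "C v"] by (simp add: mult_le_cancel_right1)
        then show ?thesis using rdK[OF yS] True by auto
      next
        case False
        then show ?thesis using j yS S Dw(2)[OF S(2)] by (auto simp: \<rho>_def v_def)
      qed
    qed
    have nb_le: "card (nb y (C j)) \<le> \<rho> * card (C j)" if "y \<in> S" "j = v \<or> j \<in> Zv l" for y j
    proof -
      have "j \<in> Q" using that labl by auto
      then show ?thesis using rd_le[OF that] cC0[of j] by (simp add: rd_def field_simps)
    qed
    have nbK: "card (nb y (C v)) \<le> \<rho> / K * card (C v)" if "y \<in> S - {x}" for y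
      using rdK[OF that] cC0[OF labl(2)] K1 by (simp add: rd_def field_simps)
    \<comment> \<open>\<open>C v\<close> is at least half of \<open>B v\<close>, so relative degrees
      at most double. By \<open>8 * s * \<theta> \<le> 1\<close> one further copy hits at most a
      quarter of a block, which takes the hit share from 1/2 to no more than 3/4.\<close>
    have \<rho>2: "\<rho> \<le> 2 * \<theta>"
    proof -
      have xB: "x \<in> B (lu l)" using S DB labl by auto
      have "card (nb x (C v)) \<le> card (nb x (B v))"
        using CB finB[OF labl(2)] by (intro card_mono) (auto simp: nb_def)
      then have "real (card (nb x (C v))) \<le> \<theta> * card (B v)" using sparse[OF labl(1,2,3) xB] by linarith
      then have "\<rho> * card (C v) \<le> \<theta> * card (B v)"
        using cC0[OF labl(2)] by (simp add: \<rho>_def rd_def)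
      moreover have "0 \<le> \<theta>"
      proof -
        have "0 \<le> \<theta> * card (B v)" using sparse[OF labl(1,2,3) xB] by linarith
        then show ?thesis using cB[OF labl(2)] by (simp add: zero_le_mult_iff)
      qed
      then have "\<theta> * card (B v) \<le> \<theta> * (2 * card (C v))"
        using cC[OF labl(2)] by (intro mult_left_mono) auto
      ultimately have "\<rho> * card (C v) \<le> 2 * \<theta> * card (C v)" by linarith
      then show ?thesis using cC0[OF labl(2)] by simp
    qed
    define \<C>' where "\<C>' = insert (l, x, S) \<C>"
    define N where "N = {b\<in>C v. c x b = kap l \<and> (\<forall>y\<in>S-{x}. c y b = 0)}"
    have N_C: "N \<subseteq> C v" by (auto simp: N_def)
    \<comment> \<open>The root sees at least a \<open>\<rho> / k\<close> share of \<open>C v\<close>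
      in colour \<open>kap l\<close>. The other at most \<open>s\<close> vertices have relative
      degree at most \<open>\<rho> / K\<close>, and by \<open>2 * k * s \<le> K\<close> they spoil
      at most half of it. Another factor 2 leads from \<open>C v\<close> to
      \<open>B v\<close>.\<close>
    have N_card: "\<rho> / (4 * k) * card (B v) \<le> card N"
    proof -
      have "{z\<in>C v. c x z = kap l} \<subseteq> N \<union> (\<Union>y\<in>S-{x}. nb y (C v))"
        by (auto simp: N_def nb_def)
      then have "card {z\<in>C v. c x z = kap l} \<le> card (N \<union> (\<Union>y\<in>S-{x}. nb y (C v)))"
        using finC[OF labl(2)] fS by (intro card_mono) (auto simp: N_def nb_def)
      also have "\<dots> \<le> card N + card (\<Union>y\<in>S-{x}. nb y (C v))" by (rule card_Un_le)
      also have "\<dots> \<le> card N + (\<Sum>y\<in>S-{x}. card (nb y (C v)))"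
        using card_UN_le[of "S - {x}"] fS by simp
      finally have "real (card {z\<in>C v. c x z = kap l}) \<le> real (card N + (\<Sum>y\<in>S-{x}. card (nb y (C v))))"
        by (rule of_nat_mono)
      also have "\<dots> = card N + (\<Sum>y\<in>S-{x}. real (card (nb y (C v))))" by simp
      also have "(\<Sum>y\<in>S-{x}. real (card (nb y (C v)))) \<le> card (S - {x}) * (\<rho> / K * card (C v))"
        using nbK by (intro sum_bounded_above) auto
      also have "\<dots> \<le> s * (\<rho> / K * card (C v))"
        using fS \<rho>0 K1 card_mono[of S "S - {x}"] by (intro mult_right_mono) auto
      also have "\<dots> = (s / K) * (\<rho> * card (C v))" by simp
      also have "\<dots> \<le> (1 / (2 * k)) * (\<rho> * card (C v))"
        using par K1 \<rho>0 by (intro mult_right_mono) (auto simp: field_simps)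
      finally have 1: "real (card {z\<in>C v. c x z = kap l}) \<le> card N + \<rho> * card (C v) / (2 * k)" by simp
      have "\<rho> * card (C v) = card (nb x (C v))" using cC0[OF labl(2)] by (simp add: \<rho>_def rd_def)
      also have "\<dots> \<le> real (k * card {z\<in>C v. c x z = kap l})"
        using Dx(2)[OF S(2)] unfolding v_def by (rule of_nat_mono)
      also have "\<dots> = k * real (card {z\<in>C v. c x z = kap l})" by simp
      finally have "\<rho> * card (C v) / k \<le> card {z\<in>C v. c x z = kap l}"
        using par by (simp add: field_simps)
      then have "\<rho> * card (C v) / (2 * k) \<le> card N" using 1 par by (simp add: field_simps)
      moreover have "\<rho> / (4 * k) * card (B v) = \<rho> * (card (B v) / 2) / (2 * k)" by simp
      moreover have "\<dots> \<le> \<rho> * card (C v) / (2 * k)"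
        using cC[OF labl(2)] \<rho>0 by (intro divide_right_mono mult_left_mono) auto
      ultimately show ?thesis by linarith
    qed
    have "0 < \<rho> / (4 * k) * card (B v)" using \<rho>0 par cB[OF labl(2)] by simp
    then have "N \<noteq> {}" using N_card by auto
    have C'U: "\<C>' \<subseteq> Univ" using CU eU by (simp add: \<C>'_def)
    have N_good: "N \<subseteq> good \<C>' l"
      using CB by (auto simp: N_def good_def \<C>'_def v_def)
    \<comment> \<open>\<open>C v\<close> avoids everything hit so far, so the vertices of
      \<open>N\<close> were not good before: the collection really grows and \<open>tot\<close>
      increases by the full amount.\<close>
    have N_hit: "N \<inter> hit \<C> v = {}" using N_C by (auto simp: C_def)
    have ne: "\<C>' \<noteq> \<C>"
    proof
      assume "\<C>' = \<C>"
      then have "N \<subseteq> hit \<C> v" using N_good goodhit[OF CU l] by (auto simp: v_def)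
      then show False using N_hit \<open>N \<noteq> {}\<close> by blast
    qed
    have fgood: "finite (good \<C>' l')" if "l' \<in> Lab" for l' and \<C>'
      using finite_subset[OF goodB] finB lab[OF that] by simp
    have tot': "tot \<C> + \<rho> / (4 * k) \<le> tot \<C>'"
    proof -
      have mono: "card (good \<C> l') / card (B (lv l')) \<le> card (good \<C>' l') / card (B (lv l'))" if "l' \<in> Lab" for l'
      proof -
        have "good \<C> l' \<subseteq> good \<C>' l'" by (auto simp: good_def \<C>'_def)
        then have "card (good \<C> l') \<le> card (good \<C>' l')" using fgood[OF that] by (intro card_mono) auto
        then show ?thesis by (intro divide_right_mono) auto
      qed
      have "card (good \<C> l) + card N = card (good \<C> l \<union> N)"
        using fgood[OF l] finite_subset[OF N_C finC[OF labl(2)]] N_hit goodhit[OF CU l] unfolding v_def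
        by (intro card_Un_disjoint[symmetric]) auto
      also have "\<dots> \<le> card (good \<C>' l)"
      proof (intro card_mono fgood[OF l] Un_least N_good)
        show "good \<C> l \<subseteq> good \<C>' l" by (auto simp: good_def \<C>'_def)
      qed
      finally have "real (card (good \<C> l)) + \<rho> / (4 * k) * card (B v) \<le> card (good \<C>' l)"
        using N_card by linarith
      then have "(real (card (good \<C> l)) + \<rho> / (4 * k) * card (B v)) / card (B v) \<le> card (good \<C>' l) / card (B v)"
        by (intro divide_right_mono) auto
      then have l_inc: "card (good \<C> l) / card (B (lv l)) + \<rho> / (4 * k) \<le> card (good \<C>' l) / card (B (lv l))"
        using cB[OF labl(2)] by (simp add: add_divide_distrib v_def)
      have "tot \<C> = card (good \<C> l) / card (B (lv l)) + (\<Sum>l\<in>Lab-{l}. card (good \<C> l) / card (B (lv l)))"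
        unfolding tot_def using Lab l by (simp add: sum.remove)
      moreover have "tot \<C>' = card (good \<C>' l) / card (B (lv l)) + (\<Sum>l\<in>Lab-{l}. card (good \<C>' l) / card (B (lv l)))"
        unfolding tot_def using Lab l by (simp add: sum.remove)
      moreover have "(\<Sum>l\<in>Lab-{l}. card (good \<C> l) / card (B (lv l))) \<le> (\<Sum>l\<in>Lab-{l}. card (good \<C>' l) / card (B (lv l)))"
        using mono by (intro sum_mono) auto
      ultimately show ?thesis using l_inc by linarith
    qed
    have hit': "card (hit \<C>' j) \<le> card (hit \<C> j) + s * \<rho> * card (B j)" if j: "j \<in> Q" for j
    proof (cases "j = v \<or> j \<in> Zv l")
      case True
      have "hit \<C>' j \<subseteq> hit \<C> j \<union> (\<Union>y\<in>S. nb y (C j))"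
        by (auto simp: hit_def \<C>'_def nb_def C_def)
      then have "card (hit \<C>' j) \<le> card (hit \<C> j \<union> (\<Union>y\<in>S. nb y (C j)))"
        using fS finC[OF j] finhit[OF j] by (intro card_mono) (auto simp: nb_def)
      also have "\<dots> \<le> card (hit \<C> j) + card (\<Union>y\<in>S. nb y (C j))" by (rule card_Un_le)
      also have "\<dots> \<le> card (hit \<C> j) + (\<Sum>y\<in>S. card (nb y (C j)))"
        using card_UN_le[of S] fS by simp
      finally have "real (card (hit \<C>' j)) \<le> real (card (hit \<C> j) + (\<Sum>y\<in>S. card (nb y (C j))))"
        by (rule of_nat_mono)
      also have "\<dots> = card (hit \<C> j) + (\<Sum>y\<in>S. real (card (nb y (C j))))" by simp
      also have "(\<Sum>y\<in>S. real (card (nb y (C j)))) \<le> card S * (\<rho> * card (C j))"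
        using nb_le True by (intro sum_bounded_above) auto
      also have "\<dots> \<le> s * (\<rho> * card (B j))"
        using fS \<rho>0 cCB[OF j] by (intro mult_mono) auto
      finally show ?thesis by (simp add: mult.assoc)
    next
      case False
      have "hit \<C>' j = hit \<C> j" using False by (auto simp: hit_def \<C>'_def v_def)
      then show ?thesis using \<rho>0 by simp
    qed
    have "\<C>' \<in> CC"
      unfolding CC_def
    proof (intro CollectI conjI ballI C'U)
      fix j assume j: "j \<in> Q"
      have "s * \<rho> \<le> s * (2 * \<theta>)" using \<rho>2 by (intro mult_left_mono) auto
      moreover have "s * (2 * \<theta>) = (8 * s * \<theta>) / 4" by simp
      ultimately have "s * \<rho> \<le> 1/4" using par(4) by linarith
      then have "s * \<rho> * card (B j) \<le> 1/4 * card (B j)" by (intro mult_right_mono) auto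
      then show "card (hit \<C>' j) \<le> 3/4 * card (B j)" using hit'[OF j] half[OF j] by linarith
      have "4 * real k * s * tot \<C> + s * \<rho> = 4 * real k * s * (tot \<C> + \<rho> / (4 * k))"
        using par by (simp add: field_simps)
      also have "\<dots> \<le> 4 * real k * s * tot \<C>'" using tot' by (intro mult_left_mono) auto
      finally have "(4 * real k * s * tot \<C> + s * \<rho>) * card (B j) \<le> 4 * real k * s * tot \<C>' * card (B j)"
        by (intro mult_right_mono) auto
      then show "card (hit \<C>' j) \<le> 4 * real k * s * tot \<C>' * card (B j)"
        using hit'[OF j] htot[OF j] by (simp add: distrib_right)
    qed
    then show False using max[of \<C>'] ne by (auto simp: \<C>'_def)
  qed
  \<comment> \<open>A block that is more than half hit forces \<open>tot\<close> above
    \<open>1 / (8 * k * s)\<close> by the second invariant. One of the at most \<open>L\<close>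
    labels then has the share of good vertices that \<open>\<kappa>f\<close> requires.\<close>
  then obtain j where j: "j \<in> Q" "card (B j) / 2 < card (hit \<C> j)" by blast
  have "card (B j) / 2 < 4 * real k * s * tot \<C> * card (B j)" using j htot[OF j(1)] by linarith
  then have tot8: "1 / (8 * real k * s) < tot \<C>" using cB[OF j(1)] par by (simp add: field_simps)
  have "\<exists>l\<in>Lab. 1 / (8 * real k * s * L) \<le> card (good \<C> l) / card (B (lv l))"
  proof (rule ccontr)
    assume "\<not> ?thesis"
    then have "tot \<C> \<le> card Lab * (1 / (8 * real k * s * L))"
      unfolding tot_def by (intro sum_bounded_above) force
    also have "\<dots> \<le> L * (1 / (8 * real k * s * L))" using Lab by (intro mult_right_mono) auto
    also have "\<dots> = 1 / (8 * real k * s)" using par by simp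
    finally show False using tot8 by linarith
  qed
  then obtain l where l: "l \<in> Lab" and gl: "1 / (8 * real k * s * L) \<le> card (good \<C> l) / card (B (lv l))" by blast
  have ll: "lu l \<in> Q" "lv l \<in> Q" "lu l \<noteq> lv l" "Zu l \<subseteq> Q" "Zv l \<subseteq> Q"
      "lu l \<notin> Zu l" "lu l \<notin> Zv l" "lv l \<notin> Zu l" "lv l \<notin> Zv l" "Zu l \<inter> Zv l = {}"
    using lab[OF l] by auto
  \<comment> \<open>A copy of \<open>tb l\<close> inside \<open>E\<close> has a good vertex as root,
    while its other vertices are unhit and so see no collected copy labelled \<open>l\<close>. It
    can be joined to the copy that witnesses goodness of its root.\<close>
  define E where "E i = (if i = lv l then good \<C> l else B i - hit \<C> i)" for i
  have "contr \<kappa>f Q E B"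
    unfolding contr_def
  proof (intro ballI conjI)
    fix i assume i: "i \<in> Q"
    show "E i \<subseteq> B i" using goodB by (auto simp: E_def)
    show "\<kappa>f * card (B i) \<le> card (E i)"
    proof (cases "i = lv l")
      case True
      have "\<kappa>f \<le> card (good \<C> l) / card (B (lv l))" using gl par by linarith
      then show ?thesis using cB[OF i] True by (simp add: E_def field_simps)
    next
      case False
      have "card (B i - hit \<C> i) = card (B i) - card (hit \<C> i)"
        using hitB finhit[OF i] by (intro card_Diff_subset)
      moreover have "card (hit \<C> i) \<le> card (B i)" using hitB finB[OF i] by (intro card_mono) auto
      ultimately have "1/4 * card (B i) \<le> card (E i)"
        using h34[OF i] False by (simp add: E_def of_nat_diff)
      moreover have "\<kappa>f * card (B i) \<le> 1/4 * card (B i)" using par by (intro mult_right_mono) auto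
      ultimately show ?thesis by linarith
    qed
  qed
  from alw_b[OF l this] obtain y U where U: "rcopy (kap l) (tb l) y U" "y \<in> E (lv l)" "U - {y} \<subseteq> (\<Union>i\<in>Zv l. E i)"
    by (auto simp: titem_def)
  have EB: "E i \<subseteq> B i" for i using goodB by (auto simp: E_def)
  have "y \<in> good \<C> l" using U by (simp add: E_def)
  then obtain x S where xSC: "(l, x, S) \<in> \<C>" "c x y = kap l" "\<And>z. z \<in> S - {x} \<Longrightarrow> c z y = 0"
    by (auto simp: good_def)
  have S: "rcopy (kap l) (ta l) x S" "x \<in> B (lu l)" "S - {x} \<subseteq> (\<Union>i\<in>Zu l. B i)"
    using xSC CU by (auto simp: Univ_def)
  have zero: "c a b = 0" if "a \<in> S" "b \<in> U" "(a, b) \<noteq> (x, y)" for a b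
  proof (cases "b = y")
    case True
    then show ?thesis using that xSC(3) by auto
  next
    case False
    then have "b \<in> (\<Union>i\<in>Zv l. E i)" using that(2) U(3) by blast
    then obtain i where i: "i \<in> Zv l" "b \<in> E i" by blast
    then have "i \<noteq> lv l" using ll by blast
    then have "b \<in> B i" "b \<notin> hit \<C> i" using i(2) by (auto simp: E_def)
    then show ?thesis using xSC(1) i that by (auto simp: hit_def)
  qed
  have "y \<in> B (lv l)" "U - {y} \<subseteq> (\<Union>i\<in>Zv l. B i)" using U EB by blast+
  then show ?thesis using l S U(1) zero xSC(2) by blast
qed

end

subsection \<open>Attaching leaves\<close>

text \<open>The enumeration is decreasing for \<open>b\<close> and increasing otherwise, so that a
  block beyond all others on the side given by \<open>b\<close> comes last; this is the place of a
  new leaf.\<close>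

definition en :: "bool \<Rightarrow> nat set \<Rightarrow> nat \<Rightarrow> nat" where
  "en b A a = (if b then rev (sorted_list_of_set A) ! a else sorted_list_of_set A ! a)"

lemma en_mem:
  assumes "finite A" "a < card A"
  shows "en b A a \<in> A"
proof -
  have "set (sorted_list_of_set A) = A" "length (sorted_list_of_set A) = card A" using assms by auto
  then show ?thesis unfolding en_def using assms(2)
    by (metis length_rev nth_mem set_rev)
qed

lemma en_inj:
  assumes "finite A"
  shows "inj_on (en b A) {..<card A}"
  using assms by (auto simp: inj_on_def en_def nth_eq_iff_index_eq)

lemma sorted_list_of_set_insert_max:
  fixes A :: "nat set"
  assumes "finite A" "\<And>w. w \<in> A \<Longrightarrow> w < v"
  shows "sorted_list_of_set (insert v A) = sorted_list_of_set A @ [v]"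
proof (rule sorted_distinct_set_unique)
  show "sorted (sorted_list_of_set A @ [v])" using assms by (force simp: sorted_append)
qed (use assms in \<open>auto simp del: sorted_list_of_set_insert_remove\<close>)

lemma sorted_list_of_set_insert_min:
  fixes A :: "nat set"
  assumes "finite A" "\<And>w. w \<in> A \<Longrightarrow> v < w"
  shows "sorted_list_of_set (insert v A) = v # sorted_list_of_set A"
proof (rule sorted_distinct_set_unique)
  show "sorted (v # sorted_list_of_set A)" using assms by force
qed (use assms in \<open>auto simp del: sorted_list_of_set_insert_remove\<close>)

lemma en_insert:
  assumes A: "finite A" and v: "\<And>w. w \<in> A \<Longrightarrow> (if b then v < w else w < v)" and a: "a \<le> card A"
  shows "en b (insert v A) a = ((en b A)(card A := v)) a"
proof (cases b)
  case True
  then have "sorted_list_of_set (insert v A) = v # sorted_list_of_set A"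
    using A v by (intro sorted_list_of_set_insert_min) auto
  then show ?thesis using True A a by (auto simp: en_def nth_append)
next
  case False
  then have "sorted_list_of_set (insert v A) = sorted_list_of_set A @ [v]"
    using A v by (intro sorted_list_of_set_insert_max) auto
  then show ?thesis using False A a by (auto simp: en_def nth_append)
qed

context coloured
begin

text \<open>Unlike in \<open>titem\<close>, each vertex has its own block: attaching a leaf
  restricts the block of the parent and the blocks of the other vertices in opposite ways.\<close>

definition pitem :: "(nat \<Rightarrow> nat) \<Rightarrow> nat \<Rightarrow> nat \<Rightarrow> (nat \<Rightarrow> nat) \<Rightarrow> (nat \<Rightarrow> 'a set) \<Rightarrow> bool" where
  "pitem p \<kappa> i q B \<longleftrightarrow> (\<exists>\<phi>. (\<forall>a\<le>i. \<phi> a \<in> B (q a)) \<and>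
     (\<forall>a b. a < b \<longrightarrow> b \<le> i \<longrightarrow> c (\<phi> a) (\<phi> b) = (if p b = a then \<kappa> else 0)))"

lemma pitem_mono:
  assumes "pitem p \<kappa> i q B'" "\<And>a. a \<le> i \<Longrightarrow> B' (q a) \<subseteq> B (q' a)"
  shows "pitem p \<kappa> i q' B"
  using assms unfolding pitem_def by (meson subsetD)

text \<open>\<open>selective_cover\<close> yields a set \<open>X\<close> in the new block whose
  \<open>\<kappa>\<close>-neighbours fill a linear part of the parent's block, while half of every
  other used block sees \<open>X\<close> in colour 0 only. A copy of the smaller tree exists inside
  these parts by \<open>alw\<close>, and a suitable vertex of \<open>X\<close> is the leaf. The
  ratio of degrees to be tolerated is \<open>K * k\<close>, with \<open>K\<close> from comparability
  and \<open>k\<close> from passing to the majority colour.\<close>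

lemma add_leaf:
  fixes B C D :: "nat \<Rightarrow> 'a set" and F K \<theta> \<kappa>f L :: real and k P :: nat
  assumes Q: "finite Q" and finB: "\<And>i. i \<in> Q \<Longrightarrow> finite (B i) \<and> B i \<noteq> {}"
    and C: "contr (1/2) Q C B"
    and D: "\<And>w. w \<in> Q \<Longrightarrow> D w \<subseteq> C w \<and> card (C w) \<le> P * card (D w)"
    and v: "v \<in> Q" and q: "\<And>a. a \<le> i \<Longrightarrow> q a \<in> Q \<and> q a \<noteq> v" "inj_on q {..i}" and p: "p (Suc i) \<le> i"
    and deg: "\<And>a y. a \<le> i \<Longrightarrow> y \<in> D (q a) \<Longrightarrow> F / K \<le> rd y (C v) \<and> rd y (C v) \<le> F \<and>
      card (nb y (C v)) \<le> k * card {z\<in>C v. c y z = \<kappa>}"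
    and sparse: "\<And>i j x. i \<in> Q \<Longrightarrow> j \<in> Q \<Longrightarrow> i \<noteq> j \<Longrightarrow> x \<in> B i \<Longrightarrow> card (nb x (B j)) \<le> \<theta> * card (B j)"
    and par: "0 < F" "1 \<le> K" "1 \<le> k" "1 \<le> P" "1 \<le> \<kappa>" "1 \<le> L" "2 * (K * k) * i \<le> L" "8 * P * L * \<theta> \<le> 1"
      "\<kappa>f \<le> 1 / (8 * P * L)"
    and alw: "\<And>E. contr \<kappa>f Q E B \<Longrightarrow> pitem p \<kappa> i q E"
  shows "pitem p \<kappa> (Suc i) (q(Suc i := v)) B"
proof -
  define u where "u = q (p (Suc i))"
  define W where "W = q ` {..i} - {u}"
  have uQ: "u \<in> Q" "u \<noteq> v" using q p by (auto simp: u_def)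
  have WQ: "w \<in> Q \<and> w \<noteq> v \<and> w \<noteq> u" if "w \<in> W" for w using that q by (auto simp: W_def)
  have cB: "0 < real (card (B w))" if "w \<in> Q" for w using finB[OF that] by (simp add: card_gt_0_iff)
  have CB: "C w \<subseteq> B w" "card (B w) / 2 \<le> card (C w)" if "w \<in> Q" for w
    using C that by (auto simp: contr_def)
  have cC: "0 < real (card (C w))" if "w \<in> Q" for w using CB(2)[OF that] cB[OF that] by linarith
  have finC: "finite (C w)" if "w \<in> Q" for w using finB[OF that] finite_subset[OF CB(1)[OF that]] by simp
  have DC: "D w \<subseteq> C w" if "w \<in> Q" for w using D[OF that] by simp
  have cD: "card (B w) \<le> 2 * real P * card (D w)" if "w \<in> Q" for w
  proof -
    have "real (card (C w)) \<le> real (P * card (D w))" using D[OF that] by (simp only: of_nat_le_iff)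
    then show ?thesis using CB(2)[OF that] by simp
  qed
  have cD0: "0 < card (D w)" if "w \<in> Q" for w
    using cD[OF that] cB[OF that] by (metis gr0I linorder_not_less mult_zero_right of_nat_0)
  have finD: "finite (D w)" "D w \<noteq> {}" if "w \<in> Q" for w using cD0[OF that] by (auto simp: card_gt_0_iff)
  have rng: "w \<in> q ` {..i}" if "w \<in> W \<or> w = u" for w using that p by (auto simp: W_def u_def)
  have "card W \<le> i"
  proof -
    have "u \<in> q ` {..i}" using rng by blast
    then have "card W = card (q ` {..i}) - 1" by (simp add: W_def)
    also have "card (q ` {..i}) = Suc i" using q(2) by (simp add: card_image)
    finally show ?thesis by simp
  qed
  have "\<exists>X\<subseteq>C v. card (D u) / (4 * L) \<le> card {y\<in>D u. \<exists>z\<in>X. c y z = \<kappa>} \<and>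
    (\<forall>w\<in>W. card {y\<in>D w. \<exists>z\<in>X. c y z \<noteq> 0} \<le> card (D w) / 2)"
  proof (rule selective_cover)
    show "finite (C v)" "C v \<noteq> {}" using finC[OF v] cC[OF v] by auto
    show "finite (D u)" "D u \<noteq> {}" using finD uQ by auto
    show "finite W" by (simp add: W_def)
    show "finite (D w) \<and> D w \<noteq> {}" if "w \<in> W" for w using finD WQ[OF that] by auto
    show "0 < F" "1 \<le> L" "0 < K * k" using par by auto
    have "2 * (K * k) * card W \<le> 2 * (K * k) * i" using \<open>card W \<le> i\<close> par by (intro mult_left_mono) auto
    then show "2 * (K * k) * card W \<le> L" using par by linarith
  next
    fix y assume y: "y \<in> D u"
    obtain a where a: "a \<le> i" "u = q a" using rng[of u] by auto
    have "F / K * card (C v) \<le> card (nb y (C v))"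
      using deg[OF a(1), of y] y a cC[OF v] by (simp add: rd_def field_simps)
    also have "\<dots> \<le> real (k * card {z\<in>C v. c y z = \<kappa>})"
      using deg[OF a(1), of y] y a by (simp only: of_nat_le_iff)
    finally show "F / (K * k) * card (C v) \<le> card {z\<in>C v. c y z = \<kappa>}"
      using par by (simp add: field_simps)
  next
    fix w y assume w: "w \<in> W" and y: "y \<in> D w"
    obtain a where a: "a \<le> i" "w = q a" using rng[of w] w by auto
    show "card {z\<in>C v. c y z \<noteq> 0} \<le> F * card (C v)"
      using deg[OF a(1), of y] y a cC[OF v] by (simp add: rd_def nb_def field_simps)
  next
    fix z assume z: "z \<in> C v"
    have "{y\<in>D u. c y z = \<kappa>} \<subseteq> nb z (B u)"
      using DC[OF uQ(1)] CB(1)[OF uQ(1)] par by (auto simp: nb_def sym[of z])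
    then have "card {y\<in>D u. c y z = \<kappa>} \<le> card (nb z (B u))"
      using finB[OF uQ(1)] finite_subset[OF nb_subset] by (intro card_mono) auto
    then have "real (card {y\<in>D u. c y z = \<kappa>}) \<le> card (nb z (B u))" by (rule of_nat_mono)
    also have "\<dots> \<le> \<theta> * card (B u)" using sparse[OF v uQ(1)] uQ z CB(1)[OF v] by auto
    finally have 1: "real (card {y\<in>D u. c y z = \<kappa>}) \<le> \<theta> * card (B u)" .
    have "0 \<le> \<theta> * card (B u)" using 1 by linarith
    then have th: "0 \<le> \<theta>" using cB[OF uQ(1)] by (simp add: zero_le_mult_iff)
    have "\<theta> * card (B u) \<le> \<theta> * (2 * real P * card (D u))" using cD[OF uQ(1)] th by (rule mult_left_mono)
    also have "\<dots> = (8 * P * L * \<theta>) * (card (D u) / (4 * L))" using par by simp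
    also have "\<dots> \<le> 1 * (card (D u) / (4 * L))" using par by (intro mult_right_mono) auto
    finally show "card {y\<in>D u. c y z = \<kappa>} \<le> card (D u) / (4 * L)" using 1 by linarith
  qed
  then obtain X where X: "X \<subseteq> C v" and Xu: "card (D u) / (4 * L) \<le> card {y\<in>D u. \<exists>z\<in>X. c y z = \<kappa>}"
    and Xw: "\<And>w. w \<in> W \<Longrightarrow> card {y\<in>D w. \<exists>z\<in>X. c y z \<noteq> 0} \<le> card (D w) / 2" by blast
  define E where "E w = (if w = u then {y\<in>D u. \<exists>z\<in>X. c y z = \<kappa>}
    else if w \<in> W then {y\<in>D w. \<forall>z\<in>X. c y z = 0} else B w)" for w
  have EB: "E w \<subseteq> B w" if "w \<in> Q" for w using DC[OF that] CB(1)[OF that] by (auto simp: E_def)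
  have "contr \<kappa>f Q E B"
    unfolding contr_def
  proof (intro ballI conjI EB)
    fix w assume w: "w \<in> Q"
    have PL: "1 \<le> real P * L" using par mult_mono[of 1 "real P" 1 L] by simp
    have kf1: "\<kappa>f * card (B w) \<le> 1 / (8 * P * L) * card (B w)"
      using par by (intro mult_right_mono) auto
    also have "\<dots> \<le> 1 / (8 * P * L) * (2 * real P * card (D w))" 
      using cD[OF w] par by (intro mult_left_mono) auto
    also have "\<dots> = card (D w) / (4 * L)" using par by simp
    finally have kf: "\<kappa>f * card (B w) \<le> card (D w) / (4 * L)" .
    have kfB: "\<kappa>f * card (B w) \<le> card (B w)"
    proof -
      have "1 / (8 * P * L) \<le> 1" using PL by (simp add: field_simps)
      then have "1 / (8 * P * L) * card (B w) \<le> (1::real) * card (B w)" by (intro mult_right_mono) auto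
      then show ?thesis using kf1 by linarith
    qed
    consider "w = u" | "w \<in> W" | "w \<noteq> u" "w \<notin> W" by blast
    then show "\<kappa>f * card (B w) \<le> card (E w)"
    proof cases
      case 1 then show ?thesis using kf Xu by (simp add: E_def)
    next
      case 2
      have "card (D w) = card {y\<in>D w. \<exists>z\<in>X. c y z \<noteq> 0} + card {y\<in>D w. \<forall>z\<in>X. c y z = 0}"
        using finD[OF w] by (subst card_Un_disjoint[symmetric]) (auto intro: arg_cong[where f=card])
      then have "real (card (D w)) = card {y\<in>D w. \<exists>z\<in>X. c y z \<noteq> 0} + card {y\<in>D w. \<forall>z\<in>X. c y z = 0}" by simp
      then have "card (D w) / 2 \<le> card {y\<in>D w. \<forall>z\<in>X. c y z = 0}" using Xw[OF 2] by linarith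
      moreover have "card (D w) / (4 * L) \<le> card (D w) / 2" using par by (intro divide_left_mono) auto
      ultimately show ?thesis using kf 2 WQ[OF 2] by (simp add: E_def)
    next
      case 3 then show ?thesis using kfB by (simp add: E_def)
    qed
  qed
  from alw[OF this] obtain \<phi> where \<phi>: "\<And>a. a \<le> i \<Longrightarrow> \<phi> a \<in> E (q a)"
    "\<And>a b. a < b \<Longrightarrow> b \<le> i \<Longrightarrow> c (\<phi> a) (\<phi> b) = (if p b = a then \<kappa> else 0)"
    unfolding pitem_def by blast
  have "\<phi> (p (Suc i)) \<in> E u" using \<phi>(1)[OF p] by (simp add: u_def)
  then obtain z where z: "z \<in> X" "c (\<phi> (p (Suc i))) z = \<kappa>" by (auto simp: E_def)
  have zero: "c (\<phi> a) z = 0" if a: "a \<le> i" "a \<noteq> p (Suc i)" for a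
  proof -
    have "q a \<noteq> u" using q(2) a p by (auto simp: u_def inj_on_def)
    then have "\<phi> a \<in> {y\<in>D (q a). \<forall>z\<in>X. c y z = 0}" using \<phi>(1)[OF a(1)] a by (auto simp: E_def W_def)
    then show ?thesis using z by blast
  qed
  have zB: "z \<in> B v" using z X CB(1)[OF v] by blast
  show ?thesis
    unfolding pitem_def
  proof (intro exI[of _ "\<phi>(Suc i := z)"] conjI allI impI)
    fix a assume "a \<le> Suc i"
    then show "(\<phi>(Suc i := z)) a \<in> B ((q(Suc i := v)) a)"
      using zB \<phi>(1)[of a] EB[of "q a"] q(1)[of a] by (cases "a = Suc i") auto
  next
    fix a b assume "a < b" "b \<le> Suc i"
    then show "c ((\<phi>(Suc i := z)) a) ((\<phi>(Suc i := z)) b) = (if p b = a then \<kappa> else 0)"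
      using \<phi>(2) z zero by (cases "b = Suc i") auto
  qed
qed

end

subsection \<open>Monochromatic trees\<close>

primrec subs :: "rtree \<Rightarrow> rtree set" where
  "subs Leaf = {Leaf}"
| "subs (Join s t) = insert (Join s t) (subs s \<union> subs t)"

lemma subs_self: "t \<in> subs t"
  by (cases t) auto

lemma finite_subs: "finite (subs t)"
  by (induction t) auto

lemma sz_subs: "s \<in> subs t \<Longrightarrow> sz s \<le> sz t"
  by (induction t) (auto intro: trans_le_add1 trans_le_add2)

lemma subs_join: "Join s t \<in> subs r \<Longrightarrow> s \<in> subs r \<and> t \<in> subs r"
  using subs_self by (induction r) auto

text \<open>If no join failed, the trees available on both sides would include \<open>Leaf\<close>
  and be closed under the joins occurring inside \<open>r\<close>, hence include \<open>r\<close>.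
  Both orientations are offered because the order of the two root blocks decides which root can be
  extreme in the union.\<close>

lemma failing_join:
  assumes leaf: "\<And>b. al b Leaf" and dich: "\<And>b t. t \<in> subs r \<Longrightarrow> al b t \<or> ne b t" and n: "\<not> al a r"
  shows "(\<exists>s t. Join s t \<in> subs r \<and> al a s \<and> al b t \<and> ne a (Join s t)) \<or>
         (\<exists>s t. Join t s \<in> subs r \<and> al a s \<and> al b t \<and> ne b (Join t s))"
proof (rule ccontr)
  assume "\<not> ?thesis"
  then have 1: "\<And>s t. Join s t \<in> subs r \<Longrightarrow> al a s \<Longrightarrow> al b t \<Longrightarrow> al a (Join s t)"
    and 2: "\<And>s t. Join t s \<in> subs r \<Longrightarrow> al a s \<Longrightarrow> al b t \<Longrightarrow> al b (Join t s)"
    using dich by blast+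
  have "t \<in> subs r \<Longrightarrow> al a t \<and> al b t" for t
  proof (induction t)
    case Leaf
    then show ?case using leaf by blast
  next
    case (Join s t)
    then show ?case using 1[of s t] 2[of s t] subs_join by blast
  qed
  then show False using n subs_self by blast
qed

text \<open>Uniformity over index sets of equal size is informative for rooted trees only if the
  index set itself determines the block of the root.\<close>

definition ext :: "bool \<Rightarrow> nat set \<Rightarrow> nat" where
  "ext b A = (if b then Min A else Max A)"

lemma ext_eq:
  assumes "finite A" "u \<in> A" "\<And>w. w \<in> A \<Longrightarrow> w \<noteq> u \<Longrightarrow> (if b then u < w else w < u)"
  shows "ext b A = u"
proof (cases b)
  case True
  then have "Min A = u" using assms by (intro Min_eqI) (auto, metis less_imp_le order_refl)
  then show ?thesis using True by (simp add: ext_def)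
next
  case False
  then have "Max A = u" using assms by (intro Max_eqI) (auto, metis less_imp_le order_refl)
  then show ?thesis using False by (simp add: ext_def)
qed

lemma ext_mem: "finite A \<Longrightarrow> A \<noteq> {} \<Longrightarrow> ext b A \<in> A"
  by (simp add: ext_def)

text \<open>\<open>TI b \<kappa> t\<close>: a copy of \<open>t\<close> whose root lies in the first (\<open>b\<close>) or last (\<open>\<not> b\<close>) of the given blocks;
  \<open>FI b \<kappa> i\<close>: a copy of the first \<open>i + 1\<close> vertices of the labelled tree with parent function \<open>p\<close>.\<close>

datatype item = TI bool nat rtree | FI bool nat nat

primrec isz :: "item \<Rightarrow> nat" where
  "isz (TI b \<kappa> t) = sz t"
| "isz (FI b \<kappa> i) = Suc i"

context coloured
begin

primrec holds :: "(nat \<Rightarrow> nat) \<Rightarrow> item \<Rightarrow> nat set \<Rightarrow> (nat \<Rightarrow> 'a set) \<Rightarrow> bool" where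
  "holds p (TI b \<kappa> t) A B = titem \<kappa> t B (ext b A) (A - {ext b A})"
| "holds p (FI b \<kappa> i) A B = pitem p \<kappa> i (en b A) B"

lemma holds_mono:
  assumes "holds p it A B'" "\<And>i. i \<in> A \<Longrightarrow> B' i \<subseteq> B i" "finite A" "card A = isz it"
  shows "holds p it A B"
proof (cases it)
  case (TI b \<kappa> t)
  then have "A \<noteq> {}" using assms sz_pos[of t] by auto
  then have "ext b A \<in> A" using assms ext_mem by blast
  then show ?thesis using assms TI by (auto intro: titem_mono)
next
  case (FI b \<kappa> i)
  then have "en b A a \<in> A" if "a \<le> i" for a using that assms en_mem[of A a b] by simp
  then show ?thesis using assms FI by (auto intro: pitem_mono)
qed

text \<open>Quantifying over all \<open>\<kappa>f\<close>-shrinkings allows blocks to be restricted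
  before a copy is requested. The negative counterpart \<open>nev\<close> can refer to
  \<open>B\<close> alone, as shrinking creates no copies.\<close>

definition alw :: "(nat \<Rightarrow> nat) \<Rightarrow> real \<Rightarrow> nat set \<Rightarrow> (nat \<Rightarrow> 'a set) \<Rightarrow> item \<Rightarrow> bool" where
  "alw p \<kappa>f Q B it \<longleftrightarrow> (\<forall>A\<subseteq>Q. card A = isz it \<longrightarrow> (\<forall>C. contr \<kappa>f Q C B \<longrightarrow> holds p it A C))"

definition nev :: "(nat \<Rightarrow> nat) \<Rightarrow> nat set \<Rightarrow> (nat \<Rightarrow> 'a set) \<Rightarrow> item \<Rightarrow> bool" where
  "nev p Q B it \<longleftrightarrow> (\<forall>A\<subseteq>Q. card A = isz it \<longrightarrow> \<not> holds p it A B)"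

lemma alw_titem:
  assumes "alw p \<kappa>f Q B (TI b \<kappa> t)" "finite Q" "u \<in> Q" "Z \<subseteq> Q" "u \<notin> Z" "Suc (card Z) = sz t"
    "\<And>w. w \<in> Z \<Longrightarrow> (if b then u < w else w < u)" "contr \<kappa>f Q C B"
  shows "titem \<kappa> t C u Z"
proof -
  have fin: "finite (insert u Z)" using assms finite_subset by auto
  have "card (insert u Z) = isz (TI b \<kappa> t)" using assms fin by simp
  moreover have "insert u Z \<subseteq> Q" using assms by simp
  ultimately have "holds p (TI b \<kappa> t) (insert u Z) C" using assms unfolding alw_def by blast
  moreover have "ext b (insert u Z) = u" using fin assms by (intro ext_eq) auto
  moreover have "insert u Z - {u} = Z" using assms by auto
  ultimately show ?thesis by simp
qed

lemma nev_titem: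
  assumes "nev p Q B (TI b \<kappa> t)" "finite Q" "u \<in> Q" "Z \<subseteq> Q" "u \<notin> Z" "Suc (card Z) = sz t"
    "\<And>w. w \<in> Z \<Longrightarrow> (if b then u < w else w < u)"
  shows "\<not> titem \<kappa> t B u Z"
proof -
  have fin: "finite (insert u Z)" using assms finite_subset by auto
  have "card (insert u Z) = isz (TI b \<kappa> t)" using assms fin by simp
  moreover have "insert u Z \<subseteq> Q" using assms by simp
  ultimately have "\<not> holds p (TI b \<kappa> t) (insert u Z) B" using assms(1) unfolding nev_def by blast
  moreover have "ext b (insert u Z) = u" using fin assms by (intro ext_eq) auto
  moreover have "insert u Z - {u} = Z" using assms by auto
  ultimately show ?thesis by simp
qed

lemma alw_holds:
  assumes "alw p \<kappa>f Q B it" "\<kappa>f \<le> 1" "isz it \<le> card Q" "finite Q"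
  shows "\<exists>A\<subseteq>Q. card A = isz it \<and> holds p it A B"
proof -
  obtain A where "A \<subseteq> Q" "card A = isz it" using assms obtain_subset_with_card_n by metis
  then show ?thesis using assms contr_refl[of \<kappa>f Q B] unfolding alw_def by blast
qed

lemma titem_join:
  assumes "rcopy \<kappa> s x S" "rcopy \<kappa> t y U" "x \<in> B u" "S - {x} \<subseteq> (\<Union>i\<in>Z1. B i)"
    "y \<in> B v" "U - {y} \<subseteq> (\<Union>i\<in>Z2. B i)" "c x y = \<kappa>" "S \<inter> U = {}"
    "\<And>a b. a \<in> S \<Longrightarrow> b \<in> U \<Longrightarrow> (a, b) \<noteq> (x, y) \<Longrightarrow> c a b = 0"
  shows "titem \<kappa> (Join s t) B u (insert v (Z1 \<union> Z2))"
  unfolding titem_def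
proof (intro exI conjI)
  show "rcopy \<kappa> (Join s t) x (S \<union> U)" using assms by (intro rcopy.join) auto
  show "x \<in> B u" by fact
  show "S \<union> U - {x} \<subseteq> (\<Union>i\<in>insert v (Z1 \<union> Z2). B i)" using assms by auto
qed

text \<open>Suppose not. By \<open>dich\<close> every colour has a possible initial part of the
  labelled tree whose next extension is impossible, and an impossible join of two possible trees.
  \<open>slice\<close> is applied to half-size subfamilies. If the dominant class of blocks has
  degrees comparable to those of \<open>u\<close>, \<open>add_leaf\<close> produces an impossible
  initial part. So each subfamily has a dominant class of much smaller degrees, which is what
  \<open>join_copies\<close> needs as \<open>step\<close>, and an impossible join results.
  \<open>N\<close> leaves \<open>n1\<close> blocks besides \<open>u\<close> and \<open>v\<close> in
  one of \<open>4 * Suc k\<close> classes, \<open>P\<close> is the loss in \<open>slice\<close>,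
  \<open>L\<close> bounds the number of labels, and \<open>Lf\<close> is the constant
  \<open>L\<close> of \<open>add_leaf\<close>.\<close>

lemma stable_blocks:
  fixes B :: "nat \<Rightarrow> 'a set" and K \<theta> \<kappa>f Lf :: real and k m N P L n1 :: nat
  assumes Q: "finite Q" "card Q = N" and k: "1 \<le> k" and p: "\<And>b. 1 \<le> b \<Longrightarrow> p b < b"
    and disj: "\<And>i j. i \<in> Q \<Longrightarrow> j \<in> Q \<Longrightarrow> i \<noteq> j \<Longrightarrow> B i \<inter> B j = {}"
    and finB: "\<And>i. i \<in> Q \<Longrightarrow> finite (B i) \<and> B i \<noteq> {}"
    and col: "\<And>x y. c x y \<le> k"
    and sparse: "\<And>i j x. i \<in> Q \<Longrightarrow> j \<in> Q \<Longrightarrow> i \<noteq> j \<Longrightarrow> x \<in> B i \<Longrightarrow> card (nb x (B j)) \<le> \<theta> * card (B j)"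
    and coh: "\<And>i j X Y. i \<in> Q \<Longrightarrow> j \<in> Q \<Longrightarrow> i \<noteq> j \<Longrightarrow> X \<subseteq> B i \<Longrightarrow> Y \<subseteq> B j \<Longrightarrow>
      card (B i) / 4 \<le> card X \<Longrightarrow> card (B j) / 4 \<le> card Y \<Longrightarrow> \<exists>x\<in>X. \<exists>y\<in>Y. c x y \<noteq> 0"
    and dich: "\<And>it. it \<in> {TI b \<kappa> t |b \<kappa> t. \<kappa> \<in> {1..k} \<and> t \<in> subs r} \<union> {FI b \<kappa> i |b \<kappa> i. \<kappa> \<in> {1..k} \<and> i \<le> m} \<Longrightarrow>
      alw p \<kappa>f Q B it \<or> nev p Q B it"
    and n1: "n1 = 2 * sz r + m + 2" and N: "N = 2 + 4 * Suc k * n1" and K: "K = 2 * real k * sz r + 1"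
    and P: "P = 2 * N * k * 4 ^ N" and L: "L = k * card (subs r) * card (subs r) * N * N * 2 ^ N * 2 ^ N"
    and Lf: "Lf = 2 * (K * k) * Suc m"
    and par: "0 < \<kappa>f" "\<kappa>f \<le> 1/4" "\<kappa>f \<le> 1 / (2 * P)" "\<kappa>f \<le> 1 / (8 * real k * sz r * L)"
      "\<kappa>f \<le> 1 / (8 * P * Lf)" "8 * sz r * \<theta> \<le> 1" "8 * P * Lf * \<theta> \<le> 1"
  shows "\<exists>\<kappa>\<in>{1..k}. \<exists>b. alw p \<kappa>f Q B (TI b \<kappa> r) \<or> alw p \<kappa>f Q B (FI b \<kappa> m)"
proof (rule ccontr)
  assume nc: "\<not> ?thesis"
  have N2: "2 \<le> N" using N by simp
  have szr: "1 \<le> sz r" by (rule sz_pos)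
  obtain w0 where w0: "w0 \<in> Q" using Q N2 by fastforce
  have leafTI: "alw p \<kappa>f Q B (TI b \<kappa> Leaf)" if \<kappa>: "\<kappa> \<in> {1..k}" for b \<kappa>
  proof -
    have "Leaf \<in> subs r" by (induction r) auto
    moreover have "\<not> nev p Q B (TI b \<kappa> Leaf)"
    proof
      assume nv: "nev p Q B (TI b \<kappa> Leaf)"
      have "\<not> titem \<kappa> Leaf B w0 {}"
        by (rule nev_titem[OF nv Q(1) w0]) auto
      moreover obtain x where "x \<in> B w0" using finB[OF w0] by blast
      then have "titem \<kappa> Leaf B w0 {}" unfolding titem_def using rcopy.leaf by blast
      ultimately show False by blast
    qed
    ultimately show ?thesis using dich[of "TI b \<kappa> Leaf"] \<kappa> by blast
  qed
  have leafFI: "alw p \<kappa>f Q B (FI b \<kappa> 0)" if \<kappa>: "\<kappa> \<in> {1..k}" for b \<kappa>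
  proof -
    have "\<not> nev p Q B (FI b \<kappa> 0)"
    proof
      assume "nev p Q B (FI b \<kappa> 0)"
      then have "\<not> holds p (FI b \<kappa> 0) {w0} B" using w0 unfolding nev_def by simp
      moreover have "en b {w0} 0 \<in> {w0}" by (rule en_mem) auto
      moreover obtain x where "x \<in> B w0" using finB[OF w0] by blast
      ultimately show False by (auto simp: pitem_def)
    qed
    then show ?thesis using dich[of "FI b \<kappa> 0"] \<kappa> by blast
  qed
  have exF: "\<exists>i<m. alw p \<kappa>f Q B (FI b \<kappa> i) \<and> nev p Q B (FI b \<kappa> (Suc i))" if \<kappa>: "\<kappa> \<in> {1..k}" for b \<kappa>
  proof (rule ccontr)
    assume n: "\<not> ?thesis"
    have "i \<le> m \<Longrightarrow> alw p \<kappa>f Q B (FI b \<kappa> i)" for i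
    proof (induction i)
      case 0 then show ?case using leafFI \<kappa> by simp
    next
      case (Suc i)
      then show ?case using n dich[of "FI b \<kappa> (Suc i)"] \<kappa> by auto
    qed
    then show False using nc \<kappa> by blast
  qed
  have exT: "(\<exists>s t. Join s t \<in> subs r \<and> alw p \<kappa>f Q B (TI a \<kappa> s) \<and> alw p \<kappa>f Q B (TI b \<kappa> t) \<and> nev p Q B (TI a \<kappa> (Join s t))) \<or>
         (\<exists>s t. Join t s \<in> subs r \<and> alw p \<kappa>f Q B (TI a \<kappa> s) \<and> alw p \<kappa>f Q B (TI b \<kappa> t) \<and> nev p Q B (TI b \<kappa> (Join t s)))"
    if \<kappa>: "\<kappa> \<in> {1..k}" for a b \<kappa>
  proof (rule failing_join)
    show "\<not> alw p \<kappa>f Q B (TI a \<kappa> r)" using nc \<kappa> by blast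
  qed (use leafTI[OF \<kappa>] dich \<kappa> in blast)+
  \<comment> \<open>A label is a configuration that promises two trees but admits no joined copy of
    them, so the conclusion of \<open>join_copies\<close> for any label is absurd. Labels are needed
    because the configuration found by \<open>slice\<close> changes with the subfamily.\<close>
  define nojoin where "nojoin \<kappa> s t u v Z1 Z2 \<longleftrightarrow> \<not> (\<exists>x S y U. rcopy \<kappa> s x S \<and> rcopy \<kappa> t y U \<and>
    x \<in> B u \<and> S - {x} \<subseteq> (\<Union>i\<in>Z1. B i) \<and> y \<in> B v \<and> U - {y} \<subseteq> (\<Union>i\<in>Z2. B i) \<and>
    c x y = \<kappa> \<and> (\<forall>a\<in>S. \<forall>b\<in>U. (a, b) \<noteq> (x, y) \<longrightarrow> c a b = 0))" for \<kappa> s t u v Z1 Z2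
  define isl where "isl \<kappa> s t u v Z1 Z2 \<longleftrightarrow> \<kappa> \<in> {1..k} \<and> s \<in> subs r \<and> t \<in> subs r \<and> u \<in> Q \<and> v \<in> Q \<and>
    Z1 \<subseteq> Q \<and> Z2 \<subseteq> Q \<and> u \<noteq> v \<and> u \<notin> Z1 \<and> u \<notin> Z2 \<and> v \<notin> Z1 \<and> v \<notin> Z2 \<and> Z1 \<inter> Z2 = {} \<and>
    (\<forall>C. contr \<kappa>f Q C B \<longrightarrow> titem \<kappa> s C u Z1) \<and> (\<forall>C. contr \<kappa>f Q C B \<longrightarrow> titem \<kappa> t C v Z2) \<and>
    nojoin \<kappa> s t u v Z1 Z2" for \<kappa> s t u v Z1 Z2
  define Lab where "Lab = {(\<kappa>, s, t, u, v, Z1, Z2). isl \<kappa> s t u v Z1 Z2}"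
  have LabU: "Lab \<subseteq> {1..k} \<times> subs r \<times> subs r \<times> Q \<times> Q \<times> Pow Q \<times> Pow Q" (is "_ \<subseteq> ?U")
    by (auto simp: Lab_def isl_def)
  have finU: "finite ?U" using Q finite_subs by simp
  have "card ?U = L" using Q L by (simp add: card_cartesian_product card_Pow)
  then have LabL: "finite Lab" "card Lab \<le> L" using LabU finU finite_subset card_mono by (blast, metis)
  have Lpos: "1 \<le> L" using L k N2 subs_self[of r] finite_subs[of r]
    by (simp add: Suc_le_eq card_gt_0_iff) blast
  have Ppos: "1 \<le> P" using P k N2 by (simp add: Suc_le_eq)
  have K1: "1 < K" using K k szr by simp
  have Lf1: "1 \<le> Lf"
  proof -
    have "1 * 1 \<le> K * k" using K1 k by (intro mult_mono) auto
    then have "1 * 1 \<le> (2 * (K * k)) * Suc m" by (intro mult_mono) auto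
    then show ?thesis using Lf by simp
  qed
  have "\<exists>l\<in>Lab. \<exists>x S y U. rcopy (fst l) (fst (snd l)) x S \<and> rcopy (fst l) (fst (snd (snd l))) y U \<and>
    x \<in> B (fst (snd (snd (snd l)))) \<and> S - {x} \<subseteq> (\<Union>i\<in>fst (snd (snd (snd (snd (snd l))))). B i) \<and>
    y \<in> B (fst (snd (snd (snd (snd l))))) \<and> U - {y} \<subseteq> (\<Union>i\<in>snd (snd (snd (snd (snd (snd l))))). B i) \<and>
    c x y = fst l \<and> (\<forall>a\<in>S. \<forall>b\<in>U. (a, b) \<noteq> (x, y) \<longrightarrow> c a b = 0)"
  proof (rule join_copies[where k = k and s = "sz r" and L = L and \<kappa>s = "1 / P" and K = K and \<theta> = \<theta> and \<kappa>f = \<kappa>f and Q = Q])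
    fix l assume "l \<in> Lab"
    then obtain \<kappa> s t u v Z1 Z2 where l: "l = (\<kappa>, s, t, u, v, Z1, Z2)" "isl \<kappa> s t u v Z1 Z2" by (auto simp: Lab_def)
    then show "fst (snd (snd (snd l))) \<in> Q \<and> fst (snd (snd (snd (snd l)))) \<in> Q \<and>
      fst (snd (snd (snd l))) \<noteq> fst (snd (snd (snd (snd l)))) \<and>
      fst (snd (snd (snd (snd (snd l))))) \<subseteq> Q \<and> snd (snd (snd (snd (snd (snd l))))) \<subseteq> Q \<and>
      fst (snd (snd (snd l))) \<notin> fst (snd (snd (snd (snd (snd l))))) \<and>
      fst (snd (snd (snd l))) \<notin> snd (snd (snd (snd (snd (snd l))))) \<and>
      fst (snd (snd (snd (snd l)))) \<notin> fst (snd (snd (snd (snd (snd l))))) \<and>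
      fst (snd (snd (snd (snd l)))) \<notin> snd (snd (snd (snd (snd (snd l))))) \<and>
      fst (snd (snd (snd (snd (snd l))))) \<inter> snd (snd (snd (snd (snd (snd l))))) = {} \<and>
      sz (fst (snd l)) \<le> sz r \<and> 1 \<le> fst l"
      using sz_subs by (auto simp: isl_def)
    fix C assume C: "contr \<kappa>f Q C B"
    show "titem (fst l) (fst (snd l)) C (fst (snd (snd (snd l)))) (fst (snd (snd (snd (snd (snd l))))))"
      using l C by (simp add: isl_def)
    show "titem (fst l) (fst (snd (snd l))) C (fst (snd (snd (snd (snd l))))) (snd (snd (snd (snd (snd (snd l))))))"
      using l C by (simp add: isl_def)
  next
    fix C assume C: "contr (1/2) Q C B"
    have CB: "C w \<subseteq> B w" "card (B w) / 2 \<le> card (C w)" if "w \<in> Q" for w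
      using C that by (auto simp: contr_def)
    have finC: "finite (C w) \<and> C w \<noteq> {}" if w: "w \<in> Q" for w
    proof -
      have "0 < real (card (B w))" using finB[OF w] by (simp add: card_gt_0_iff)
      then have "0 < real (card (C w))" using CB(2)[OF w] by linarith
      then show ?thesis by (simp add: card_gt_0_iff)
    qed
    \<comment> \<open>Otherwise half of \<open>C w\<close>, which is at least a quarter of
      \<open>B w\<close>, would be joined to \<open>C j\<close> in colour 0 only, against
      \<open>coh\<close>.\<close>
    have pos: "2 * card {x\<in>C w. nb x (C j) = {}} < card (C w)" if wj: "w \<in> Q" "j \<in> Q" "w \<noteq> j" for w j
    proof (rule ccontr)
      assume "\<not> ?thesis"
      then have "card (C w) \<le> 2 * card {x\<in>C w. nb x (C j) = {}}" by simp
      then have "real (card (C w)) \<le> 2 * real (card {x\<in>C w. nb x (C j) = {}})" by linarith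
      then have "card (B w) / 4 \<le> card {x\<in>C w. nb x (C j) = {}}" using CB(2)[OF wj(1)] by linarith
      moreover have "card (B j) / 4 \<le> card (C j)" using CB(2)[OF wj(2)] by linarith
      moreover have "{x\<in>C w. nb x (C j) = {}} \<subseteq> B w" using CB(1)[OF wj(1)] by auto
      ultimately obtain x y where "x \<in> C w" "nb x (C j) = {}" "y \<in> C j" "c x y \<noteq> 0"
        using coh[OF wj, of "{x\<in>C w. nb x (C j) = {}}" "C j"] CB(1)[OF wj(2)] by blast
      then show False by (auto simp: nb_def)
    qed
    have cQ2: "2 \<le> card Q" using N2 Q by simp
    obtain u v D g where uv: "u \<in> Q" "v \<in> Q" "u \<noteq> v"
      and D: "\<And>w. w \<in> Q \<Longrightarrow> D w \<subseteq> C w \<and> card (C w) \<le> P * card (D w)"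
      and upos: "\<And>x. x \<in> D u \<Longrightarrow> 0 < rd x (C v)"
      and top: "\<And>x w y j. x \<in> D u \<Longrightarrow> w \<in> Q - {u} \<Longrightarrow> y \<in> D w \<Longrightarrow> j \<in> Q - {w} \<Longrightarrow> rd y (C j) \<le> rd x (C v)"
      and topu: "\<And>x j. x \<in> D u \<Longrightarrow> j \<in> Q - {u} \<Longrightarrow> rd x (C j) \<le> rd x (C v)"
      and g: "\<And>w. w \<in> Q - {v} \<Longrightarrow> g w \<in> {1..k}"
        "\<And>w x. w \<in> Q - {v} \<Longrightarrow> x \<in> D w \<Longrightarrow> card (nb x (C v)) \<le> k * card {z\<in>C v. c x z = g w}"
      and sf: "\<And>w. w \<in> Q - {u,v} \<Longrightarrow> (\<forall>x\<in>D u. \<forall>y\<in>D w. K * rd y (C v) \<le> rd x (C v)) \<or>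
                  (\<forall>x\<in>D u. \<forall>y\<in>D w. rd x (C v) < K * rd y (C v))"
    proof -
      have s: "\<exists>u v D g. u \<in> Q \<and> v \<in> Q \<and> u \<noteq> v \<and>
    (\<forall>w\<in>Q. D w \<subseteq> C w \<and> card (C w) \<le> 2 * card Q * k * 4 ^ card Q * card (D w)) \<and>
    (\<forall>x\<in>D u. 0 < rd x (C v)) \<and>
    (\<forall>x\<in>D u. \<forall>w\<in>Q - {u}. \<forall>y\<in>D w. \<forall>j\<in>Q-{w}. rd y (C j) \<le> rd x (C v)) \<and>
    (\<forall>x\<in>D u. \<forall>j\<in>Q-{u}. rd x (C j) \<le> rd x (C v)) \<and>
    (\<forall>w\<in>Q-{v}. g w \<in> {1..k} \<and> (\<forall>x\<in>D w. card (nb x (C v)) \<le> k * card {z\<in>C v. c x z = g w})) \<and>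
    (\<forall>w\<in>Q-{u,v}. (\<forall>x\<in>D u. \<forall>y\<in>D w. K * rd y (C v) \<le> rd x (C v)) \<or>
                  (\<forall>x\<in>D u. \<forall>y\<in>D w. rd x (C v) < K * rd y (C v)))"
        by (rule slice[OF Q(1) cQ2 K1 k finC pos col])
      then obtain u v D g where uvs: "u \<in> Q" "v \<in> Q" "u \<noteq> v" and s': "(\<forall>w\<in>Q. D w \<subseteq> C w \<and> card (C w) \<le> 2 * card Q * k * 4 ^ card Q * card (D w)) \<and>
    (\<forall>x\<in>D u. 0 < rd x (C v)) \<and>
    (\<forall>x\<in>D u. \<forall>w\<in>Q - {u}. \<forall>y\<in>D w. \<forall>j\<in>Q-{w}. rd y (C j) \<le> rd x (C v)) \<and>
    (\<forall>x\<in>D u. \<forall>j\<in>Q-{u}. rd x (C j) \<le> rd x (C v)) \<and>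
    (\<forall>w\<in>Q-{v}. g w \<in> {1..k} \<and> (\<forall>x\<in>D w. card (nb x (C v)) \<le> k * card {z\<in>C v. c x z = g w})) \<and>
    (\<forall>w\<in>Q-{u,v}. (\<forall>x\<in>D u. \<forall>y\<in>D w. K * rd y (C v) \<le> rd x (C v)) \<or>
                  (\<forall>x\<in>D u. \<forall>y\<in>D w. rd x (C v) < K * rd y (C v)))"
        by (elim exE conjE) (rule that, assumption+, intro conjI, assumption+)
      show ?thesis
      proof (rule that[OF uvs, of D g])
      qed (use s' in \<open>simp_all add: Q(2) P\<close>)
    qed
    have finD: "finite (D w) \<and> D w \<noteq> {}" if w: "w \<in> Q" for w
    proof -
      have "0 < card (C w)" using finC[OF w] by (simp add: card_gt_0_iff)
      then have "0 < P * card (D w)" using D[OF w] by linarith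
      then show ?thesis by (simp add: card_gt_0_iff)
    qed
    obtain x0 where x0: "x0 \<in> D u" using finD[OF uv(1)] by blast
    define W where "W = Q - {u, v}"
    define strict where "strict w \<longleftrightarrow> (\<forall>x\<in>D u. \<forall>y\<in>D w. K * rd y (C v) \<le> rd x (C v))" for w
    \<comment> \<open>The value 0 is free to mark strict blocks, since \<open>g w\<close> is at
      least 1. The two sides are recorded to know which of \<open>u\<close>, \<open>v\<close> will
      be extreme among the blocks used.\<close>
    define cls where "cls w = (u < w, v < w, if strict w then 0 else g w)" for w
    have "\<exists>i\<in>UNIV \<times> UNIV \<times> {0..k}. card W \<le> card ((UNIV::bool set) \<times> (UNIV::bool set) \<times> {0..k}) * card {w\<in>W. cls w = i}"
    proof (rule popular)
      fix w assume "w \<in> W"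
      then have "g w \<in> {1..k}" using g by (auto simp: W_def)
      then show "\<exists>i\<in>UNIV \<times> UNIV \<times> {0..k}. cls w = i" by (auto simp: cls_def)
    qed (use Q in \<open>auto simp: W_def\<close>)
    moreover have "card ((UNIV::bool set) \<times> (UNIV::bool set) \<times> {0..k}) = 4 * Suc k"
      by (simp add: card_cartesian_product)
    ultimately obtain i where cl': "card W \<le> 4 * Suc k * card {w\<in>W. cls w = i}" by metis
    obtain su sv \<kappa>0 where "i = (su, sv, \<kappa>0)" by (cases i)
    with cl' have cl: "card W \<le> 4 * Suc k * card {w\<in>W. cls w = (su, sv, \<kappa>0)}" by simp
    define Z where "Z = {w\<in>W. cls w = (su, sv, \<kappa>0)}"
    have "card W = card Q - 2" using uv Q by (simp add: W_def card_Diff_subset)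
    then have "4 * Suc k * n1 \<le> 4 * Suc k * card Z" using cl Q N by (simp add: Z_def)
    then have cZ: "n1 \<le> card Z" unfolding mult_le_cancel1 by simp
    have ZQ: "Z \<subseteq> Q" "u \<notin> Z" "v \<notin> Z" "finite Z" using Q by (auto simp: Z_def W_def)
    have sideu: "(if su then u < w else w < u)" and sidev: "(if sv then v < w else w < v)" if "w \<in> Z" for w
      using that by (auto simp: Z_def W_def cls_def)
    show "\<exists>l\<in>Lab. \<exists>D. contr (1 / P) Q D C \<and>
      (\<forall>x\<in>D (fst (snd (snd (snd l)))). 0 < rd x (C (fst (snd (snd (snd (snd l)))))) \<and>
         card (nb x (C (fst (snd (snd (snd (snd l))))))) \<le> k * card {z\<in>C (fst (snd (snd (snd (snd l))))). c x z = fst l} \<and>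
         (\<forall>j\<in>snd (snd (snd (snd (snd (snd l))))). rd x (C j) \<le> rd x (C (fst (snd (snd (snd (snd l))))))) \<and>
         (\<forall>w\<in>fst (snd (snd (snd (snd (snd l))))). \<forall>y\<in>D w.
            K * rd y (C (fst (snd (snd (snd (snd l)))))) \<le> rd x (C (fst (snd (snd (snd (snd l)))))) \<and>
            (\<forall>j\<in>snd (snd (snd (snd (snd (snd l))))). rd y (C j) \<le> rd x (C (fst (snd (snd (snd (snd l)))))))))"
    proof (cases "\<kappa>0 = 0")
      case False
      have flat: "\<not> strict w" "g w = \<kappa>0" if "w \<in> Z" for w
        using that False by (auto simp: Z_def cls_def split: if_splits)
      obtain w1 where "w1 \<in> Z" using cZ n1 by fastforce
      then have \<kappa>0: "\<kappa>0 \<in> {1..k}" using flat(2) g(1) ZQ by blast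
      obtain i where i: "i < m" "alw p \<kappa>f Q B (FI sv \<kappa>0 i)" "nev p Q B (FI sv \<kappa>0 (Suc i))" using exF[OF \<kappa>0] by blast
      have "Suc i \<le> card Z" using cZ n1 i by simp
      then obtain Z' where Z': "Z' \<subseteq> Z" "card Z' = Suc i" "finite Z'" using obtain_subset_with_card_n by metis
      have enZ: "en sv Z' a \<in> Z" if "a \<le> i" for a using en_mem[OF Z'(3), of a sv] Z' that by auto
      have "pitem p \<kappa>0 (Suc i) ((en sv Z')(Suc i := v)) B"
      proof (rule add_leaf[where F = "rd x0 (C v)" and K = K and k = k and P = P and L = Lf and Q = Q and C = C and D = D and \<theta> = \<theta> and \<kappa>f = \<kappa>f])
        show "en sv Z' a \<in> Q \<and> en sv Z' a \<noteq> v" if "a \<le> i" for a using enZ[OF that] ZQ by blast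
        show "inj_on (en sv Z') {..i}" using en_inj[OF Z'(3), of sv] Z'(2) lessThan_Suc_atMost by metis
        show "p (Suc i) \<le> i" using p[of "Suc i"] by simp
        show "0 < rd x0 (C v)" by (rule upos[OF x0])
        show "2 * (K * k) * i \<le> Lf" unfolding Lf using K1 i by (intro mult_left_mono) auto
        fix a y assume a: "a \<le> i" and y: "y \<in> D (en sv Z' a)"
        have eQ: "en sv Z' a \<in> Q - {u,v}" "en sv Z' a \<in> Z" using enZ[OF a] ZQ by auto
        have "rd x0 (C v) < K * rd y (C v)"
          using sf[OF eQ(1)] flat(1)[OF eQ(2)] x0 y unfolding strict_def by blast
        then have "rd x0 (C v) / K \<le> rd y (C v)" using K1 by (simp add: field_simps)
        moreover have "rd y (C v) \<le> rd x0 (C v)" using top[OF x0 _ y, of v] eQ uv by auto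
        ultimately show "rd x0 (C v) / K \<le> rd y (C v) \<and> rd y (C v) \<le> rd x0 (C v) \<and>
          card (nb y (C v)) \<le> k * card {z\<in>C v. c y z = \<kappa>0}"
          using g(2)[of "en sv Z' a" y] y eQ flat(2)[OF eQ(2)] by auto
      next
        fix E assume E: "contr \<kappa>f Q E B"
        have "holds p (FI sv \<kappa>0 i) Z' E" using i(2) E Z' ZQ unfolding alw_def by auto
        then show "pitem p \<kappa>0 i (en sv Z') E" by simp
      qed (use Q finB C D uv sparse k Ppos \<kappa>0 Lf1 par K1 in auto)
      \<comment> \<open>As \<open>v\<close> lies beyond \<open>Z'\<close> on the side
        \<open>sv\<close>, it is enumerated last, and the enlarged copy is an instance of the item
        known never to occur.\<close>
      moreover have "en sv (insert v Z') a = ((en sv Z')(Suc i := v)) a" if "a \<le> Suc i" for a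
        using en_insert[OF Z'(3), of sv v a] sidev Z' that by (metis subsetD)
      ultimately have "pitem p \<kappa>0 (Suc i) (en sv (insert v Z')) B"
        by (auto elim!: pitem_mono)
      moreover have "v \<notin> Z'" using Z' ZQ by blast
      then have "card (insert v Z') = isz (FI sv \<kappa>0 (Suc i))" "insert v Z' \<subseteq> Q"
        using Z' ZQ uv by auto
      ultimately show ?thesis using i(3) unfolding nev_def by auto
    next
      case True
      have st: "strict w" if "w \<in> Z" for w
      proof (rule ccontr)
        assume "\<not> strict w"
        then have "g w = 0" using that True by (auto simp: Z_def cls_def split: if_splits)
        then show False using g(1)[of w] that by (auto simp: Z_def W_def)
      qed
      define \<kappa> where "\<kappa> = g u"
      have \<kappa>: "\<kappa> \<in> {1..k}" using g(1) uv by (auto simp: \<kappa>_def)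
      \<comment> \<open>If the sides differ, \<open>Z\<close> lies between \<open>u\<close> and
        \<open>v\<close>, and both are extreme in the union. If they agree, only the outer one is,
        but then both trees are available on that same side, and exchanging \<open>s\<close> and
        \<open>t\<close> moves the root of the join to the outer block.\<close>
      have ext_uv: "su \<noteq> sv \<Longrightarrow> (if su then u < v else v < u) \<and> (if sv then v < u else u < v)"
      proof -
        assume "su \<noteq> sv"
        moreover obtain w where "w \<in> Z" using cZ n1 by fastforce
        ultimately show ?thesis using sideu[of w] sidev[of w] by (auto split: if_splits)
      qed
      have "(\<exists>s t. (if su then u < v else v < u) \<and> Join s t \<in> subs r \<and> alw p \<kappa>f Q B (TI su \<kappa> s) \<and> alw p \<kappa>f Q B (TI sv \<kappa> t) \<and> nev p Q B (TI su \<kappa> (Join s t))) \<or>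
         (\<exists>s t. (if sv then v < u else u < v) \<and> Join t s \<in> subs r \<and> alw p \<kappa>f Q B (TI su \<kappa> s) \<and> alw p \<kappa>f Q B (TI sv \<kappa> t) \<and> nev p Q B (TI sv \<kappa> (Join t s)))"
      proof (cases "su = sv")
        case False
        then show ?thesis using exT[OF \<kappa>, of su sv] ext_uv by blast
      next
        case True
        then obtain s t where st: "Join s t \<in> subs r" "alw p \<kappa>f Q B (TI su \<kappa> s)" "alw p \<kappa>f Q B (TI su \<kappa> t)" "nev p Q B (TI su \<kappa> (Join s t))"
          using exT[OF \<kappa>, of su su] by blast
        have "(if su then u < v else v < u) \<or> (if su then v < u else u < v)" using uv(3) by auto
        then show ?thesis using st True by blast
      qed
      then obtain s t where st_subs: "s \<in> subs r" "t \<in> subs r"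
        and al: "alw p \<kappa>f Q B (TI su \<kappa> s)" "alw p \<kappa>f Q B (TI sv \<kappa> t)"
        and nj: "((if su then u < v else v < u) \<and> nev p Q B (TI su \<kappa> (Join s t))) \<or>
                 ((if sv then v < u else u < v) \<and> nev p Q B (TI sv \<kappa> (Join t s)))"
        using subs_join by blast
      have szs: "sz s \<le> sz r" "sz t \<le> sz r" "1 \<le> sz s" "1 \<le> sz t"
        using sz_subs[OF st_subs(1)] sz_subs[OF st_subs(2)] sz_pos by auto
      \<comment> \<open>The sizes are exact: together with its root block each part has as many
        blocks as its tree has vertices, and the union has as many as the join.\<close>
      have "sz s - 1 \<le> card Z" using szs cZ n1 by simp
      then obtain Z1 where Z1: "Z1 \<subseteq> Z" "card Z1 = sz s - 1" "finite Z1" using obtain_subset_with_card_n by metis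
      have "card (Z - Z1) = card Z - card Z1" using Z1 by (simp add: card_Diff_subset)
      then have "sz t - 1 \<le> card (Z - Z1)" using szs cZ n1 Z1 by simp
      then obtain Z2 where Z2: "Z2 \<subseteq> Z - Z1" "card Z2 = sz t - 1" "finite Z2" using obtain_subset_with_card_n by metis
      have Zs: "Z1 \<subseteq> Q" "Z2 \<subseteq> Q" "Z1 \<inter> Z2 = {}" "u \<notin> Z1" "u \<notin> Z2" "v \<notin> Z1" "v \<notin> Z2"
        using Z1 Z2 ZQ by auto
      have Zsub: "Z1 \<subseteq> Z" "Z2 \<subseteq> Z" using Z1 Z2 by auto
      have card12: "card (Z1 \<union> Z2) = sz s - 1 + (sz t - 1)"
        using Z1 Z2 Zs by (simp add: card_Un_disjoint)
      have a1: "titem \<kappa> s E u Z1" if E: "contr \<kappa>f Q E B" for E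
        by (rule alw_titem[OF al(1) Q(1) uv(1) Zs(1,4) _ _ E]) (use Z1 szs sideu in auto)
      have a2: "titem \<kappa> t E v Z2" if E: "contr \<kappa>f Q E B" for E
        by (rule alw_titem[OF al(2) Q(1) uv(2) Zs(2,7) _ _ E]) (use Z2 szs sidev in auto)
      have "nojoin \<kappa> s t u v Z1 Z2"
        unfolding nojoin_def
      proof
        assume "\<exists>x S y U. rcopy \<kappa> s x S \<and> rcopy \<kappa> t y U \<and>
          x \<in> B u \<and> S - {x} \<subseteq> (\<Union>i\<in>Z1. B i) \<and> y \<in> B v \<and> U - {y} \<subseteq> (\<Union>i\<in>Z2. B i) \<and>
          c x y = \<kappa> \<and> (\<forall>a\<in>S. \<forall>b\<in>U. (a, b) \<noteq> (x, y) \<longrightarrow> c a b = 0)"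
        then obtain x S y U where S: "rcopy \<kappa> s x S" "rcopy \<kappa> t y U"
          "x \<in> B u" "S - {x} \<subseteq> (\<Union>i\<in>Z1. B i)" "y \<in> B v" "U - {y} \<subseteq> (\<Union>i\<in>Z2. B i)"
          "c x y = \<kappa>" and zero: "\<And>a b. a \<in> S \<Longrightarrow> b \<in> U \<Longrightarrow> (a, b) \<noteq> (x, y) \<Longrightarrow> c a b = 0" by blast
        have "S \<inter> U = {}"
        proof (rule ccontr)
          assume "S \<inter> U \<noteq> {}"
          then obtain z where z: "z \<in> S" "z \<in> U" by blast
          obtain i where i: "i \<in> insert u Z1" "z \<in> B i" using z S by blast
          obtain j where j: "j \<in> insert v Z2" "z \<in> B j" using z S by blast
          have "i \<noteq> j" "i \<in> Q" "j \<in> Q" using i j Zs uv by auto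
          then show False using disj i j by blast
        qed
        note j1 = titem_join[OF S this zero]
        have zero': "c a b = 0" if "a \<in> U" "b \<in> S" "(a, b) \<noteq> (y, x)" for a b
          using zero[of b a] that by (subst sym) auto
        have yx: "c y x = \<kappa>" using S(7) by (subst sym)
        have US: "U \<inter> S = {}" using \<open>S \<inter> U = {}\<close> by blast
        have j2: "titem \<kappa> (Join t s) B v (insert u (Z2 \<union> Z1))"
          by (rule titem_join[OF S(2,1,5,6,3,4) yx US zero'])
        have c1: "card (insert v (Z1 \<union> Z2)) = Suc (card (Z1 \<union> Z2))" "card (insert u (Z2 \<union> Z1)) = Suc (card (Z1 \<union> Z2))"
          using Zs Z1 Z2 by (auto simp: Un_commute)
        from nj show False
        proof (elim disjE conjE)
          assume e: "if su then u < v else v < u" and nv: "nev p Q B (TI su \<kappa> (Join s t))"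
          have "\<not> titem \<kappa> (Join s t) B u (insert v (Z1 \<union> Z2))"
            by (rule nev_titem[OF nv Q(1) uv(1)])
              (use Zs uv e sideu Zsub c1 card12 szs in \<open>auto split: if_splits\<close>)
          then show False using j1 by blast
        next
          assume e: "if sv then v < u else u < v" and nv: "nev p Q B (TI sv \<kappa> (Join t s))"
          have "\<not> titem \<kappa> (Join t s) B v (insert u (Z2 \<union> Z1))"
            by (rule nev_titem[OF nv Q(1) uv(2)])
              (use Zs uv e sidev Zsub c1 card12 szs in \<open>auto split: if_splits\<close>)
          then show False using j2 by blast
        qed
      qed
      then have "isl \<kappa> s t u v Z1 Z2"
        unfolding isl_def using \<kappa> st_subs uv Zs a1 a2 by blast
      then have lab: "(\<kappa>, s, t, u, v, Z1, Z2) \<in> Lab" by (simp add: Lab_def)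
      have "contr (1 / P) Q D C"
        unfolding contr_def
      proof (intro ballI conjI)
        fix w assume w: "w \<in> Q"
        show "D w \<subseteq> C w" using D[OF w] by simp
        have "real (card (C w)) \<le> real (P * card (D w))" using D[OF w] by (simp only: of_nat_le_iff)
        then show "1 / P * card (C w) \<le> card (D w)" using Ppos by (simp add: field_simps)
      qed
      moreover have "0 < rd x (C v) \<and> card (nb x (C v)) \<le> k * card {z\<in>C v. c x z = \<kappa>} \<and>
         (\<forall>j\<in>Z2. rd x (C j) \<le> rd x (C v)) \<and>
         (\<forall>w\<in>Z1. \<forall>y\<in>D w. K * rd y (C v) \<le> rd x (C v) \<and> (\<forall>j\<in>Z2. rd y (C j) \<le> rd x (C v)))"
        if x: "x \<in> D u" for x
      proof (intro conjI ballI)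
        show "0 < rd x (C v)" by (rule upos[OF x])
        show "card (nb x (C v)) \<le> k * card {z\<in>C v. c x z = \<kappa>}" unfolding \<kappa>_def using g(2)[of u x] uv x by auto
        show "rd x (C j) \<le> rd x (C v)" if "j \<in> Z2" for j using topu[OF x] that Zs by blast
        fix w y assume w: "w \<in> Z1" and y: "y \<in> D w"
        show "K * rd y (C v) \<le> rd x (C v)" using st[of w] w Z1 x y unfolding strict_def by blast
        show "rd y (C j) \<le> rd x (C v)" if j: "j \<in> Z2" for j
        proof (rule top[OF x _ y])
          show "w \<in> Q - {u}" using w Zs by blast
          show "j \<in> Q - {w}" using w j Zs by blast
        qed
      qed
      ultimately show ?thesis by (intro bexI[OF _ lab] exI[of _ D]) simp
    qed
  qed (use Q disj finB LabL sparse szr k Lpos par K in \<open>auto simp: field_simps\<close>)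
  then obtain l x S y U where "l \<in> Lab" and l: "rcopy (fst l) (fst (snd l)) x S \<and> rcopy (fst l) (fst (snd (snd l))) y U \<and>
    x \<in> B (fst (snd (snd (snd l)))) \<and> S - {x} \<subseteq> (\<Union>i\<in>fst (snd (snd (snd (snd (snd l))))). B i) \<and>
    y \<in> B (fst (snd (snd (snd (snd l))))) \<and> U - {y} \<subseteq> (\<Union>i\<in>snd (snd (snd (snd (snd (snd l))))). B i) \<and>
    c x y = fst l \<and> (\<forall>a\<in>S. \<forall>b\<in>U. (a, b) \<noteq> (x, y) \<longrightarrow> c a b = 0)" by blast
  then obtain \<kappa> s t u v Z1 Z2 where leq: "l = (\<kappa>, s, t, u, v, Z1, Z2)" and "isl \<kappa> s t u v Z1 Z2" by (auto simp: Lab_def)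
  then have "nojoin \<kappa> s t u v Z1 Z2" by (simp add: isl_def)
  then show False using l unfolding leq nojoin_def fst_conv snd_conv by blast
qed

end

text \<open>Constants are chosen against the direction of use. The shrinking
  \<open>\<kappa>f\<close> suits \<open>stable_blocks\<close>; \<open>\<kappa>t\<close> is the total
  loss when all pairs of an index set and an item are stabilised; \<open>\<theta>\<close> and
  \<open>\<delta>\<close> carry a factor \<open>\<kappa>t\<close> so that sparseness and the absence
  of large pairs complete in colour 0 survive stabilisation.\<close>

lemma monochromatic_tree:
  fixes p :: "nat \<Rightarrow> nat" and m k :: nat and r :: rtree
  assumes k: "1 \<le> k" and p: "\<And>b. 1 \<le> b \<Longrightarrow> p b < b"
  shows "\<exists>M::nat. \<exists>\<theta>::real. \<exists>\<delta>::real. 0 < \<theta> \<and> 0 < \<delta> \<and> (\<forall>(c :: 'a \<Rightarrow> 'a \<Rightarrow> nat) B. coloured c \<longrightarrow> (\<forall>x y. c x y \<le> k) \<longrightarrow>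
    (\<forall>i<M. finite (B i) \<and> B i \<noteq> {}) \<longrightarrow> (\<forall>i<M. \<forall>j<M. i \<noteq> j \<longrightarrow> B i \<inter> B j = {}) \<longrightarrow>
    (\<forall>i<M. \<forall>j<M. i \<noteq> j \<longrightarrow> (\<forall>x\<in>B i. card {y\<in>B j. c x y \<noteq> 0} \<le> \<theta> * card (B j))) \<longrightarrow>
    (\<forall>i<M. \<forall>j<M. i \<noteq> j \<longrightarrow> (\<forall>X Y. X \<subseteq> B i \<longrightarrow> Y \<subseteq> B j \<longrightarrow> \<delta> * card (B i) \<le> card X \<longrightarrow>
      \<delta> * card (B j) \<le> card Y \<longrightarrow> (\<exists>x\<in>X. \<exists>y\<in>Y. c x y \<noteq> 0))) \<longrightarrow>
    (\<exists>\<kappa>\<in>{1..k}. (\<exists>x S. coloured.rcopy c \<kappa> r x S \<and> S \<subseteq> (\<Union>i<M. B i)) \<or>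
      (\<exists>\<phi>. inj_on \<phi> {..m} \<and> \<phi> ` {..m} \<subseteq> (\<Union>i<M. B i) \<and>
        (\<forall>a b. a < b \<longrightarrow> b \<le> m \<longrightarrow> c (\<phi> a) (\<phi> b) = (if p b = a then \<kappa> else 0)))))"
proof -
  define I where "I = {TI b \<kappa> t |b \<kappa> t. \<kappa> \<in> {1..k} \<and> t \<in> subs r} \<union> {FI b \<kappa> i |b \<kappa> i. \<kappa> \<in> {1..k} \<and> i \<le> m}"
  have "I \<subseteq> (\<lambda>(b, \<kappa>, t). TI b \<kappa> t) ` (UNIV \<times> {1..k} \<times> subs r) \<union> (\<lambda>(b, \<kappa>, i). FI b \<kappa> i) ` (UNIV \<times> {1..k} \<times> {..m})"
    by (auto simp: I_def image_iff)
  then have finI: "finite I" by (rule finite_subset) (simp add: finite_subs)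
  have iszI: "isz it \<le> sz r + Suc m" if "it \<in> I" for it
    using that sz_subs by (fastforce simp: I_def)
  define n1 where "n1 = 2 * sz r + m + 2"
  define N where "N = 2 + 4 * Suc k * n1"
  define K where "K = 2 * real k * sz r + 1"
  define P where "P = 2 * N * k * 4 ^ N"
  define L where "L = k * card (subs r) * card (subs r) * N * N * 2 ^ N * 2 ^ N"
  define Lf where "Lf = 2 * (K * k) * Suc m"
  obtain M where M: "\<forall>V::nat set. finite V \<longrightarrow> M \<le> card V \<longrightarrow> (\<forall>f. (\<forall>A. A \<subseteq> V \<longrightarrow> f A \<in> Pow I) \<longrightarrow>
      (\<exists>Q\<subseteq>V. card Q = N \<and> homogeneous f (sz r + Suc m) Q))"
    using ramsey_uniform[of "Pow I" N "sz r + Suc m"] finI by (auto simp only: finite_Pow_iff)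
  have szr: "1 \<le> sz r" by (rule sz_pos)
  have P1: "1 \<le> P" using k by (simp add: P_def N_def Suc_le_eq)
  have "0 < card (subs r)" using subs_self[of r] finite_subs[of r] by (metis card_gt_0_iff empty_iff)
  then have L1: "1 \<le> L" using k by (simp add: L_def N_def Suc_le_eq)
  have K1: "1 \<le> K" by (simp add: K_def)
  have Lf1: "1 \<le> Lf"
  proof -
    have "1 * 1 \<le> K * k" using K1 k by (intro mult_mono) auto
    then have "1 * 1 \<le> (2 * (K * k)) * Suc m" by (intro mult_mono) auto
    then show ?thesis by (simp add: Lf_def)
  qed
  define G where "G = real k * sz r * L"
  define R where "R = real P * Lf"
  have G1: "1 \<le> G"
  proof -
    have "1 \<le> k * sz r * L" using k szr L1 by (simp add: Suc_le_eq)
    then have "real 1 \<le> real (k * sz r * L)" by (rule of_nat_mono)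
    then show ?thesis by (simp add: G_def)
  qed
  have R1: "1 \<le> R" using mult_mono[of 1 "real P" 1 Lf] P1 Lf1 by (simp add: R_def)
  \<comment> \<open>One product of quantities that are at least 1 dominates all denominators in the
    bounds required of \<open>\<kappa>f\<close>.\<close>
  define \<kappa>f where "\<kappa>f = 1 / (8 * (G * R))"
  have GR: "G \<le> G * R" "R \<le> G * R" using G1 R1 by (auto simp: mult_le_cancel_left1 mult_le_cancel_right1)
  have GR1: "1 \<le> G * R" using GR(1) G1 by linarith
  have inv: "\<kappa>f \<le> 1 / x" if "0 < x" "x \<le> 8 * (G * R)" for x
    unfolding \<kappa>f_def using that GR1 by (intro divide_left_mono) auto
  have PR: "real P \<le> R" using Lf1 P1 by (simp add: R_def mult_le_cancel_left1)
  have kf: "0 < \<kappa>f" "\<kappa>f \<le> 1/4" "\<kappa>f \<le> 1 / (2 * P)" "\<kappa>f \<le> 1 / (8 * real k * sz r * L)" "\<kappa>f \<le> 1 / (8 * P * Lf)"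
  proof -
    show "0 < \<kappa>f" using G1 R1 by (simp add: \<kappa>f_def)
    show "\<kappa>f \<le> 1/4" using GR1 by (intro inv) linarith+
    have "0 < 2 * real P" "2 * real P \<le> 8 * (G * R)" using GR PR P1 R1 by linarith+
    then show "\<kappa>f \<le> 1 / (2 * P)" using inv[of "2 * real P"] by simp
    have "0 < 8 * G" "8 * G \<le> 8 * (G * R)" using GR G1 by linarith+
    then show "\<kappa>f \<le> 1 / (8 * real k * sz r * L)" using inv[of "8 * G"] by (simp add: G_def mult.assoc)
    have "0 < 8 * R" "8 * R \<le> 8 * (G * R)" using GR R1 by linarith+
    then show "\<kappa>f \<le> 1 / (8 * P * Lf)" using inv[of "8 * R"] by (simp add: R_def mult.assoc)
  qed
  define \<kappa>t where "\<kappa>t = \<kappa>f ^ card (Pow {..<M} \<times> I)"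
  have kt: "0 < \<kappa>t" using kf by (simp add: \<kappa>t_def)
  define \<theta>1 where "\<theta>1 = 1 / (8 * (sz r * R))"
  have th1: "0 < \<theta>1" "8 * sz r * \<theta>1 \<le> 1" "8 * P * Lf * \<theta>1 \<le> 1"
  proof -
    show "0 < \<theta>1" using szr R1 by (simp add: \<theta>1_def)
    have "8 * sz r * \<theta>1 = 1 / R" using szr by (simp add: \<theta>1_def)
    then show "8 * sz r * \<theta>1 \<le> 1" using R1 by simp
    have "8 * P * Lf * \<theta>1 = (8 * R) / (8 * (sz r * R))" by (simp add: \<theta>1_def R_def)
    also have "\<dots> = 1 / sz r" using R1 by simp
    finally show "8 * P * Lf * \<theta>1 \<le> 1" using szr by simp
  qed
  show ?thesis
  proof (rule exI[of _ M], rule exI[of _ "\<theta>1 * \<kappa>t"], rule exI[of _ "\<kappa>t / 4"], intro conjI allI impI)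
    show "0 < \<theta>1 * \<kappa>t" "0 < \<kappa>t / 4" using th1 kt by auto
    fix c :: "'a \<Rightarrow> 'a \<Rightarrow> nat" and B
    assume "coloured c" and col: "\<forall>x y. c x y \<le> k"
      and finB: "\<forall>i<M. finite (B i) \<and> B i \<noteq> {}" and disj: "\<forall>i<M. \<forall>j<M. i \<noteq> j \<longrightarrow> B i \<inter> B j = {}"
      and sparse: "\<forall>i<M. \<forall>j<M. i \<noteq> j \<longrightarrow> (\<forall>x\<in>B i. card {y\<in>B j. c x y \<noteq> 0} \<le> \<theta>1 * \<kappa>t * card (B j))"
      and coh: "\<forall>i<M. \<forall>j<M. i \<noteq> j \<longrightarrow> (\<forall>X Y. X \<subseteq> B i \<longrightarrow> Y \<subseteq> B j \<longrightarrow> \<kappa>t / 4 * card (B i) \<le> card X \<longrightarrow>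
        \<kappa>t / 4 * card (B j) \<le> card Y \<longrightarrow> (\<exists>x\<in>X. \<exists>y\<in>Y. c x y \<noteq> 0))"
    interpret coloured c by fact
    define F where "F = (\<lambda>(A, it) B. card A = isz it \<and> holds p it A B)"
    have "\<exists>B'. contr (\<kappa>f ^ card (Pow {..<M} \<times> I)) {..<M} B' B \<and>
      (\<forall>j\<in>Pow {..<M} \<times> I. \<not> F j B' \<or> (\<forall>C. contr \<kappa>f {..<M} C B' \<longrightarrow> F j C))"
    proof (rule stabilise)
      show "finite (Pow {..<M} \<times> I)" using finI by simp
      show "0 < \<kappa>f" "\<kappa>f \<le> 1" using kf by auto
      fix j B B' assume j: "j \<in> Pow {..<M} \<times> I" and s: "\<forall>i\<in>{..<M}. B' i \<subseteq> B i" and f: "F j B'"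
      obtain A it where j': "j = (A, it)" "A \<subseteq> {..<M}" using j by auto
      then have "finite A" using finite_subset by blast
      then have "holds p it A B" using f j' s by (intro holds_mono[of p it A B' B]) (auto simp: F_def)
      then show "F j B" using f j' by (simp add: F_def)
    qed
    then obtain B1 where B1: "contr \<kappa>t {..<M} B1 B"
      and st: "\<And>A it C. A \<subseteq> {..<M} \<Longrightarrow> it \<in> I \<Longrightarrow> F (A, it) B1 \<Longrightarrow> contr \<kappa>f {..<M} C B1 \<Longrightarrow> F (A, it) C"
      unfolding \<kappa>t_def by blast
    \<comment> \<open>Index sets are coloured by the items they realise after stabilisation; on a
      homogeneous \<open>Q\<close>, realised once means realised on all index sets of that
      size.\<close>
    define f where "f A = {it\<in>I. F (A, it) B1}" for A
    have "\<forall>A. A \<subseteq> {..<M} \<longrightarrow> f A \<in> Pow I" by (auto simp: f_def)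
    with M[THEN spec, of "{..<M}", THEN mp, OF finite_lessThan, THEN mp, of, simplified card_lessThan, OF order_refl]
    obtain Q where Q: "Q \<subseteq> {..<M}" "card Q = N" and hom: "homogeneous f (sz r + Suc m) Q" by blast
    have finQ: "finite Q" using Q finite_subset by blast
    have "1 * n1 \<le> (4 * Suc k) * n1" by (intro mult_le_mono1) simp
    then have cQ: "n1 \<le> card Q" unfolding Q(2) N_def by linarith
    have dich: "alw p \<kappa>f Q B1 it \<or> nev p Q B1 it" if it: "it \<in> I" for it
    proof (cases "nev p Q B1 it")
      case False
      then obtain A where A: "A \<subseteq> Q" "card A = isz it" "holds p it A B1" by (auto simp: nev_def)
      have "alw p \<kappa>f Q B1 it"
        unfolding alw_def
      proof (intro allI impI)
        fix A' C assume A': "A' \<subseteq> Q" "card A' = isz it" and C: "contr \<kappa>f Q C B1"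
        have "f A' = f A" using homogeneousD[OF hom A'(1) A(1)] A' A iszI[OF it] by simp
        then have F1: "F (A', it) B1" using A it by (auto simp: f_def F_def)
        \<comment> \<open>Stabilisation concerned all \<open>M\<close> blocks, so \<open>C\<close>
          is completed by the unchanged blocks outside \<open>Q\<close>.\<close>
        define C' where "C' i = (if i \<in> Q then C i else B1 i)" for i
        have "contr \<kappa>f {..<M} C' B1"
          unfolding contr_def
        proof (intro ballI conjI)
          fix i
          show "C' i \<subseteq> B1 i" using C by (auto simp: C'_def contr_def)
          have "\<kappa>f * card (B1 i) \<le> (1::real) * card (B1 i)" using kf by (intro mult_right_mono) auto
          then show "\<kappa>f * card (B1 i) \<le> card (C' i)" using C by (auto simp: C'_def contr_def)
        qed
        then have "F (A', it) C'" using st F1 A' Q it by blast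
        then have "holds p it A' C'" by (simp add: F_def)
        then show "holds p it A' C"
          using A' finQ by (rule_tac holds_mono) (auto simp: C'_def intro: finite_subset)
      qed
      then show ?thesis ..
    qed simp
    have B1B: "B1 i \<subseteq> B i" "\<kappa>t * card (B i) \<le> card (B1 i)" if "i < M" for i
      using B1 that by (auto simp: contr_def)
    have fB1: "finite (B1 i) \<and> B1 i \<noteq> {}" if i: "i < M" for i
    proof -
      have "0 < card (B i)" using finB i by (simp add: card_gt_0_iff)
      then have "0 < \<kappa>t * card (B i)" using kt by simp
      then have "0 < real (card (B1 i))" using B1B(2)[OF i] by linarith
      then show ?thesis by (simp add: card_gt_0_iff)
    qed
    have cB1: "card (B1 i) \<le> card (B i)" if "i < M" for i
      using B1B(1)[OF that] finB that by (simp add: card_mono)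
    have "\<exists>\<kappa>\<in>{1..k}. \<exists>b. alw p \<kappa>f Q B1 (TI b \<kappa> r) \<or> alw p \<kappa>f Q B1 (FI b \<kappa> m)"
    proof (rule stable_blocks[where \<theta> = \<theta>1, OF finQ Q(2) k p _ _ _ _ _ _ n1_def N_def K_def P_def L_def Lf_def kf th1(2,3)])
      show "c x y \<le> k" for x y using col by blast
      show "alw p \<kappa>f Q B1 it \<or> nev p Q B1 it"
        if "it \<in> {TI b \<kappa> t |b \<kappa> t. \<kappa> \<in> {1..k} \<and> t \<in> subs r} \<union> {FI b \<kappa> i |b \<kappa> i. \<kappa> \<in> {1..k} \<and> i \<le> m}" for it
        by (rule dich, unfold I_def, rule that)
      fix i assume i: "i \<in> Q"
      then have iM: "i < M" using Q by auto
      show "finite (B1 i) \<and> B1 i \<noteq> {}" using fB1 iM by blast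
      fix j assume j: "j \<in> Q" and ij: "i \<noteq> j"
      then have jM: "j < M" using Q by auto
      show "B1 i \<inter> B1 j = {}" using disj iM jM ij B1B(1) by blast
      show "card (nb x (B1 j)) \<le> \<theta>1 * card (B1 j)" if x: "x \<in> B1 i" for x
      proof -
        have "nb x (B1 j) \<subseteq> {y\<in>B j. c x y \<noteq> 0}" using B1B(1)[OF jM] by (auto simp: nb_def)
        then have "card (nb x (B1 j)) \<le> card {y\<in>B j. c x y \<noteq> 0}" using finB jM by (intro card_mono) auto
        then have "real (card (nb x (B1 j))) \<le> card {y\<in>B j. c x y \<noteq> 0}" by (rule of_nat_mono)
        also have "\<dots> \<le> \<theta>1 * \<kappa>t * card (B j)" using sparse iM jM ij x B1B(1)[OF iM] by blast
        also have "\<dots> = \<theta>1 * (\<kappa>t * card (B j))" by simp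
        also have "\<dots> \<le> \<theta>1 * card (B1 j)" using B1B(2)[OF jM] th1 by (intro mult_left_mono) auto
        finally show ?thesis .
      qed
      fix X Y assume XY: "X \<subseteq> B1 i" "Y \<subseteq> B1 j" "card (B1 i) / 4 \<le> card X" "card (B1 j) / 4 \<le> card Y"
      have "\<kappa>t / 4 * card (B i) \<le> card X" "\<kappa>t / 4 * card (B j) \<le> card Y"
        using XY B1B(2)[OF iM] B1B(2)[OF jM] by linarith+
      moreover have "X \<subseteq> B i" "Y \<subseteq> B j" using XY B1B(1) iM jM by auto
      ultimately show "\<exists>x\<in>X. \<exists>y\<in>Y. c x y \<noteq> 0" using coh iM jM ij by blast
    qed
    then obtain \<kappa> b where \<kappa>: "\<kappa> \<in> {1..k}" and al: "alw p \<kappa>f Q B1 (TI b \<kappa> r) \<or> alw p \<kappa>f Q B1 (FI b \<kappa> m)" by blast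
    have res1: "\<exists>x S. rcopy \<kappa> r x S \<and> S \<subseteq> (\<Union>i<M. B i)" if a: "alw p \<kappa>f Q B1 (TI b \<kappa> r)"
    proof -
      have "isz (TI b \<kappa> r) \<le> card Q" using cQ by (simp add: n1_def)
      then obtain A where A: "A \<subseteq> Q" "card A = sz r" "titem \<kappa> r B1 (ext b A) (A - {ext b A})"
        using alw_holds[OF a _ _ finQ] kf by auto
      have "A \<noteq> {}" using A szr by auto
      then have "ext b A \<in> A" using ext_mem[OF finite_subset[OF A(1) finQ]] by simp
      then have eA: "ext b A < M" "A \<subseteq> {..<M}" using A Q by auto
      obtain x S where S: "rcopy \<kappa> r x S" "x \<in> B1 (ext b A)" "S - {x} \<subseteq> (\<Union>i\<in>A - {ext b A}. B1 i)"
        using A(3) by (auto simp: titem_def)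
      define U where "U = (\<Union>i<M. B i)"
      have "(\<Union>i\<in>A - {ext b A}. B1 i) \<subseteq> U" unfolding U_def using eA(2) B1B(1) by (intro UN_mono) auto
      then have "S - {x} \<subseteq> U" using S(3) by simp
      moreover have "x \<in> U" unfolding U_def using S(2) eA(1) B1B(1) by auto
      ultimately have "S \<subseteq> U" by blast
      then show ?thesis using S(1) unfolding U_def by (intro exI conjI)
    qed
    have res2: "\<exists>\<phi>. inj_on \<phi> {..m} \<and> \<phi> ` {..m} \<subseteq> (\<Union>i<M. B i) \<and>
        (\<forall>a b. a < b \<longrightarrow> b \<le> m \<longrightarrow> c (\<phi> a) (\<phi> b) = (if p b = a then \<kappa> else 0))"
      if a: "alw p \<kappa>f Q B1 (FI b \<kappa> m)"
    proof -
      have "isz (FI b \<kappa> m) \<le> card Q" using cQ by (simp add: n1_def)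
      then obtain A where A: "A \<subseteq> Q" "card A = Suc m" "pitem p \<kappa> m (en b A) B1"
        using alw_holds[OF a _ _ finQ] kf by auto
      obtain \<phi> where \<phi>0: "\<forall>a\<le>m. \<phi> a \<in> B1 (en b A a)"
        and \<phi>1: "\<forall>a b. a < b \<longrightarrow> b \<le> m \<longrightarrow> c (\<phi> a) (\<phi> b) = (if p b = a then \<kappa> else 0)"
        using A(3) unfolding pitem_def by (elim exE conjE)
      note \<phi> = \<phi>0[rule_format] \<phi>1
      have fA: "finite A" by (rule finite_subset[OF A(1) finQ])
      have eM: "en b A a < M" if "a \<le> m" for a using en_mem[OF fA, of a b] that A Q by auto
      have "inj_on \<phi> {..m}"
      proof (rule inj_onI)
        fix a a' assume aa: "a \<in> {..m}" "a' \<in> {..m}" "\<phi> a = \<phi> a'"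
        then have "\<phi> a \<in> B (en b A a) \<inter> B (en b A a')" using \<phi>(1)[of a] \<phi>(1)[of a'] B1B(1) eM by auto
        moreover have "en b A a < M" "en b A a' < M" using eM aa by auto
        ultimately have "en b A a = en b A a'" using disj[rule_format, of "en b A a" "en b A a'"] by fastforce
        then show "a = a'" using en_inj[OF fA, of b] aa A(2) by (auto simp: inj_on_def)
      qed
      moreover have "\<phi> ` {..m} \<subseteq> (\<Union>i<M. B i)"
      proof
        fix y assume "y \<in> \<phi> ` {..m}"
        then obtain a where a: "a \<le> m" "y = \<phi> a" by auto
        then show "y \<in> (\<Union>i<M. B i)" using \<phi>(1)[OF a(1)] B1B(1)[OF eM[OF a(1)]] eM[OF a(1)] by auto
      qed
      ultimately show ?thesis using \<phi>(2) by (intro exI conjI)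
    qed
    show "\<exists>\<kappa>\<in>{1..k}. (\<exists>x S. rcopy \<kappa> r x S \<and> S \<subseteq> (\<Union>i<M. B i)) \<or>
      (\<exists>\<phi>. inj_on \<phi> {..m} \<and> \<phi> ` {..m} \<subseteq> (\<Union>i<M. B i) \<and>
        (\<forall>a b. a < b \<longrightarrow> b \<le> m \<longrightarrow> c (\<phi> a) (\<phi> b) = (if p b = a then \<kappa> else 0)))"
      by (rule bexI[OF _ \<kappa>], rule disj_forward[OF al]) (erule res1, erule res2)
  qed
qed

subsection \<open>Making all colours but one sparse\<close>

text \<open>Greedy embedding, last block first. If some vertex of block \<open>h\<close> has a
  \<open>\<theta>\<close> share of the right colour in every earlier block, it is chosen and those
  blocks shrink to its neighbourhoods. If not, each vertex of block \<open>h\<close> is deficient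
  towards some earlier block, and a popular one gives the sparse pair.\<close>

lemma embed_or_sparse:
  fixes h :: nat and \<theta> :: real
  assumes \<theta>: "0 < \<theta>" "\<theta> \<le> 1"
  shows "\<exists>\<kappa>::real. 0 < \<kappa> \<and> \<kappa> \<le> 1 \<and> (\<forall>(c :: 'a \<Rightarrow> 'a \<Rightarrow> nat) B pc. (\<forall>a<h. finite (B a) \<and> B a \<noteq> {}) \<longrightarrow>
    (\<exists>\<phi>. (\<forall>a<h. \<phi> a \<in> B a) \<and> (\<forall>a b. a < b \<longrightarrow> b < h \<longrightarrow> c (\<phi> b) (\<phi> a) = pc a b)) \<or>
    (\<exists>a b X Y. a < b \<and> b < h \<and> X \<subseteq> B b \<and> Y \<subseteq> B a \<and> \<kappa> * card (B b) \<le> card X \<and> \<kappa> * card (B a) \<le> card Y \<and>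
      (\<forall>x\<in>X. card {y\<in>Y. c x y = pc a b} \<le> \<theta> * card Y)))"
proof (induction h)
  case 0
  show ?case by (intro exI[of _ 1]) auto
next
  case (Suc h)
  then obtain \<kappa> :: real where \<kappa>: "0 < \<kappa>" "\<kappa> \<le> 1" and IH: "\<And>(c :: 'a \<Rightarrow> 'a \<Rightarrow> nat) B pc. (\<forall>a<h. finite (B a) \<and> B a \<noteq> {}) \<Longrightarrow>
    (\<exists>\<phi>. (\<forall>a<h. \<phi> a \<in> B a) \<and> (\<forall>a b. a < b \<longrightarrow> b < h \<longrightarrow> c (\<phi> b) (\<phi> a) = pc a b)) \<or>
    (\<exists>a b X Y. a < b \<and> b < h \<and> X \<subseteq> B b \<and> Y \<subseteq> B a \<and> \<kappa> * card (B b) \<le> card X \<and> \<kappa> * card (B a) \<le> card Y \<and>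
      (\<forall>x\<in>X. card {y\<in>Y. c x y = pc a b} \<le> \<theta> * card Y))" 
    by (elim exE conjE) (rule that, assumption, assumption, erule allE, erule allE, erule allE, erule (1) mp)
  \<comment> \<open>The factor \<open>\<theta>\<close> pays for restricting to neighbourhoods,
    \<open>1 / Suc h\<close> for choosing the popular block.\<close>
  define \<kappa>' where "\<kappa>' = \<kappa> * \<theta> / Suc h"
  have k': "0 < \<kappa>'" "\<kappa>' \<le> \<kappa> * \<theta>" "\<kappa>' \<le> 1 / Suc h" "\<kappa>' \<le> 1"
  proof -
    have 1: "\<kappa> * \<theta> \<le> 1" using mult_mono[of \<kappa> 1 \<theta> 1] \<kappa> \<theta> by simp
    show "0 < \<kappa>'" using \<kappa> \<theta> by (simp add: \<kappa>'_def)
    show "\<kappa>' \<le> \<kappa> * \<theta>" using \<kappa> \<theta> by (simp add: \<kappa>'_def divide_le_eq mult_le_cancel_left1 mult_less_0_iff)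
    then show "\<kappa>' \<le> 1" using 1 by linarith
    show "\<kappa>' \<le> 1 / Suc h" unfolding \<kappa>'_def using 1 by (intro divide_right_mono) auto
  qed
  show ?case
  proof (rule exI[of _ \<kappa>'], intro conjI allI impI k'(1,4))
    fix c :: "'a \<Rightarrow> 'a \<Rightarrow> nat" and B :: "nat \<Rightarrow> 'a set" and pc assume fin: "\<forall>a<Suc h. finite (B a) \<and> B a \<noteq> {}"
    let ?concl = "(\<exists>\<phi>. (\<forall>a<Suc h. \<phi> a \<in> B a) \<and> (\<forall>a b. a < b \<longrightarrow> b < Suc h \<longrightarrow> c (\<phi> b) (\<phi> a) = pc a b)) \<or>
      (\<exists>a b X Y. a < b \<and> b < Suc h \<and> X \<subseteq> B b \<and> Y \<subseteq> B a \<and> \<kappa>' * card (B b) \<le> card X \<and> \<kappa>' * card (B a) \<le> card Y \<and>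
      (\<forall>x\<in>X. card {y\<in>Y. c x y = pc a b} \<le> \<theta> * card Y))"
    show ?concl
    proof (cases "\<exists>x\<in>B h. \<forall>a<h. \<theta> * card (B a) \<le> card {y\<in>B a. c x y = pc a h}")
      case True
      then obtain x where x: "x \<in> B h" "\<And>a. a < h \<Longrightarrow> \<theta> * card (B a) \<le> card {y\<in>B a. c x y = pc a h}"
        by (elim bexE) (rule that, assumption, erule allE, erule (1) mp)
      define B' where "B' a = {y\<in>B a. c x y = pc a h}" for a
      have B': "B' a \<subseteq> B a" for a by (auto simp: B'_def)
      have fin': "\<forall>a<h. finite (B' a) \<and> B' a \<noteq> {}"
      proof (intro allI impI)
        fix a assume a: "a < h"
        then have "0 < card (B a)" using fin by (simp add: card_gt_0_iff)
        then have "0 < \<theta> * card (B a)" using \<theta> by simp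
        then have "0 < real (card (B' a))" using x(2)[OF a] unfolding B'_def by linarith
        then show "finite (B' a) \<and> B' a \<noteq> {}" by (simp add: card_gt_0_iff)
      qed
      have le: "\<kappa>' * card (B a) \<le> \<kappa> * card (B' a)" if "a < h" for a
      proof -
        have "\<kappa>' * card (B a) \<le> (\<kappa> * \<theta>) * card (B a)" using k' by (intro mult_right_mono) auto
        also have "\<dots> = \<kappa> * (\<theta> * card (B a))" by simp
        also have "\<dots> \<le> \<kappa> * card (B' a)" using x(2)[OF that] \<kappa> unfolding B'_def by (intro mult_left_mono) auto
        finally show ?thesis .
      qed
      from IH[OF fin', of c pc] show ?concl
      proof (elim disjE exE conjE)
        fix \<phi> assume \<phi>: "\<forall>a<h. \<phi> a \<in> B' a" "\<forall>a b. a < b \<longrightarrow> b < h \<longrightarrow> c (\<phi> b) (\<phi> a) = pc a b"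
        have "(\<forall>a<Suc h. (\<phi>(h := x)) a \<in> B a) \<and>
          (\<forall>a b. a < b \<longrightarrow> b < Suc h \<longrightarrow> c ((\<phi>(h := x)) b) ((\<phi>(h := x)) a) = pc a b)"
          using \<phi> x(1) by (auto simp: less_Suc_eq B'_def)
        then show ?concl by (intro disjI1 exI)
      next
        fix a b X Y assume ab: "a < b" "b < h" "X \<subseteq> B' b" "Y \<subseteq> B' a" "\<kappa> * card (B' b) \<le> card X"
          "\<kappa> * card (B' a) \<le> card Y" "\<forall>x\<in>X. card {y\<in>Y. c x y = pc a b} \<le> \<theta> * card Y"
        have "\<kappa>' * card (B b) \<le> card X" "\<kappa>' * card (B a) \<le> card Y" using le[of a] le[of b] ab by linarith+
        moreover have "X \<subseteq> B b" "Y \<subseteq> B a" using ab(3,4) B' by (meson subset_trans)+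
        ultimately show ?concl using ab
          by (intro disjI2, rule_tac exI[of _ a], rule_tac exI[of _ b], rule_tac exI[of _ X], rule_tac exI[of _ Y]) simp
      qed
    next
      case False
      then have ex: "\<And>x. x \<in> B h \<Longrightarrow> \<exists>a\<in>{..<h}. card {y\<in>B a. c x y = pc a h} \<le> \<theta> * card (B a)"
        by (meson lessThan_iff linear)
      have fh: "finite (B h)" "B h \<noteq> {}" using fin by auto
      have h0: "{..<h} \<noteq> {}" using ex fh(2) by fastforce
      obtain a where a: "a < h" "card (B h) \<le> h * card {x\<in>B h. card {y\<in>B a. c x y = pc a h} \<le> \<theta> * card (B a)}"
        using popular[of "B h" "{..<h}" "\<lambda>a x. card {y\<in>B a. c x y = pc a h} \<le> \<theta> * card (B a)"] ex h0 fh(1) by auto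
      define X where "X = {x\<in>B h. card {y\<in>B a. c x y = pc a h} \<le> \<theta> * card (B a)}"
      have "real (card (B h)) \<le> real (h * card X)" using a(2) unfolding X_def by (rule of_nat_mono)
      also have "\<dots> \<le> Suc h * real (card X)" by (simp add: mult_right_mono)
      finally have "1 / Suc h * card (B h) \<le> card X" by (simp add: field_simps)
      moreover have "\<kappa>' * card (B h) \<le> 1 / Suc h * card (B h)" using k' by (intro mult_right_mono) auto
      ultimately have "\<kappa>' * card (B h) \<le> card X" by linarith
      moreover have "\<kappa>' * card (B a) \<le> (1::real) * card (B a)" using k' by (intro mult_right_mono) auto
      ultimately have "a < h \<and> h < Suc h \<and> X \<subseteq> B h \<and> B a \<subseteq> B a \<and> \<kappa>' * card (B h) \<le> card X \<and> \<kappa>' * card (B a) \<le> card (B a) \<and>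
        (\<forall>x\<in>X. card {y\<in>B a. c x y = pc a h} \<le> \<theta> * card (B a))" using a(1) by (auto simp: X_def)
      then show ?concl by (intro disjI2 exI)
    qed
  qed
qed

section \<open>Two-sided sparse pairs and the elimination of colours\<close>

definition sparse_pair :: "('a \<Rightarrow> 'a \<Rightarrow> nat) \<Rightarrow> real \<Rightarrow> nat \<Rightarrow> 'a set \<Rightarrow> 'a set \<Rightarrow> bool" where
  "sparse_pair c \<theta> \<gamma> A B \<longleftrightarrow> (\<forall>x\<in>A. real (card {y\<in>B. c x y = \<gamma>}) \<le> \<theta> * real (card B)) \<and>
    (\<forall>y\<in>B. real (card {x\<in>A. c y x = \<gamma>}) \<le> \<theta> * real (card A))"

lemma sparse_pair_shrink:
  fixes \<theta> \<theta>' \<kappa> :: real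
  assumes sp: "sparse_pair c \<theta> \<gamma> A B" and fin: "finite A" "finite B" and sub: "A' \<subseteq> A" "B' \<subseteq> B"
    and \<kappa>: "0 < \<kappa>" "\<kappa> * card A \<le> card A'" "\<kappa> * card B \<le> card B'" and \<theta>: "0 \<le> \<theta>" "\<theta> \<le> \<theta>' * \<kappa>"
  shows "sparse_pair c \<theta>' \<gamma> A' B'"
proof -
  have *: "card {y\<in>Y'. P y} \<le> \<theta>' * card Y'"
    if "card {y\<in>Y. P y} \<le> \<theta> * card Y" "finite Y" "Y' \<subseteq> Y" "\<kappa> * card Y \<le> card Y'" for Y Y' :: "'a set" and P
  proof -
    have t': "0 \<le> \<theta>'" using \<theta> \<kappa>(1) by (smt (verit) mult_neg_pos)
    have "card {y\<in>Y'. P y} \<le> card {y\<in>Y. P y}" using that by (intro card_mono) auto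
    then have "real (card {y\<in>Y'. P y}) \<le> \<theta> * card Y" using that by linarith
    also have "\<dots> \<le> (\<theta>' * \<kappa>) * card Y" using \<theta> by (intro mult_right_mono) auto
    also have "\<dots> = \<theta>' * (\<kappa> * card Y)" by simp
    also have "\<dots> \<le> \<theta>' * card Y'" using that t' by (intro mult_left_mono) auto
    finally show ?thesis .
  qed
  show ?thesis
    unfolding sparse_pair_def
  proof (intro conjI ballI)
    fix x assume "x \<in> A'"
    then have "card {y\<in>B. c x y = \<gamma>} \<le> \<theta> * card B" using sp[unfolded sparse_pair_def, THEN conjunct1, THEN bspec] sub(1) by (meson subsetD)
    then show "card {y\<in>B'. c x y = \<gamma>} \<le> \<theta>' * card B'" using fin sub \<kappa> by (intro *)
  next
    fix x assume "x \<in> B'"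
    then have "card {y\<in>A. c x y = \<gamma>} \<le> \<theta> * card A" using sp[unfolded sparse_pair_def, THEN conjunct2, THEN bspec] sub(2) by (meson subsetD)
    then show "card {y\<in>A'. c x y = \<gamma>} \<le> \<theta>' * card A'" using fin sub \<kappa> by (intro *)
  qed
qed

text \<open>By double counting, the vertices of \<open>Y\<close> that see more than a
  \<open>2 * \<theta>\<close> share of \<open>X\<close> make up at most half of \<open>Y\<close>.
  Deleting them costs a factor 2 in size and, towards what is left of \<open>Y\<close>, a factor 2
  in density.\<close>

lemma two_sided:
  fixes \<theta> :: real
  assumes fin: "finite X" "finite Y" and s: "\<And>x y. c x y = c y x"
    and one: "\<And>x. x \<in> X \<Longrightarrow> card {y\<in>Y. c x y = \<gamma>} \<le> \<theta> * card Y" and \<theta>: "0 \<le> \<theta>"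
  shows "\<exists>Y'\<subseteq>Y. card Y \<le> 2 * card Y' \<and> sparse_pair c (2 * \<theta>) \<gamma> Y' X"
proof -
  define Y' where "Y' = {y\<in>Y. card {x\<in>X. c y x = \<gamma>} \<le> 2 * \<theta> * card X}"
  have Y'Y: "Y' \<subseteq> Y" by (auto simp: Y'_def)
  have fY: "finite Y'" using Y'Y fin finite_subset by blast
  have half: "card Y \<le> 2 * card Y'"
  proof (rule ccontr)
    assume n: "\<not> ?thesis"
    have cYd: "card (Y - Y') = card Y - card Y'" using Y'Y fY by (simp add: card_Diff_subset)
    then have big: "card Y < 2 * card (Y - Y')" using n by linarith
    have "(\<Sum>y\<in>Y - Y'. 2 * \<theta> * card X) < (\<Sum>y\<in>Y - Y'. real (card {x\<in>X. c y x = \<gamma>}))"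
    proof (rule sum_strict_mono)
      show "Y - Y' \<noteq> {}" using big by (metis card.empty mult_0_right not_less_zero)
    qed (use fin in \<open>auto simp: Y'_def\<close>)
    also have "\<dots> \<le> (\<Sum>y\<in>Y. real (card {x\<in>X. c y x = \<gamma>}))" using fin by (intro sum_mono2) auto
    also have "\<dots> = real (\<Sum>y\<in>Y. card {x\<in>X. c y x = \<gamma>})" by simp
    also have "(\<Sum>y\<in>Y. card {x\<in>X. c y x = \<gamma>}) = (\<Sum>x\<in>X. card {y\<in>Y. c y x = \<gamma>})"
      by (rule sum_card_swap[OF fin(2,1)])
    also have "real \<dots> = (\<Sum>x\<in>X. real (card {y\<in>Y. c x y = \<gamma>}))" by (simp add: s)
    also have "\<dots> \<le> card X * (\<theta> * card Y)" using one by (intro sum_bounded_above) auto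
    finally have "card (Y - Y') * (2 * \<theta> * card X) < card X * (\<theta> * card Y)" by simp
    moreover have "\<theta> * card X * card Y \<le> \<theta> * card X * (2 * card (Y - Y'))"
      using big \<theta> by (intro mult_left_mono) auto
    ultimately show False by (simp add: algebra_simps)
  qed
  have "sparse_pair c (2 * \<theta>) \<gamma> Y' X"
    unfolding sparse_pair_def
  proof (intro conjI ballI)
    fix y assume "y \<in> Y'" then show "card {x\<in>X. c y x = \<gamma>} \<le> 2 * \<theta> * card X" by (simp add: Y'_def)
  next
    fix x assume x: "x \<in> X"
    have "card {y\<in>Y'. c x y = \<gamma>} \<le> card {y\<in>Y. c x y = \<gamma>}" using fin Y'Y by (intro card_mono) auto
    then have "real (card {y\<in>Y'. c x y = \<gamma>}) \<le> \<theta> * card Y" using one[OF x] by linarith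
    also have "\<dots> \<le> \<theta> * (2 * card Y')" using half \<theta> by (intro mult_left_mono) (auto simp flip: of_nat_mult)
    finally show "card {y\<in>Y'. c x y = \<gamma>} \<le> 2 * \<theta> * card Y'" by simp
  qed
  then show ?thesis using Y'Y half by blast
qed

lemma sparse_pair_mono: "sparse_pair c \<theta> \<gamma> A B \<Longrightarrow> \<theta> \<le> \<theta>' \<Longrightarrow> sparse_pair c \<theta>' \<gamma> A B"
  unfolding sparse_pair_def by (meson mult_right_mono of_nat_0_le_iff order_trans)

lemma sparse_pair_sym: "sparse_pair c \<theta> \<gamma> A B \<longleftrightarrow> sparse_pair c \<theta> \<gamma> B A"
  by (auto simp: sparse_pair_def)

text \<open>A triple stands for one colour between two blocks; the sets \<open>D\<close> below
  record which of these have already been made sparse.\<close>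

definition triples :: "nat \<Rightarrow> nat \<Rightarrow> (nat \<times> nat \<times> nat) set" where
  "triples M k = {(a, b, \<gamma>). a < b \<and> b < M \<and> \<gamma> \<in> {1..k}}"

lemma finite_triples: "finite (triples M k)"
  by (rule finite_subset[of _ "{..<M} \<times> {..<M} \<times> {1..k}"]) (auto simp: triples_def)

definition pair_copy :: "nat \<Rightarrow> nat \<Rightarrow> (nat \<Rightarrow> nat \<Rightarrow> bool) \<Rightarrow> ('a \<Rightarrow> 'a \<Rightarrow> nat) \<Rightarrow> 'a set \<Rightarrow> bool" where
  "pair_copy k h E c V \<longleftrightarrow> (\<exists>i\<in>{1..k}. \<exists>j\<in>{1..k}. i \<noteq> j \<and> (\<exists>\<phi>. inj_on \<phi> {..<h} \<and> \<phi> ` {..<h} \<subseteq> V \<and>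
     (\<forall>a b. a < b \<longrightarrow> b < h \<longrightarrow> c (\<phi> a) (\<phi> b) = (if E a b then i else j))))"

lemma pair_copy_mono: "pair_copy k h E c V \<Longrightarrow> V \<subseteq> W \<Longrightarrow> pair_copy k h E c W"
  unfolding pair_copy_def by (elim bexE conjE exE, intro bexI conjI exI) (assumption | erule (1) subset_trans)+

definition sparse_triples :: "('a \<Rightarrow> 'a \<Rightarrow> nat) \<Rightarrow> real \<Rightarrow> (nat \<Rightarrow> 'a set) \<Rightarrow> (nat \<times> nat \<times> nat) set \<Rightarrow> bool" where
  "sparse_triples c \<theta> B D \<longleftrightarrow> (\<forall>(a, b, \<gamma>)\<in>D. sparse_pair c \<theta> \<gamma> (B a) (B b))"

lemma sparse_triples_mono: "sparse_triples c \<theta> B D \<Longrightarrow> \<theta> \<le> \<theta>' \<Longrightarrow> sparse_triples c \<theta>' B D"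
  unfolding sparse_triples_def using sparse_pair_mono by fast

definition dense_pair :: "nat \<Rightarrow> (nat \<times> nat \<times> nat) set \<Rightarrow> nat set \<Rightarrow> nat \<Rightarrow> nat \<Rightarrow> bool" where
  "dense_pair k D S i j \<longleftrightarrow> i \<in> {1..k} \<and> j \<in> {1..k} \<and> i \<noteq> j \<and>
     (\<forall>a\<in>S. \<forall>b\<in>S. a < b \<longrightarrow> (a, b, i) \<notin> D \<and> (a, b, j) \<notin> D)"

definition blocks :: "nat \<Rightarrow> (nat \<Rightarrow> 'a set) \<Rightarrow> bool" where
  "blocks M B \<longleftrightarrow> (\<forall>i<M. finite (B i) \<and> B i \<noteq> {}) \<and> (\<forall>i<M. \<forall>j<M. i \<noteq> j \<longrightarrow> B i \<inter> B j = {})"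

lemma blocks_contr:
  assumes "blocks M B" "contr \<kappa> {..<M} B' B" "0 < \<kappa>"
  shows "blocks M B'"
proof -
  have "finite (B' i) \<and> B' i \<noteq> {}" if i: "i < M" for i
  proof -
    have "0 < card (B i)" using assms(1) i by (auto simp: blocks_def card_gt_0_iff)
    then have "0 < \<kappa> * card (B i)" using assms(3) by simp
    also have "\<dots> \<le> card (B' i)" using assms(2) i by (auto simp: contr_def)
    finally show ?thesis by (simp add: card_gt_0_iff)
  qed
  moreover have "B' i \<inter> B' j = {}" if "i < M" "j < M" "i \<noteq> j" for i j
  proof -
    have "B i \<inter> B j = {}" using assms(1) that by (auto simp: blocks_def)
    moreover have "B' i \<subseteq> B i" "B' j \<subseteq> B j" using assms(2) that by (auto simp: contr_def)
    ultimately show ?thesis by blast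
  qed
  ultimately show ?thesis by (simp add: blocks_def)
qed

text \<open>In the blocks of \<open>S\<close> an embedding is attempted with \<open>i\<close> on
  edges and \<open>j\<close> on nonedges. Its failure makes one of the two colours sparse between
  two blocks, and \<open>dense_pair\<close> ensures that this triple is new. Restriction divides the
  old densities by at most \<open>\<kappa>\<close>, hence \<open>\<theta> * \<kappa>\<close>
  beforehand; making the new pair two-sided explains \<open>\<theta> / 2\<close> and
  \<open>\<kappa>1 / 2\<close>.\<close>

lemma kill_triple:
  fixes \<theta> :: real
  assumes \<theta>: "0 < \<theta>" "\<theta> \<le> 1"
  shows "\<exists>\<kappa>::real. 0 < \<kappa> \<and> \<kappa> \<le> 1 \<and> (\<forall>(c :: 'a \<Rightarrow> 'a \<Rightarrow> nat) B D S i j. (\<forall>x y. c x y = c y x) \<longrightarrow> blocks M B \<longrightarrow>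
    D \<subseteq> triples M k \<longrightarrow> sparse_triples c (\<theta> * \<kappa>) B D \<longrightarrow> S \<subseteq> {..<M} \<longrightarrow> card S = h \<longrightarrow> dense_pair k D S i j \<longrightarrow>
    pair_copy k h E c (\<Union>i<M. B i) \<or>
    (\<exists>B' t. t \<in> triples M k - D \<and> contr \<kappa> {..<M} B' B \<and> sparse_triples c \<theta> B' (insert t D)))"
proof -
  have "0 < \<theta> / 2" "\<theta> / 2 \<le> 1" using \<theta> by auto
  from embed_or_sparse[OF this, where 'a = 'a and h = h]
  obtain \<kappa>1 :: real where k1: "0 < \<kappa>1" "\<kappa>1 \<le> 1" and emb: "\<And>(c :: 'a \<Rightarrow> 'a \<Rightarrow> nat) B pc. (\<forall>a<h. finite (B a) \<and> B a \<noteq> {}) \<Longrightarrow>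
    (\<exists>\<phi>. (\<forall>a<h. \<phi> a \<in> B a) \<and> (\<forall>a b. a < b \<longrightarrow> b < h \<longrightarrow> c (\<phi> b) (\<phi> a) = pc a b)) \<or>
    (\<exists>a b X Y. a < b \<and> b < h \<and> X \<subseteq> B b \<and> Y \<subseteq> B a \<and> \<kappa>1 * card (B b) \<le> card X \<and> \<kappa>1 * card (B a) \<le> card Y \<and>
      (\<forall>x\<in>X. card {y\<in>Y. c x y = pc a b} \<le> \<theta> / 2 * card Y))"
    by (elim exE conjE) (rule that, assumption, assumption, erule allE, erule allE, erule allE, erule (1) mp)
  define \<kappa> where "\<kappa> = \<kappa>1 / 2"
  show ?thesis
  proof (rule exI[of _ \<kappa>], intro conjI allI impI)
    show k0: "0 < \<kappa>" "\<kappa> \<le> 1" using k1 by (auto simp: \<kappa>_def)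
    fix c :: "'a \<Rightarrow> 'a \<Rightarrow> nat" and B D S i j
    assume c: "\<forall>x y. c x y = c y x" and B: "blocks M B" and D: "D \<subseteq> triples M k" and sp: "sparse_triples c (\<theta> * \<kappa>) B D"
      and S: "S \<subseteq> {..<M}" "card S = h" and d: "dense_pair k D S i j"
    let ?concl = "pair_copy k h E c (\<Union>i<M. B i) \<or>
      (\<exists>B' t. t \<in> triples M k - D \<and> contr \<kappa> {..<M} B' B \<and> sparse_triples c \<theta> B' (insert t D))"
    have finS: "finite S" using finite_subset[OF S(1)] by simp
    obtain e where e: "bij_betw e {..<h} S" "strict_mono_on {..<h} e"
      using ex_bij_betw_strict_mono_card[OF finS] S(2) by (metis lessThan_atLeast0)
    have eM: "e a < M" if "a < h" for a using e(1) S(1) that by (auto simp: bij_betw_def)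
    have eS: "e a \<in> S" if "a < h" for a using e(1) that by (auto simp: bij_betw_def)
    have elt: "e a < e b" if "a < b" "b < h" for a b using e(2) that by (auto simp: strict_mono_on_def)
    define pc where "pc a b = (if E a b then i else j)" for a b
    have ijk: "i \<in> {1..k}" "j \<in> {1..k}" "i \<noteq> j" and nD: "\<And>a b. a \<in> S \<Longrightarrow> b \<in> S \<Longrightarrow> a < b \<Longrightarrow> (a, b, i) \<notin> D \<and> (a, b, j) \<notin> D"
      using d by (auto simp: dense_pair_def)
    have fB: "finite (B a)" "B a \<noteq> {}" if "a < M" for a using B that by (auto simp: blocks_def)
    have "\<forall>a<h. finite (B (e a)) \<and> B (e a) \<noteq> {}" using fB eM by blast
    from emb[OF this, of c pc] show ?concl
    proof (elim disjE exE conjE)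
      fix \<phi> assume \<phi>: "\<forall>a<h. \<phi> a \<in> B (e a)" "\<forall>a b. a < b \<longrightarrow> b < h \<longrightarrow> c (\<phi> b) (\<phi> a) = pc a b"
      have "inj_on \<phi> {..<h}"
      proof (rule inj_onI)
        fix a b assume ab: "a \<in> {..<h}" "b \<in> {..<h}" "\<phi> a = \<phi> b"
        then have "B (e a) \<inter> B (e b) \<noteq> {}" using \<phi>(1) by (metis disjoint_iff lessThan_iff)
        then have "e a = e b" using B eM[of a] eM[of b] ab unfolding blocks_def by (metis lessThan_iff)
        then show "a = b" using e(1) ab by (auto simp: bij_betw_def inj_on_def)
      qed
      moreover have "\<phi> ` {..<h} \<subseteq> (\<Union>i<M. B i)" using \<phi>(1) eM by blast
      moreover have "\<forall>a b. a < b \<longrightarrow> b < h \<longrightarrow> c (\<phi> a) (\<phi> b) = (if E a b then i else j)"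
      proof (intro allI impI)
        fix a b assume "a < b" "b < h"
        then have "c (\<phi> b) (\<phi> a) = pc a b" using \<phi>(2) by simp
        then show "c (\<phi> a) (\<phi> b) = (if E a b then i else j)" using c by (metis pc_def)
      qed
      ultimately have "pair_copy k h E c (\<Union>i<M. B i)" unfolding pair_copy_def using ijk by blast
      then show ?concl ..
    next
      fix a b X Y assume ab: "a < b" "b < h" and XY: "X \<subseteq> B (e b)" "Y \<subseteq> B (e a)" "\<kappa>1 * card (B (e b)) \<le> card X"
        "\<kappa>1 * card (B (e a)) \<le> card Y" and few: "\<forall>x\<in>X. card {y\<in>Y. c x y = pc a b} \<le> \<theta> / 2 * card Y"
      have ah: "a < h" using ab by linarith
      have finX: "finite X" using finite_subset[OF XY(1)] fB(1)[OF eM[OF ab(2)]] by simp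
      have finY: "finite Y" using finite_subset[OF XY(2)] fB(1)[OF eM[OF ah]] by simp
      have c': "c x y = c y x" for x y using c by simp
      have few': "real (card {y\<in>Y. c x y = pc a b}) \<le> \<theta> / 2 * real (card Y)" if "x \<in> X" for x
        using few that by (rule bspec)
      have "0 \<le> \<theta> / 2" using \<theta> by simp
      from two_sided[OF finX finY c' few' this]
      obtain Y' where Y': "Y' \<subseteq> Y" "card Y \<le> 2 * card Y'" "sparse_pair c \<theta> (pc a b) Y' X" by auto
      define B' where "B' = B(e a := Y', e b := X)"
      have eab: "e a < e b" by (rule elt[OF ab])
      have cB: "contr \<kappa> {..<M} B' B"
      proof -
        have le1: "\<kappa> * card A \<le> (1::real) * card A" for A :: "'a set" using k0 by (intro mult_right_mono) auto
        have "real (card Y) \<le> real (2 * card Y')" using Y'(2) by (rule of_nat_mono)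
        then have "\<kappa> * card (B (e a)) \<le> card Y'" using XY(4) unfolding \<kappa>_def by simp
        moreover have "\<kappa> * card (B (e b)) \<le> card X"
          using XY(3) le1 k1 order_trans[OF mult_right_mono[of \<kappa> \<kappa>1 "real (card (B (e b)))"]] by (simp add: \<kappa>_def)
        ultimately show ?thesis using le1 XY Y'(1) by (auto simp: contr_def B'_def)
      qed
      define t where "t = (e a, e b, pc a b)"
      have "t \<in> triples M k - D"
        using eab eM[OF ab(2)] nD[OF eS[OF ah] eS[OF ab(2)] eab] ijk by (auto simp: t_def pc_def triples_def)
      moreover have "sparse_triples c \<theta> B' (insert t D)"
        unfolding sparse_triples_def
      proof (intro ballI, clarify)
        fix u v \<gamma> assume uv: "(u, v, \<gamma>) \<in> insert t D"
        show "sparse_pair c \<theta> \<gamma> (B' u) (B' v)"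
        proof (cases "(u, v, \<gamma>) = t")
          case True
          then show ?thesis using Y'(3) eab by (auto simp: t_def B'_def)
        next
          case False
          then have uvD: "(u, v, \<gamma>) \<in> D" using uv by simp
          then have "(u, v, \<gamma>) \<in> triples M k" using D by blast
          then have uvM: "u < M" "v < M" by (auto simp: triples_def)
          have "sparse_pair c (\<theta> * \<kappa>) \<gamma> (B u) (B v)" using sp uvD unfolding sparse_triples_def by fast
          then show ?thesis
          proof (rule sparse_pair_shrink)
            show "finite (B u)" "finite (B v)" using fB uvM by auto
            show "B' u \<subseteq> B u" "B' v \<subseteq> B v" "\<kappa> * card (B u) \<le> card (B' u)" "\<kappa> * card (B v) \<le> card (B' v)"
              using cB uvM by (auto simp: contr_def)
          qed (use k0 \<theta> in auto)
        qed
      qed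
      ultimately show ?concl using cB by blast
    qed
  qed
qed

text \<open>Induction on the number of triples not yet sparse, which drops with each application of
  \<open>kill_triple\<close>. As every round worsens the densities, the initial
  \<open>\<theta>0\<close> must be chosen for the whole remaining number of rounds.\<close>

lemma kill_all:
  fixes \<theta> :: real
  assumes \<theta>: "0 < \<theta>" "\<theta> \<le> 1"
  shows "\<exists>\<kappa>::real. \<exists>\<theta>0::real. 0 < \<kappa> \<and> \<kappa> \<le> 1 \<and> 0 < \<theta>0 \<and> \<theta>0 \<le> \<theta> \<and> (\<forall>(c :: 'a \<Rightarrow> 'a \<Rightarrow> nat) B D. (\<forall>x y. c x y = c y x) \<longrightarrow>
    blocks M B \<longrightarrow> D \<subseteq> triples M k \<longrightarrow> card (triples M k - D) < n \<longrightarrow> sparse_triples c \<theta>0 B D \<longrightarrow>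
    pair_copy k h E c (\<Union>i<M. B i) \<or>
    (\<exists>B' D'. contr \<kappa> {..<M} B' B \<and> sparse_triples c \<theta> B' D' \<and> (\<forall>S i j. S \<subseteq> {..<M} \<longrightarrow> card S = h \<longrightarrow> \<not> dense_pair k D' S i j)))"
proof (induction n)
  case 0
  show ?case by (rule exI[of _ 1], rule exI[of _ \<theta>]) (use \<theta> in auto)
next
  case (Suc n)
  then obtain \<kappa>1 \<theta>1 :: real where 1: "0 < \<kappa>1" "\<kappa>1 \<le> 1" "0 < \<theta>1" "\<theta>1 \<le> \<theta>" and
    IH: "\<And>(c :: 'a \<Rightarrow> 'a \<Rightarrow> nat) B D. (\<forall>x y. c x y = c y x) \<Longrightarrow>
    blocks M B \<Longrightarrow> D \<subseteq> triples M k \<Longrightarrow> card (triples M k - D) < n \<Longrightarrow> sparse_triples c \<theta>1 B D \<Longrightarrow>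
    pair_copy k h E c (\<Union>i<M. B i) \<or>
    (\<exists>B' D'. contr \<kappa>1 {..<M} B' B \<and> sparse_triples c \<theta> B' D' \<and> (\<forall>S i j. S \<subseteq> {..<M} \<longrightarrow> card S = h \<longrightarrow> \<not> dense_pair k D' S i j))"
    by (elim exE conjE) (rule that, assumption, assumption, assumption, assumption, erule allE, erule allE, erule allE,
      erule (1) impE, erule (1) impE, erule (1) impE, erule (1) impE, erule (1) mp)
  have "\<theta>1 \<le> 1" using 1 \<theta> by linarith
  from kill_triple[OF 1(3) this, where 'a = 'a and M = M and k = k and h = h and E = E]
  obtain \<kappa>2 :: real where k2: "0 < \<kappa>2" "\<kappa>2 \<le> 1" and step: "\<And>(c :: 'a \<Rightarrow> 'a \<Rightarrow> nat) B D S i j. (\<forall>x y. c x y = c y x) \<Longrightarrow> blocks M B \<Longrightarrow>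
    D \<subseteq> triples M k \<Longrightarrow> sparse_triples c (\<theta>1 * \<kappa>2) B D \<Longrightarrow> S \<subseteq> {..<M} \<Longrightarrow> card S = h \<Longrightarrow> dense_pair k D S i j \<Longrightarrow>
    pair_copy k h E c (\<Union>i<M. B i) \<or>
    (\<exists>B' t. t \<in> triples M k - D \<and> contr \<kappa>2 {..<M} B' B \<and> sparse_triples c \<theta>1 B' (insert t D))"
    by (elim exE conjE) (rule that, assumption, assumption, erule allE, erule allE, erule allE, erule allE, erule allE, erule allE,
      erule (1) impE, erule (1) impE, erule (1) impE, erule (1) impE, erule (1) impE, erule (1) impE, erule (1) mp)
  have k12: "0 < \<kappa>2 * \<kappa>1" "\<kappa>2 * \<kappa>1 \<le> 1" using 1 k2 mult_mono[of \<kappa>2 1 \<kappa>1 1] by auto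
  have t12: "0 < \<theta>1 * \<kappa>2" "\<theta>1 * \<kappa>2 \<le> \<theta>" using 1 k2 mult_mono[of \<theta>1 \<theta> \<kappa>2 1] \<theta> by auto
  show ?case
  proof (rule exI[of _ "\<kappa>2 * \<kappa>1"], rule exI[of _ "\<theta>1 * \<kappa>2"], intro conjI allI impI k12 t12)
    fix c :: "'a \<Rightarrow> 'a \<Rightarrow> nat" and B D
    assume c: "\<forall>x y. c x y = c y x" and B: "blocks M B" and D: "D \<subseteq> triples M k" "card (triples M k - D) < Suc n"
      and sp: "sparse_triples c (\<theta>1 * \<kappa>2) B D"
    let ?end = "\<lambda>D' :: (nat \<times> nat \<times> nat) set. \<forall>S i j. S \<subseteq> {..<M} \<longrightarrow> card S = h \<longrightarrow> \<not> dense_pair k D' S i j"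
    let ?concl = "pair_copy k h E c (\<Union>i<M. B i) \<or> (\<exists>B' D'. contr (\<kappa>2 * \<kappa>1) {..<M} B' B \<and> sparse_triples c \<theta> B' D' \<and> ?end D')"
    show ?concl
    proof (cases "?end D")
      case True
      then have "contr (\<kappa>2 * \<kappa>1) {..<M} B B \<and> sparse_triples c \<theta> B D \<and> ?end D"
        using contr_refl[OF k12(2)] sparse_triples_mono[OF sp t12(2)] by simp
      then show ?concl by (intro disjI2 exI)
    next
      case False
      then obtain S i j where S: "S \<subseteq> {..<M}" "card S = h" "dense_pair k D S i j" by blast
      from step[OF c B D(1) sp S] show ?concl
      proof (elim disjE exE conjE)
        fix B' t assume t: "t \<in> triples M k - D" and cB: "contr \<kappa>2 {..<M} B' B" and sp': "sparse_triples c \<theta>1 B' (insert t D)"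
        have "triples M k - insert t D = (triples M k - D) - {t}" by blast
        then have "card (triples M k - insert t D) < card (triples M k - D)"
          using t finite_triples by (metis card_Diff1_less finite_Diff)
        then have lt: "card (triples M k - insert t D) < n" using D(2) by linarith
        have sub: "insert t D \<subseteq> triples M k" using t D(1) by blast
        from IH[OF c blocks_contr[OF B cB k2(1)] sub lt sp'] show ?concl
        proof (elim disjE exE conjE)
          assume "pair_copy k h E c (\<Union>i<M. B' i)"
          moreover have "(\<Union>i<M. B' i) \<subseteq> (\<Union>i<M. B i)" using cB by (intro UN_mono) (auto simp: contr_def)
          ultimately show ?concl using pair_copy_mono by (intro disjI1) (rule pair_copy_mono)
        next
          fix B'' D' assume "contr \<kappa>1 {..<M} B'' B'" "sparse_triples c \<theta> B'' D'" "?end D'"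
          then have "contr (\<kappa>2 * \<kappa>1) {..<M} B'' B \<and> sparse_triples c \<theta> B'' D' \<and> ?end D'"
            using contr_trans[OF cB _ less_imp_le[OF 1(1)]] by simp
          then show ?concl by (intro disjI2 exI)
        qed
      qed blast
    qed
  qed
qed

text \<open>After the elimination each pair of blocks is coloured by its set of remaining colours.
  On a homogeneous index set this is a single set, and it has at most one element, since two of its
  colours would form a dense pair on \<open>h\<close> blocks. The other colours together have
  density at most \<open>\<theta>\<close>, because each has at most
  \<open>\<theta> / k\<close>.\<close>

lemma roedl:
  fixes \<theta> :: real and M h k :: nat
  assumes \<theta>: "0 < \<theta>" "\<theta> \<le> 1" and k: "1 \<le> k"
  shows "\<exists>N::nat. \<exists>\<kappa>::real. 1 \<le> N \<and> 0 < \<kappa> \<and> (\<forall>(c :: 'a \<Rightarrow> 'a \<Rightarrow> nat) B. (\<forall>x y. c x y = c y x) \<longrightarrow>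
    (\<forall>x y. x \<noteq> y \<longrightarrow> c x y \<in> {1..k}) \<longrightarrow> blocks N B \<longrightarrow> pair_copy k h E c (\<Union>i<N. B i) \<or>
    (\<exists>g\<in>{1..k}. \<exists>B' e. inj_on e {..<M} \<and> e ` {..<M} \<subseteq> {..<N} \<and> contr \<kappa> {..<M} B' (B \<circ> e) \<and>
      (\<forall>a<M. \<forall>b<M. a \<noteq> b \<longrightarrow> (\<forall>x\<in>B' a. card {y\<in>B' b. c x y \<noteq> g} \<le> \<theta> * card (B' b)))))"
proof -
  \<comment> \<open>\<open>M\<close> blocks are wanted in the end, \<open>h\<close> are needed for a
    dense pair, and 2 for one pair \<open>P\<close> to exist and define the common colour
    set.\<close>
  define m where "m = max (max M h) 2"
  have "finite (Pow {1..k})" by simp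
  from ramsey_colours[OF this, where r = 2 and m = m]
  obtain N0 :: nat where N0: "\<And>(V :: nat set) f. finite V \<Longrightarrow> N0 \<le> card V \<Longrightarrow> \<forall>A\<in>nsets V 2. f A \<in> Pow {1..k} \<Longrightarrow>
      \<exists>Q\<subseteq>V. card Q = m \<and> (\<forall>A\<in>nsets Q 2. \<forall>A'\<in>nsets Q 2. f A = f A')"
    by (elim exE) (rule that, erule allE, erule (1) impE, erule (1) impE, erule allE, erule (1) mp)
  define N where "N = max N0 1"
  define \<theta>' where "\<theta>' = \<theta> / k"
  have t': "0 < \<theta>'" "\<theta>' \<le> 1" "k * \<theta>' = \<theta>" using \<theta> k by (auto simp: \<theta>'_def field_simps)
  from kill_all[OF t'(1,2), where 'a = 'a and M = N and k = k and h = h and E = E and n = "Suc (card (triples N k))"]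
  obtain \<kappa> \<theta>0 :: real where 0: "0 < \<kappa>" "\<kappa> \<le> 1" "0 < \<theta>0" and
    kill: "\<And>(c :: 'a \<Rightarrow> 'a \<Rightarrow> nat) B D. (\<forall>x y. c x y = c y x) \<Longrightarrow>
    blocks N B \<Longrightarrow> D \<subseteq> triples N k \<Longrightarrow> card (triples N k - D) < Suc (card (triples N k)) \<Longrightarrow> sparse_triples c \<theta>0 B D \<Longrightarrow>
    pair_copy k h E c (\<Union>i<N. B i) \<or>
    (\<exists>B' D'. contr \<kappa> {..<N} B' B \<and> sparse_triples c \<theta>' B' D' \<and> (\<forall>S i j. S \<subseteq> {..<N} \<longrightarrow> card S = h \<longrightarrow> \<not> dense_pair k D' S i j))"
    by (elim exE conjE) (rule that, assumption, assumption, assumption, erule allE, erule allE, erule allE,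
      erule (1) impE, erule (1) impE, erule (1) impE, erule (1) impE, erule (1) mp)
  show ?thesis
  proof (rule exI[of _ N], rule exI[of _ \<kappa>], intro conjI allI impI 0(1))
    show "1 \<le> N" by (simp add: N_def)
    fix c :: "'a \<Rightarrow> 'a \<Rightarrow> nat" and B :: "nat \<Rightarrow> 'a set"
    assume c: "\<forall>x y. c x y = c y x" and ck: "\<forall>x y. x \<noteq> y \<longrightarrow> c x y \<in> {1..k}" and B: "blocks N B"
    let ?flat = "\<exists>g\<in>{1..k}. \<exists>B' e. inj_on e {..<M} \<and> e ` {..<M} \<subseteq> {..<N} \<and> contr \<kappa> {..<M} B' (B \<circ> e) \<and>
      (\<forall>a<M. \<forall>b<M. a \<noteq> b \<longrightarrow> (\<forall>x\<in>B' a. card {y\<in>B' b. c x y \<noteq> g} \<le> \<theta> * card (B' b)))"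
    have "sparse_triples c \<theta>0 B {}" by (simp add: sparse_triples_def)
    moreover have "card (triples N k - {}) < Suc (card (triples N k))" by simp
    ultimately have "pair_copy k h E c (\<Union>i<N. B i) \<or>
      (\<exists>B' D'. contr \<kappa> {..<N} B' B \<and> sparse_triples c \<theta>' B' D' \<and> (\<forall>S i j. S \<subseteq> {..<N} \<longrightarrow> card S = h \<longrightarrow> \<not> dense_pair k D' S i j))"
      by (intro kill[OF c B empty_subsetI])
    then show "pair_copy k h E c (\<Union>i<N. B i) \<or> ?flat"
    proof (elim disjE exE conjE)
      fix B' D' assume cB: "contr \<kappa> {..<N} B' B" and sp: "sparse_triples c \<theta>' B' D'"
        and nd: "\<forall>S i j. S \<subseteq> {..<N} \<longrightarrow> card S = h \<longrightarrow> \<not> dense_pair k D' S i j"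
      define f where "f A = {\<gamma>\<in>{1..k}. (Min A, Max A, \<gamma>) \<notin> D'}" for A
      have "\<forall>A\<in>nsets {..<N} 2. f A \<in> Pow {1..k}" by (auto simp: f_def)
      from N0[OF _ _ this] obtain Q where Q: "Q \<subseteq> {..<N}" "card Q = m" "\<forall>A\<in>nsets Q 2. \<forall>A'\<in>nsets Q 2. f A = f A'"
        by (auto simp: N_def)
      have finQ: "finite Q" using finite_subset[OF Q(1)] by simp
      have "2 \<le> card Q" using Q(2) by (simp add: m_def)
      then obtain P where P: "P \<subseteq> Q" "card P = 2" by (metis obtain_subset_with_card_n)
      then have Pn: "P \<in> nsets Q 2" using finite_subset[OF P(1) finQ] by (simp add: nsets_def)
      have fP: "f {a, b} = f P" if "a \<in> Q" "b \<in> Q" "a < b" for a b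
      proof -
        have "{a, b} \<in> nsets Q 2" using that by (simp add: nsets_def)
        then show ?thesis using Q(3) Pn by blast
      qed
      have tri: "(a, b, \<gamma>) \<in> D' \<longleftrightarrow> \<gamma> \<notin> f P" if "a \<in> Q" "b \<in> Q" "a < b" "\<gamma> \<in> {1..k}" for a b \<gamma>
        using fP[OF that(1-3)] that(3,4) by (auto simp: f_def)
      have fPk: "f P \<subseteq> {1..k}" by (auto simp: f_def)
      have one: "i = j" if ij: "i \<in> f P" "j \<in> f P" for i j
      proof (rule ccontr)
        assume "i \<noteq> j"
        have "h \<le> card Q" using Q(2) by (simp add: m_def)
        then obtain S where S: "S \<subseteq> Q" "card S = h" by (metis obtain_subset_with_card_n)
        have "dense_pair k D' S i j"
          unfolding dense_pair_def using \<open>i \<noteq> j\<close> ij fPk tri S(1) by (meson subsetD)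
        moreover have "\<not> dense_pair k D' S i j" using nd subset_trans[OF S(1) Q(1)] S(2) by simp
        ultimately show False by simp
      qed
      obtain g where g: "g \<in> {1..k}" "f P \<subseteq> {g}"
      proof (cases "f P = {}")
        case True
        then show ?thesis using that[of 1] k by simp
      next
        case False
        then show ?thesis using that one fPk by blast
      qed
      have "M \<le> card Q" using Q(2) by (simp add: m_def)
      then obtain R where R: "R \<subseteq> Q" "card R = M" by (metis obtain_subset_with_card_n)
      have finR: "finite R" using finite_subset[OF R(1) finQ] .
      obtain e where e: "bij_betw e {..<M} R"
        using ex_bij_betw_nat_finite[OF finR] R(2) by (auto simp: atLeast0LessThan)
      have einj: "inj_on e {..<M}" and eQ: "\<And>a. a < M \<Longrightarrow> e a \<in> Q" using e R(1) by (auto simp: bij_betw_def)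
      have eN: "e a < N" if "a < M" for a using eQ[OF that] Q(1) by auto
      have "contr \<kappa> {..<M} (B' \<circ> e) (B \<circ> e)" using cB eN by (auto simp: contr_def)
      moreover have "card {y\<in>B' (e b). c x y \<noteq> g} \<le> \<theta> * card (B' (e b))"
        if ab: "a < M" "b < M" "a \<noteq> b" and x: "x \<in> B' (e a)" for a b x
      proof -
        have ne: "e a \<noteq> e b" using einj ab by (auto simp: inj_on_def)
        have B': "blocks N B'" by (rule blocks_contr[OF B cB 0(1)])
        have disj: "B' (e a) \<inter> B' (e b) = {}" and fb: "finite (B' (e b))"
          using B' ne eN ab by (auto simp: blocks_def)
        have sp1: "real (card {y\<in>B' (e b). c x y = \<gamma>}) \<le> \<theta>' * card (B' (e b))" if \<gamma>: "\<gamma> \<in> {1..k} - {g}" for \<gamma>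
        proof -
          have "sparse_pair c \<theta>' \<gamma> (B' (e a)) (B' (e b))"
          proof (cases "e a < e b")
            case True
            then have "(e a, e b, \<gamma>) \<in> D'" using tri eQ ab \<gamma> g by blast
            then show ?thesis using sp unfolding sparse_triples_def by fast
          next
            case False
            then have "(e b, e a, \<gamma>) \<in> D'" using tri eQ ab \<gamma> g ne by (meson Diff_iff linorder_neqE_nat subsetD)
            then have "sparse_pair c \<theta>' \<gamma> (B' (e b)) (B' (e a))" using sp unfolding sparse_triples_def by fast
            then show ?thesis by (simp add: sparse_pair_sym)
          qed
          then show ?thesis using x unfolding sparse_pair_def by (meson bspec)
        qed
        have "{y\<in>B' (e b). c x y \<noteq> g} \<subseteq> (\<Union>\<gamma>\<in>{1..k} - {g}. {y\<in>B' (e b). c x y = \<gamma>})"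
        proof
          fix y assume y: "y \<in> {y\<in>B' (e b). c x y \<noteq> g}"
          then have "x \<noteq> y" using disj x by blast
          then show "y \<in> (\<Union>\<gamma>\<in>{1..k} - {g}. {y\<in>B' (e b). c x y = \<gamma>})" using ck y by simp
        qed
        then have "card {y\<in>B' (e b). c x y \<noteq> g} \<le> card (\<Union>\<gamma>\<in>{1..k} - {g}. {y\<in>B' (e b). c x y = \<gamma>})"
          using fb by (intro card_mono) auto
        also have "\<dots> \<le> (\<Sum>\<gamma>\<in>{1..k} - {g}. card {y\<in>B' (e b). c x y = \<gamma>})" by (rule card_UN_le) simp
        finally have "real (card {y\<in>B' (e b). c x y \<noteq> g}) \<le> real (\<Sum>\<gamma>\<in>{1..k} - {g}. card {y\<in>B' (e b). c x y = \<gamma>})"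
          by (rule of_nat_mono)
        also have "\<dots> = (\<Sum>\<gamma>\<in>{1..k} - {g}. real (card {y\<in>B' (e b). c x y = \<gamma>}))" by simp
        also have "\<dots> \<le> card ({1..k} - {g}) * (\<theta>' * card (B' (e b)))" using sp1 by (intro sum_bounded_above) auto
        also have "\<dots> \<le> k * (\<theta>' * card (B' (e b)))" using card_Diff_subset[of "{g}" "{1..k}"] g(1) t' by (intro mult_right_mono) auto
        also have "\<dots> = \<theta> * card (B' (e b))" unfolding t'(3)[symmetric] by simp
        finally show ?thesis .
      qed
      moreover have "e ` {..<M} \<subseteq> {..<N}" using eN by auto
      ultimately have ?flat using g(1) einj
        by (intro bexI[of _ g] exI[of _ "B' \<circ> e"] exI[of _ e]) simp_all
      then show ?thesis ..
    qed auto
  qed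
qed

subsection \<open>Forests as parent functions\<close>

text \<open>At the first vertex of a longest path all neighbours lie on the path, and one other than
  the second vertex would close a cycle.\<close>

lemma few_neighbours:
  assumes fin: "finite V" "V \<noteq> {}" and loops: "\<And>x. {x} \<notin> E" and acyc: "\<And>vs. set vs \<subseteq> V \<Longrightarrow> \<not> is_cycle E vs"
  shows "\<exists>v\<in>V. \<forall>x\<in>V. \<forall>y\<in>V. {v, x} \<in> E \<longrightarrow> {v, y} \<in> E \<longrightarrow> x = y"
proof (rule ccontr)
  assume "\<not> ?thesis"
  then have two: "\<And>v. v \<in> V \<Longrightarrow> \<exists>x\<in>V. \<exists>y\<in>V. {v, x} \<in> E \<and> {v, y} \<in> E \<and> x \<noteq> y" by blast
  define path where "path vs \<longleftrightarrow> vs \<noteq> [] \<and> distinct vs \<and> set vs \<subseteq> V \<and> (\<forall>i < length vs - 1. {vs ! i, vs ! (i+1)} \<in> E)" for vs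
  obtain v0 where "v0 \<in> V" using fin by blast
  then have "path [v0]" by (simp add: path_def)
  moreover have "\<forall>vs. path vs \<longrightarrow> length vs < Suc (card V)"
    unfolding path_def using fin by (metis card_mono distinct_card le_imp_less_Suc)
  ultimately obtain vs where vs: "path vs" "\<And>ws. path ws \<Longrightarrow> length ws \<le> length vs"
    using ex_has_greatest_nat[of path "[v0]" length "Suc (card V)"] by (metis less_imp_le)
  obtain x r where x: "vs = x # r" using vs(1) by (cases vs) (auto simp: path_def)
  then have xV: "x \<in> V" using vs(1) by (simp add: path_def)
  obtain w where w: "w \<in> V" "{x, w} \<in> E" "length vs \<ge> 2 \<longrightarrow> w \<noteq> vs ! 1" using two[OF xV] by metis
  have wvs: "w \<in> set vs"
  proof (rule ccontr)
    assume "w \<notin> set vs"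
    then have "path (w # vs)"
      using vs(1) w(1,2) x by (auto simp: path_def nth_Cons insert_commute split: nat.split)
    then show False using vs(2) by fastforce
  qed
  then obtain i where i: "i < length vs" "vs ! i = w" by (meson in_set_conv_nth)
  have "i \<noteq> 0" using i x w(2) loops by (cases i) auto
  moreover have "i \<noteq> 1" using i w(3) by auto
  ultimately have i2: "2 \<le> i" by linarith
  have "is_cycle E (take (Suc i) vs)"
    unfolding is_cycle_def
  proof (intro conjI allI impI)
    show "3 \<le> length (take (Suc i) vs)" using i i2 by simp
    show "distinct (take (Suc i) vs)" using vs(1) by (simp add: path_def)
    have "last (take (Suc i) vs) = w" using i by (simp add: take_Suc_conv_app_nth)
    moreover have "hd (take (Suc i) vs) = x" using x by simp
    ultimately show "{last (take (Suc i) vs), hd (take (Suc i) vs)} \<in> E" using w(2) by (simp add: insert_commute)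
    fix a assume "a < length (take (Suc i) vs) - 1"
    then show "{take (Suc i) vs ! a, take (Suc i) vs ! (a + 1)} \<in> E" using vs(1) i by (auto simp: path_def)
  qed
  moreover have "set (take (Suc i) vs) \<subseteq> V" using vs(1) set_take_subset[of "Suc i" vs] unfolding path_def by (meson subset_trans)
  then have "\<not> is_cycle E (take (Suc i) vs)" by (rule acyc)
  ultimately show False by simp
qed

text \<open>A vertex with at most one neighbour is removed and listed last. The value 0 of
  \<open>p\<close> means that there is no earlier neighbour, so that after a shift of indices by one
  the number 0 can be a new root.\<close>

lemma forest_enumeration:
  assumes "finite V" "\<And>x. {x} \<notin> E" "\<And>vs. set vs \<subseteq> V \<Longrightarrow> \<not> is_cycle E vs"
  shows "\<exists>f p. bij_betw f {..<card V} V \<and> (\<forall>b<card V. p b \<le> b \<and> (\<forall>a<b. {f a, f b} \<in> E \<longleftrightarrow> p b = Suc a))"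
  using assms
proof (induction "card V" arbitrary: V)
  case 0
  then have "V = {}" by simp
  then show ?case by (auto simp: bij_betw_def)
next
  case (Suc n)
  then have "V \<noteq> {}" by auto
  from few_neighbours[OF Suc.prems(1) this Suc.prems(2,3)]
  obtain v where v: "v \<in> V" "\<And>x y. x \<in> V \<Longrightarrow> y \<in> V \<Longrightarrow> {v, x} \<in> E \<Longrightarrow> {v, y} \<in> E \<Longrightarrow> x = y" by blast
  define W where "W = V - {v}"
  have cW: "card W = n" using Suc.hyps(2) v(1) Suc.prems(1) by (simp add: W_def)
  have WV: "W \<subseteq> V" "finite W" using Suc.prems(1) by (auto simp: W_def)
  have "\<And>vs. set vs \<subseteq> W \<Longrightarrow> \<not> is_cycle E vs" using Suc.prems(3) WV(1) by (meson subset_trans)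
  from Suc.hyps(1)[OF cW[symmetric] WV(2) Suc.prems(2) this]
  obtain f p where f: "bij_betw f {..<n} W" and p: "\<And>b. b < n \<Longrightarrow> p b \<le> b \<and> (\<forall>a<b. {f a, f b} \<in> E \<longleftrightarrow> p b = Suc a)"
    unfolding cW by blast
  define f' where "f' = f(n := v)"
  have f': "bij_betw f' {..<Suc n} V"
  proof -
    have "bij_betw f' {..<n} W" using f by (simp add: f'_def bij_betw_def inj_on_def)
    moreover have "bij_betw f' {n} {v}" by (simp add: f'_def)
    ultimately have "bij_betw f' ({..<n} \<union> {n}) (W \<union> {v})" by (rule bij_betw_combine) (simp add: W_def)
    moreover have "W \<union> {v} = V" "{..<n} \<union> {n} = {..<Suc n}" using v(1) by (auto simp: W_def)
    ultimately show ?thesis by simp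
  qed
  define q where "q = (if \<exists>a<n. {f a, v} \<in> E then Suc (SOME a. a < n \<and> {f a, v} \<in> E) else 0)"
  have q: "q \<le> n \<and> (\<forall>a<n. {f a, v} \<in> E \<longleftrightarrow> q = Suc a)"
  proof (cases "\<exists>a<n. {f a, v} \<in> E")
    case True
    define a0 where "a0 = (SOME a. a < n \<and> {f a, v} \<in> E)"
    have a0: "a0 < n" "{f a0, v} \<in> E" using someI_ex[OF True[unfolded]] by (auto simp: a0_def)
    have uniq: "a = a0" if a: "a < n" "{f a, v} \<in> E" for a
    proof -
      have "f a \<in> V" "f a0 \<in> V" using a a0 f WV(1) by (auto simp: bij_betw_def)
      then have "f a = f a0" using v(2) a a0 by (metis insert_commute)
      then show ?thesis using f a a0 by (auto simp: bij_betw_def inj_on_def)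
    qed
    have qa: "q = Suc a0" using True by (simp add: q_def a0_def)
    show ?thesis
    proof (intro conjI allI impI iffI)
      show "q \<le> n" using a0(1) qa by simp
      show "q = Suc a" if "a < n" "{f a, v} \<in> E" for a using uniq[OF that] qa by simp
      show "{f a, v} \<in> E" if "q = Suc a" for a using that qa a0(2) by simp
    qed
  qed (auto simp: q_def)
  have "\<forall>b<Suc n. (p(n := q)) b \<le> b \<and> (\<forall>a<b. {f' a, f' b} \<in> E \<longleftrightarrow> (p(n := q)) b = Suc a)"
    using p q by (auto simp: f'_def less_Suc_eq)
  then show ?case using f' Suc.hyps(2) by (intro exI[of _ f'] exI[of _ "p(n := q)"]) simp
qed

section \<open>Rooted trees from parent functions\<close>

locale parent =
  fixes p :: "nat \<Rightarrow> nat" and m :: nat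
  assumes p: "1 \<le> b \<Longrightarrow> p b < b"
begin

text \<open>The vertices \<open>0, \<dots>, m\<close> form a tree with root \<open>0\<close> in which \<open>p b\<close> is the parent of \<open>b\<close>;
  \<open>tree_from i j\<close> is the subtree of \<open>i\<close> without the children of \<open>i\<close> below \<open>j\<close>. It consists of
  the vertices \<open>v\<close> with \<open>anc j v = i\<close>.\<close>

function tree_from :: "nat \<Rightarrow> nat \<Rightarrow> rtree" where
  "tree_from i j = (if m < j then Leaf
     else if p j = i then Join (tree_from i (Suc j)) (tree_from j (Suc j)) else tree_from i (Suc j))"
  by auto
termination by (relation "measure (\<lambda>(i, j). Suc m - j)") auto

function anc :: "nat \<Rightarrow> nat \<Rightarrow> nat" where
  "anc j v = (if v < j \<or> v \<le> p v then v else anc j (p v))"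
  by auto
termination by (relation "measure snd") auto

declare tree_from.simps [simp del] anc.simps [simp del]

lemma anc_small: "v < j \<Longrightarrow> anc j v = v"
  by (simp add: anc.simps)

lemma anc_large: "1 \<le> j \<Longrightarrow> j \<le> v \<Longrightarrow> anc j v = anc j (p v)"
  using p[of v] by (subst anc.simps) auto

lemma anc_less: "1 \<le> j \<Longrightarrow> anc j v < j"
proof (induction v rule: less_induct)
  case (less v)
  then show ?case
    using p[of v] by (cases "v < j") (auto simp: anc_small anc_large)
qed

text \<open>Lowering the threshold from \<open>Suc j\<close> to \<open>j\<close> affects only the
  vertices whose chain of parents stopped at \<open>j\<close>; they move on to
  \<open>p j\<close>.\<close>

lemma anc_Suc: "1 \<le> j \<Longrightarrow> anc j v = (if anc (Suc j) v = j then p j else anc (Suc j) v)"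
proof (induction v rule: less_induct)
  case (less v)
  consider "v < j" | "v = j" | "j < v" by linarith
  then show ?case
  proof cases
    case 1
    then show ?thesis by (simp add: anc_small)
  next
    case 2
    then show ?thesis using anc_large[of j j] p[of j] less(2) by (simp add: anc_small)
  next
    case 3
    then show ?thesis using less(1)[of "p v"] p[of v] less(2) anc_large[of j v] anc_large[of "Suc j" v] by simp
  qed
qed

text \<open>Follows the recursion of \<open>tree_from\<close>. If \<open>p j = i\<close>, the
  vertices belonging to \<open>(i, j)\<close> split into those of \<open>(i, Suc j)\<close> and
  those of \<open>(j, Suc j)\<close>, like the two parts of the \<open>Join\<close>. A vertex above
  \<open>j\<close> stays in the same part as its parent, so the edge between \<open>i\<close> and
  \<open>j\<close> is the only one that crosses.\<close>

lemma tree_from_copy: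
  assumes c: "coloured c" and "1 \<le> j" "i < j" "coloured.rcopy c \<kappa> (tree_from i j) x S"
  shows "\<exists>\<phi>. inj_on \<phi> {v. v \<le> m \<and> anc j v = i} \<and> \<phi> ` {v. v \<le> m \<and> anc j v = i} \<subseteq> S \<and> (i \<le> m \<longrightarrow> \<phi> i = x) \<and>
    (\<forall>a b. a < b \<longrightarrow> b \<le> m \<longrightarrow> anc j a = i \<longrightarrow> anc j b = i \<longrightarrow> c (\<phi> a) (\<phi> b) = (if p b = a then \<kappa> else 0))"
  using assms(2-)
proof (induction i j arbitrary: x S rule: tree_from.induct)
  case (1 i j)
  interpret coloured c by (rule c)
  show ?case
  proof (cases "m < j")
    case True
    then have t: "tree_from i j = Leaf" by (simp add: tree_from.simps)
    have "rcopy \<kappa> Leaf x S" using "1.prems"(3) unfolding t .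
    then have "S = {x}" by cases
    moreover have only: "v = i" if "v \<le> m" "anc j v = i" for v using that True by (simp add: anc_small)
    moreover have "\<not> (a < b \<and> b \<le> m \<and> anc j a = i \<and> anc j b = i)" for a b
      using only[of a] only[of b] by linarith
    moreover have "inj_on (\<lambda>_. x) {v. v \<le> m \<and> anc j v = i}"
    proof (rule inj_onI)
      fix u v assume "u \<in> {v. v \<le> m \<and> anc j v = i}" "v \<in> {v. v \<le> m \<and> anc j v = i}"
      then show "u = v" using only[of u] only[of v] by simp
    qed
    ultimately show ?thesis by (intro exI[of _ "\<lambda>_. x"]) (simp add: image_subset_iff)
  next
    case False
    then have j: "j \<le> m" by simp
    show ?thesis
    proof (cases "p j = i")
      case False
      then have "tree_from i j = tree_from i (Suc j)" using j by (subst tree_from.simps) simp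
      then have "rcopy \<kappa> (tree_from i (Suc j)) x S" using "1.prems"(3) by simp
      moreover have "anc j v = i \<longleftrightarrow> anc (Suc j) v = i" for v
        using False "1.prems"(1,2) by (simp add: anc_Suc[of j v])
      ultimately show ?thesis using "1.IH"(3) False \<open>\<not> m < j\<close> "1.prems"(1,2) by simp
    next
      case True
      then have "tree_from i j = Join (tree_from i (Suc j)) (tree_from j (Suc j))"
        using j by (subst tree_from.simps) simp
      then have "rcopy \<kappa> (Join (tree_from i (Suc j)) (tree_from j (Suc j))) x S" using "1.prems"(3) by simp
      then obtain S1 S2 y where cp: "rcopy \<kappa> (tree_from i (Suc j)) x S1" "rcopy \<kappa> (tree_from j (Suc j)) y S2"
        and S: "S = S1 \<union> S2" "S1 \<inter> S2 = {}" "c x y = \<kappa>"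
        and zero: "\<And>a b. a \<in> S1 \<Longrightarrow> b \<in> S2 \<Longrightarrow> (a, b) \<noteq> (x, y) \<Longrightarrow> c a b = 0"
        by cases (rule that, assumption+)
      define A where "A = {v. v \<le> m \<and> anc (Suc j) v = i}"
      define A' where "A' = {v. v \<le> m \<and> anc (Suc j) v = j}"
      have "\<exists>\<phi>. inj_on \<phi> A \<and> \<phi> ` A \<subseteq> S1 \<and> (i \<le> m \<longrightarrow> \<phi> i = x) \<and>
          (\<forall>a b. a < b \<longrightarrow> b \<le> m \<longrightarrow> anc (Suc j) a = i \<longrightarrow> anc (Suc j) b = i \<longrightarrow> c (\<phi> a) (\<phi> b) = (if p b = a then \<kappa> else 0))"
        unfolding A_def using True \<open>\<not> m < j\<close> "1.prems"(1,2) cp(1) by (intro "1.IH"(1)) auto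
      then obtain \<phi>1 where 1: "inj_on \<phi>1 A" "\<phi>1 ` A \<subseteq> S1" "i \<le> m \<longrightarrow> \<phi>1 i = x" and
        cc1: "\<And>a b. a < b \<Longrightarrow> b \<le> m \<Longrightarrow> anc (Suc j) a = i \<Longrightarrow> anc (Suc j) b = i \<Longrightarrow> c (\<phi>1 a) (\<phi>1 b) = (if p b = a then \<kappa> else 0)"
        by (elim exE conjE) (rule that, assumption+, erule allE, erule allE, erule (1) impE, erule (1) impE, erule (1) impE, erule (1) mp)
      have "\<exists>\<phi>. inj_on \<phi> A' \<and> \<phi> ` A' \<subseteq> S2 \<and> (j \<le> m \<longrightarrow> \<phi> j = y) \<and>
          (\<forall>a b. a < b \<longrightarrow> b \<le> m \<longrightarrow> anc (Suc j) a = j \<longrightarrow> anc (Suc j) b = j \<longrightarrow> c (\<phi> a) (\<phi> b) = (if p b = a then \<kappa> else 0))"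
        unfolding A'_def using True \<open>\<not> m < j\<close> "1.prems"(1,2) cp(2) by (intro "1.IH"(2)) auto
      then obtain \<phi>2 where 2: "inj_on \<phi>2 A'" "\<phi>2 ` A' \<subseteq> S2" "j \<le> m \<longrightarrow> \<phi>2 j = y" and
        cc2: "\<And>a b. a < b \<Longrightarrow> b \<le> m \<Longrightarrow> anc (Suc j) a = j \<Longrightarrow> anc (Suc j) b = j \<Longrightarrow> c (\<phi>2 a) (\<phi>2 b) = (if p b = a then \<kappa> else 0)"
        by (elim exE conjE) (rule that, assumption+, erule allE, erule allE, erule (1) impE, erule (1) impE, erule (1) impE, erule (1) mp)
      have ij: "i < j" by (rule "1.prems"(2))
      have U: "{v. v \<le> m \<and> anc j v = i} = A \<union> A'"
        using True "1.prems"(1,2) by (auto simp: A_def A'_def anc_Suc[of j])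
      have AA: "A \<inter> A' = {}" using ij by (auto simp: A_def A'_def)
      have iA: "i \<in> A" "j \<in> A'" using ij j by (auto simp: A_def A'_def anc_small)
      define \<phi> where "\<phi> v = (if v \<in> A then \<phi>1 v else \<phi>2 v)" for v
      have \<phi>: "\<phi> v = \<phi>1 v" if "v \<in> A" for v using that by (simp add: \<phi>_def)
      have \<phi>': "\<phi> v = \<phi>2 v" if "v \<in> A'" for v using that AA by (auto simp: \<phi>_def)
      have inj: "inj_on \<phi> (A \<union> A')"
      proof (rule inj_onI)
        fix u v assume uv: "u \<in> A \<union> A'" "v \<in> A \<union> A'" "\<phi> u = \<phi> v"
        have ne: "\<phi>1 a \<noteq> \<phi>2 b" if "a \<in> A" "b \<in> A'" for a b
        proof -
          have "\<phi>1 a \<in> S1" "\<phi>2 b \<in> S2" using that 1(2) 2(2) by auto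
          then show ?thesis using S(2) by auto
        qed
        from uv(1,2) show "u = v"
        proof (elim UnE)
          assume "u \<in> A" "v \<in> A"
          then show ?thesis using uv(3) \<phi> inj_onD[OF 1(1)] by simp
        next
          assume "u \<in> A" "v \<in> A'"
          then show ?thesis using uv(3) \<phi> \<phi>' ne by simp
        next
          assume "u \<in> A'" "v \<in> A"
          then show ?thesis using uv(3) \<phi> \<phi>' ne[of v u] by simp
        next
          assume "u \<in> A'" "v \<in> A'"
          then show ?thesis using uv(3) \<phi>' inj_onD[OF 2(1)] by simp
        qed
      qed
      have cross: "c (\<phi>1 a) (\<phi>2 b) = (if a = i \<and> b = j then \<kappa> else 0)" if ab: "a \<in> A" "b \<in> A'" for a b
      proof (cases "a = i \<and> b = j")
        case True
        then show ?thesis using 1(3) 2(3) S(3) j ij by simp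
      next
        case False
        have "\<phi>1 i = x" "\<phi>2 j = y" using 1(3) 2(3) j ij by auto
        then have "(\<phi>1 a, \<phi>2 b) \<noteq> (x, y)" using False ab iA inj_onD[OF 1(1), of a i] inj_onD[OF 2(1), of b j] by auto
        moreover have "\<phi>1 a \<in> S1" "\<phi>2 b \<in> S2" using ab 1(2) 2(2) by auto
        ultimately show ?thesis using zero False by auto
      qed
      have up: "anc (Suc j) v = anc (Suc j) (p v)" if "j < v" for v using that by (intro anc_large) auto
      have "c (\<phi> a) (\<phi> b) = (if p b = a then \<kappa> else 0)"
        if ab: "a < b" "b \<le> m" "a \<in> A \<union> A'" "b \<in> A \<union> A'" for a b
      proof -
        consider "a \<in> A" "b \<in> A" | "a \<in> A'" "b \<in> A'" | "a \<in> A" "b \<in> A'" | "a \<in> A'" "b \<in> A"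
          using ab(3,4) by (elim UnE)
        then show ?thesis
        proof cases
          case 1
          then show ?thesis using cc1[OF ab(1,2)] \<phi> by (simp add: A_def)
        next
          case 2
          then show ?thesis using cc2[OF ab(1,2)] \<phi>' by (simp add: A'_def)
        next
          case 3
          have "p b = a \<longleftrightarrow> a = i \<and> b = j"
          proof
            assume pb: "p b = a"
            have "\<not> j < b" using up[of b] 3 pb ij by (auto simp: A_def A'_def)
            moreover have "\<not> b < j" using 3 by (auto simp: A'_def anc_small)
            ultimately show "a = i \<and> b = j" using pb True by simp
          qed (use True in simp)
          then show ?thesis using cross[OF 3] \<phi>[OF 3(1)] \<phi>'[OF 3(2)] by simp
        next
          case 4
          have "j \<le> a" using 4(1) by (cases "a < j") (auto simp: A'_def anc_small)
          then have jb: "j < b" using ab(1) by simp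
          have "p b \<noteq> a" using up[OF jb] 4 ij by (auto simp: A_def A'_def)
          moreover have "b \<noteq> i" using jb ij by simp
          ultimately show ?thesis using cross[OF 4(2,1)] sym[of "\<phi> a"] \<phi>[OF 4(2)] \<phi>'[OF 4(1)] by simp
        qed
      qed
      moreover have "a \<in> A \<union> A' \<longleftrightarrow> anc j a = i" if "a \<le> m" for a using that unfolding U[symmetric] by simp
      moreover have "\<phi> ` (A \<union> A') \<subseteq> S" using 1(2) 2(2) \<phi> \<phi>' S(1) by auto
      moreover have "\<phi> i = x" using \<phi>[OF iA(1)] 1(3) j ij by simp
      ultimately show ?thesis using inj unfolding U by (intro exI[of _ \<phi>]) simp
    qed
  qed
qed

lemma tree_copy:
  assumes c: "coloured c" and t: "coloured.rcopy c \<kappa> (tree_from 0 1) x S"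
  shows "\<exists>\<phi>. inj_on \<phi> {..m} \<and> \<phi> ` {..m} \<subseteq> S \<and>
    (\<forall>a b. a < b \<longrightarrow> b \<le> m \<longrightarrow> c (\<phi> a) (\<phi> b) = (if p b = a then \<kappa> else 0))"
proof -
  have a: "anc 1 v = 0" for v using anc_less[of 1 v] by simp
  show ?thesis using tree_from_copy[OF c _ _ t] unfolding a by (auto simp: atMost_def)
qed

end

subsection \<open>Multicolourings\<close>

text \<open>Since \<open>i \<noteq> j\<close>, the two colour classes are disjoint and nonedges stay
  outside \<open>G i\<close>. \<open>graph_iso\<close> also compares pairs with
  \<open>u = v\<close>, which is where the absence of loops enters.\<close>

lemma copy_alternative:
  fixes f :: "nat \<Rightarrow> 'b" and h n :: nat
  assumes G: "multicolouring k n G" and ij: "i \<in> {1..k}" "j \<in> {1..k}" "i \<noteq> j"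
    and f: "bij_betw f {..<h} VH" and loops: "\<And>x. {x} \<notin> EH"
    and \<phi>: "inj_on \<phi> {..<h}" "\<phi> ` {..<h} \<subseteq> {0..<n}"
    and col: "\<And>a b. a < b \<Longrightarrow> b < h \<Longrightarrow> {\<phi> a, \<phi> b} \<in> G (if {f a, f b} \<in> EH then i else j)"
  shows "\<exists>X \<subseteq> {0..<n}. induced_edges (complete_edges n) X \<subseteq> G i \<union> G j \<and> graph_iso VH EH X (induced_edges (G i) X)"
proof (intro exI conjI)
  let ?X = "\<phi> ` {..<h}"
  have col': "{\<phi> a, \<phi> b} \<in> G (if {f a, f b} \<in> EH then i else j)" if "a < h" "b < h" "a \<noteq> b" for a b
    using col[of a b] col[of b a] that by (cases a b rule: linorder_cases) (auto simp: insert_commute)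
  have disj: "G i \<inter> G j = {}" using G ij by (auto simp: multicolouring_def)
  have Gloop: "{x} \<notin> G i" for x
  proof
    assume "{x} \<in> G i"
    moreover have "G i \<subseteq> complete_edges n" using G ij by (auto simp: multicolouring_def)
    ultimately show False by (force simp: complete_edges_def doubleton_eq_iff)
  qed
  show "?X \<subseteq> {0..<n}" by (rule \<phi>(2))
  show "induced_edges (complete_edges n) ?X \<subseteq> G i \<union> G j"
  proof
    fix e assume "e \<in> induced_edges (complete_edges n) ?X"
    then obtain u v where uv: "e = {u, v}" "u \<noteq> v" "u \<in> ?X" "v \<in> ?X"
      by (auto simp: induced_edges_def complete_edges_def)
    then obtain a b where ab: "u = \<phi> a" "v = \<phi> b" "a < h" "b < h" by auto
    then have "{\<phi> a, \<phi> b} \<in> G (if {f a, f b} \<in> EH then i else j)" using uv(2) by (intro col') auto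
    then show "e \<in> G i \<union> G j" using uv(1) ab by (auto split: if_splits)
  qed
  show "graph_iso VH EH ?X (induced_edges (G i) ?X)"
    unfolding graph_iso_def
  proof (intro exI conjI ballI)
    define g where "g = inv_into {..<h} f"
    have g: "bij_betw g VH {..<h}" unfolding g_def by (rule bij_betw_inv_into[OF f])
    have "bij_betw \<phi> {..<h} ?X" using \<phi>(1) by (simp add: bij_betw_def)
    then show "bij_betw (\<phi> \<circ> g) VH ?X" using g by (rule bij_betw_trans[rotated])
    fix u v assume uv: "u \<in> VH" "v \<in> VH"
    have fg: "f (g u) = u" "f (g v) = v" using bij_betw_inv_into_right[OF f] uv by (auto simp: g_def)
    have gh: "g u < h" "g v < h" using g uv by (auto simp: bij_betw_def)
    have "{u, v} \<in> EH \<longleftrightarrow> {\<phi> (g u), \<phi> (g v)} \<in> G i"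
    proof (cases "u = v")
      case True
      then show ?thesis using loops Gloop by simp
    next
      case False
      then have "g u \<noteq> g v" using fg by metis
      then show ?thesis using col'[OF gh] disj fg by (auto split: if_splits)
    qed
    then show "{u, v} \<in> EH \<longleftrightarrow> {(\<phi> \<circ> g) u, (\<phi> \<circ> g) v} \<in> induced_edges (G i) ?X"
      using gh by (auto simp: induced_edges_def)
  qed
qed

lemma colour_function:
  assumes G: "multicolouring k n G" and k: "1 \<le> k"
  shows "\<exists>col. (\<forall>x y. col x y = col y x \<and> col x y \<in> {1..k} \<and> (x < n \<longrightarrow> y < n \<longrightarrow> x \<noteq> y \<longrightarrow> {x, y} \<in> G (col x y)))"
proof -
  \<comment> \<open>The default 1 keeps all values in \<open>{1..k}\<close>, also on the diagonal
    and outside the vertex set, as the lemmas for colour functions on all of \<open>nat\<close>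
    expect.\<close>
  define col where "col x y = (if x < n \<and> y < n \<and> x \<noteq> y then SOME i. i \<in> {1..k} \<and> {x, y} \<in> G i else 1)" for x y
  have "col x y = col y x" for x y unfolding col_def by (simp add: insert_commute conj_commute) 
  moreover have "col x y \<in> {1..k} \<and> {x, y} \<in> G (col x y)" if "x < n" "y < n" "x \<noteq> y" for x y
  proof -
    have "{x, y} \<in> complete_edges n" using that by (auto simp: complete_edges_def)
    moreover have "(\<Union>i\<in>{1..k}. G i) = complete_edges n" using G by (simp add: multicolouring_def)
    ultimately have "\<exists>i. i \<in> {1..k} \<and> {x, y} \<in> G i" by blast
    then show ?thesis using someI_ex[of "\<lambda>i. i \<in> {1..k} \<and> {x, y} \<in> G i"] that by (simp add: col_def)
  qed
  moreover have "col x y \<in> {1..k}" if "\<not> (x < n \<and> y < n \<and> x \<noteq> y)" for x y using that k by (auto simp: col_def)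
  ultimately show ?thesis by (intro exI[of _ col]) blast
qed

theorem theorem5p3:
  fixes k :: nat and VH :: "'b set" and EH :: "'b set set"
  assumes "k \<ge> 2" and "forest VH EH"
  shows "\<exists>\<epsilon>::real. \<epsilon> > 0 \<and>
    (\<forall>n G. n \<ge> 2 \<longrightarrow> multicolouring k n G \<longrightarrow>
      (\<exists>i\<in>{1..k}. \<exists>j\<in>{1..k}. i \<noteq> j \<and>
        ((\<exists>X \<subseteq> {0..<n}. induced_edges (complete_edges n) X \<subseteq> G i \<union> G j \<and>
             graph_iso VH EH X (induced_edges (G i) X)) \<or>
         (\<exists>X Y. X \<subseteq> {0..<n} \<and> Y \<subseteq> {0..<n} \<and> X \<inter> Y = {} \<and>
             real (card X) \<ge> \<epsilon> * real n \<and> real (card Y) \<ge> \<epsilon> * real n \<and>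
             (\<forall>x\<in>X. \<forall>y\<in>Y. {x, y} \<in> G j)))))"
proof -
  have finH: "finite VH" and loops: "\<And>x. {x} \<notin> EH" and acyc: "\<And>vs. set vs \<subseteq> VH \<Longrightarrow> \<not> is_cycle EH vs"
    using assms(2) by (force simp: forest_def simple_graph_def doubleton_eq_iff)+
  define h where "h = card VH"
  obtain f p0 where f: "bij_betw f {..<h} VH"
    and p0: "\<And>b. b < h \<Longrightarrow> p0 b \<le> b" "\<And>a b. a < b \<Longrightarrow> b < h \<Longrightarrow> {f a, f b} \<in> EH \<longleftrightarrow> p0 b = Suc a"
    using forest_enumeration[OF finH loops acyc] unfolding h_def by blast
  \<comment> \<open>Number \<open>Suc a\<close> stands for the vertex \<open>f a\<close>, and 0 is
    an additional root, the parent of every vertex without an earlier neighbour.\<close>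
  define P where "P b = (if 1 \<le> b \<and> b \<le> h then p0 (b - 1) else 0)" for b
  have P: "P b < b" if "1 \<le> b" for b using p0(1)[of "b - 1"] that by (cases b) (auto simp: P_def less_Suc_eq_le)
  have PE: "P (Suc b) = Suc a \<longleftrightarrow> {f a, f b} \<in> EH" if "a < b" "b < h" for a b using that p0(2) by (simp add: P_def)
  interpret parent P h by unfold_locales (rule P)
  define r where "r = tree_from 0 1"
  have k1: "1 \<le> k" using assms(1) by simp
  have other: "\<exists>i\<in>{1..k}. i \<noteq> g" for g 
    using assms(1) by (intro bexI[of _ "if g = 1 then 2 else 1"]) auto
  from monochromatic_tree[OF k1 P, where 'a = nat and m = h and r = r]
  obtain M :: nat and \<theta> \<delta> :: real where \<theta>\<delta>: "0 < \<theta>" "0 < \<delta>" and tree: "\<And>(c :: nat \<Rightarrow> nat \<Rightarrow> nat) B. coloured c \<Longrightarrow> (\<forall>x y. c x y \<le> k) \<Longrightarrow>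
    (\<forall>i<M. finite (B i) \<and> B i \<noteq> {}) \<Longrightarrow> (\<forall>i<M. \<forall>j<M. i \<noteq> j \<longrightarrow> B i \<inter> B j = {}) \<Longrightarrow>
    (\<forall>i<M. \<forall>j<M. i \<noteq> j \<longrightarrow> (\<forall>x\<in>B i. card {y\<in>B j. c x y \<noteq> 0} \<le> \<theta> * card (B j))) \<Longrightarrow>
    (\<forall>i<M. \<forall>j<M. i \<noteq> j \<longrightarrow> (\<forall>X Y. X \<subseteq> B i \<longrightarrow> Y \<subseteq> B j \<longrightarrow> \<delta> * card (B i) \<le> card X \<longrightarrow>
      \<delta> * card (B j) \<le> card Y \<longrightarrow> (\<exists>x\<in>X. \<exists>y\<in>Y. c x y \<noteq> 0))) \<Longrightarrow>
    (\<exists>\<kappa>\<in>{1..k}. (\<exists>x S. coloured.rcopy c \<kappa> r x S \<and> S \<subseteq> (\<Union>i<M. B i)) \<or>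
      (\<exists>\<phi>. inj_on \<phi> {..h} \<and> \<phi> ` {..h} \<subseteq> (\<Union>i<M. B i) \<and>
        (\<forall>a b. a < b \<longrightarrow> b \<le> h \<longrightarrow> c (\<phi> a) (\<phi> b) = (if P b = a then \<kappa> else 0))))"
    by - (drule meta_mp, assumption, elim exE conjE, rule that, assumption, assumption, erule allE, erule allE, erule (1) impE, erule (1) impE, erule (1) impE,
      erule (1) impE, erule (1) impE, erule (1) mp)
  define \<theta>' where "\<theta>' = min \<theta> 1"
  have \<theta>': "0 < \<theta>'" "\<theta>' \<le> 1" "\<theta>' \<le> \<theta>" using \<theta>\<delta> by (auto simp: \<theta>'_def)
  define E where "E a b \<longleftrightarrow> {f a, f b} \<in> EH" for a b
  from roedl[OF \<theta>'(1,2) k1, where 'a = nat and M = M and h = h and E = E]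
  obtain N :: nat and \<kappa> :: real where N: "1 \<le> N" and \<kappa>: "0 < \<kappa>" and flat: "\<And>(c :: nat \<Rightarrow> nat \<Rightarrow> nat) B. (\<forall>x y. c x y = c y x) \<Longrightarrow>
    (\<forall>x y. x \<noteq> y \<longrightarrow> c x y \<in> {1..k}) \<Longrightarrow> blocks N B \<Longrightarrow> pair_copy k h E c (\<Union>i<N. B i) \<or>
    (\<exists>g\<in>{1..k}. \<exists>B' e. inj_on e {..<M} \<and> e ` {..<M} \<subseteq> {..<N} \<and> contr \<kappa> {..<M} B' (B \<circ> e) \<and>
      (\<forall>a<M. \<forall>b<M. a \<noteq> b \<longrightarrow> (\<forall>x\<in>B' a. card {y\<in>B' b. c x y \<noteq> g} \<le> \<theta>' * card (B' b))))"
    by (elim exE conjE) (rule that, assumption, assumption, erule allE, erule allE, erule (1) impE, erule (1) impE, erule (1) mp)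
  \<comment> \<open>For \<open>n < N\<close> the bound \<open>1 / N\<close> makes single vertices
    large enough. Otherwise blocks have \<open>n div N \<ge> n / (2 * N)\<close> vertices, and the
    factors \<open>\<kappa>\<close> and \<open>\<delta>\<close> are lost in \<open>roedl\<close> and
    in the colour-0 pair.\<close>
  define \<epsilon> where "\<epsilon> = min (\<delta> * \<kappa> / (2 * N)) (1 / N)"
  have \<epsilon>: "0 < \<epsilon>" "\<epsilon> \<le> \<delta> * \<kappa> / (2 * N)" "\<epsilon> \<le> 1 / N" using \<theta>\<delta> \<kappa> N by (auto simp: \<epsilon>_def)
  show ?thesis
  proof (rule exI[of _ \<epsilon>], intro conjI allI impI \<epsilon>(1))
    fix n G assume n: "2 \<le> n" and G: "multicolouring k n G"
    let ?copy = "\<lambda>i j. \<exists>X \<subseteq> {0..<n}. induced_edges (complete_edges n) X \<subseteq> G i \<union> G j \<and>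
      graph_iso VH EH X (induced_edges (G i) X)"
    let ?pair = "\<lambda>j. \<exists>X Y. X \<subseteq> {0..<n} \<and> Y \<subseteq> {0..<n} \<and> X \<inter> Y = {} \<and>
      real (card X) \<ge> \<epsilon> * real n \<and> real (card Y) \<ge> \<epsilon> * real n \<and> (\<forall>x\<in>X. \<forall>y\<in>Y. {x, y} \<in> G j)"
    let ?goal = "\<exists>i\<in>{1..k}. \<exists>j\<in>{1..k}. i \<noteq> j \<and> (?copy i j \<or> ?pair j)"
    obtain col where col: "\<And>x y. col x y = col y x" "\<And>x y. col x y \<in> {1..k}"
      "\<And>x y. x < n \<Longrightarrow> y < n \<Longrightarrow> x \<noteq> y \<Longrightarrow> {x, y} \<in> G (col x y)"
      using colour_function[OF G k1] by blast
    \<comment> \<open>The pair alternative constrains \<open>j\<close> alone; a different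
      \<open>i\<close> exists because \<open>k \<ge> 2\<close>.\<close>
    have goal_pair: ?goal if "j \<in> {1..k}" "?pair j" for j
    proof -
      obtain i where "i \<in> {1..k}" "i \<noteq> j" using other by blast
      then show ?thesis using that by (intro bexI[of _ i] bexI[of _ j]) simp_all
    qed
    have goal_copy: ?goal if "i \<in> {1..k}" "j \<in> {1..k}" "i \<noteq> j" "?copy i j" for i j
      using that by (intro bexI[of _ i] bexI[of _ j]) simp_all
    show ?goal
    proof (cases "n < N")
      case True
      have "\<epsilon> * real n \<le> 1 / N * real n" using \<epsilon>(3) by (intro mult_right_mono) auto
      also have "\<dots> \<le> 1" using True by (simp add: divide_le_eq)
      finally have "\<epsilon> * real n \<le> 1" .
      moreover have "{0, 1} \<in> G (col 0 1)" using n by (intro col(3)) auto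
      ultimately have "?pair (col 0 1)" using n by - (rule exI[of _ "{0}"], rule exI[of _ "{1}"], auto)
      then show ?goal by (rule goal_pair[OF col(2)])
    next
      case False
      define q where "q = n div N"
      have q1: "1 \<le> q" using False N by (simp add: q_def div_greater_zero_iff Suc_le_eq)
      have Nq: "N * q \<le> n" by (simp add: q_def)
      have "n < N * q + N" using N dividend_less_times_div[of N n] by (simp add: q_def)
      also have "\<dots> \<le> 2 * N * q" using q1 by simp
      finally have "real n \<le> real (2 * N * q)" by (intro of_nat_mono) simp
      then have nq: "real n \<le> 2 * N * q" by simp
      define B where "B a = {a * q..<Suc a * q}" for a
      have cB: "card (B a) = q" for a by (simp add: B_def)
      have B0: "B a \<subseteq> {0..<n}" if "a < N" for a
      proof -
        have "Suc a * q \<le> N * q" using that by (intro mult_le_mono1) simp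
        then show ?thesis using Nq by (auto simp: B_def)
      qed
      have bl: "blocks N B"
      proof -
        have lt: "B a \<inter> B b = {}" if "a < b" for a b
        proof -
          have "Suc a * q \<le> b * q" using that by (intro mult_le_mono1) simp
          then show ?thesis by (auto simp: B_def)
        qed
        have "B a \<inter> B b = {}" if "a \<noteq> b" for a b
          using that lt[of a b] lt[of b a] by (cases a b rule: linorder_cases) (simp_all add: Int_commute)
        then show ?thesis using q1 by (auto simp: blocks_def B_def)
      qed
      have "pair_copy k h E col (\<Union>i<N. B i) \<or>
        (\<exists>g\<in>{1..k}. \<exists>B' e. inj_on e {..<M} \<and> e ` {..<M} \<subseteq> {..<N} \<and> contr \<kappa> {..<M} B' (B \<circ> e) \<and>
          (\<forall>a<M. \<forall>b<M. a \<noteq> b \<longrightarrow> (\<forall>x\<in>B' a. card {y\<in>B' b. col x y \<noteq> g} \<le> \<theta>' * card (B' b))))"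
        
        by (rule flat) (use col(1,2) bl in simp_all)
      then show ?goal
      proof (elim disjE bexE exE conjE)
        assume "pair_copy k h E col (\<Union>i<N. B i)"
        then obtain i j \<phi> where ij: "i \<in> {1..k}" "j \<in> {1..k}" "i \<noteq> j" and \<phi>: "inj_on \<phi> {..<h}" "\<phi> ` {..<h} \<subseteq> (\<Union>i<N. B i)"
          and c: "\<And>a b. a < b \<Longrightarrow> b < h \<Longrightarrow> col (\<phi> a) (\<phi> b) = (if E a b then i else j)"
          unfolding pair_copy_def by (elim bexE conjE exE) (rule that, assumption+, simp)
        have \<phi>n: "\<phi> ` {..<h} \<subseteq> {0..<n}" using \<phi>(2) B0 by blast
        have "?copy i j"
        proof (rule copy_alternative[OF G ij f loops \<phi>(1) \<phi>n])
          fix a b assume ab: "a < b" "b < h"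
          then have "\<phi> a \<noteq> \<phi> b" "\<phi> a < n" "\<phi> b < n" using \<phi>(1) \<phi>n by (auto simp: inj_on_def image_subset_iff)
          then show "{\<phi> a, \<phi> b} \<in> G (if {f a, f b} \<in> EH then i else j)" 
            using col(3)[of "\<phi> a" "\<phi> b"] c[OF ab] by (simp add: E_def)
        qed
        then show ?goal by (rule goal_copy[OF ij])
      next
        fix g B' e assume g: "g \<in> {1..k}" and e: "inj_on e {..<M}" "e ` {..<M} \<subseteq> {..<N}" and ct: "contr \<kappa> {..<M} B' (B \<circ> e)"
          and sparse: "\<forall>a<M. \<forall>b<M. a \<noteq> b \<longrightarrow> (\<forall>x\<in>B' a. card {y\<in>B' b. col x y \<noteq> g} \<le> \<theta>' * card (B' b))"
        \<comment> \<open>\<open>col\<close> is never 0, so the colour 0 of \<open>c\<close> is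
          exactly the dominant colour \<open>g\<close>, whichever it is.\<close>
        define c where "c x y = (if col x y = g then 0 else col x y)" for x y
        have c0: "c x y = 0 \<longleftrightarrow> col x y = g" for x y using col(2)[of x y] by (auto simp: c_def)
        have cc: "coloured c" by unfold_locales (simp add: c_def col(1))
        have ck: "\<forall>x y. c x y \<le> k" using col(2) by (simp add: c_def)
        have eN: "e a < N" if "a < M" for a using e(2) that by auto
        have "B (e a) \<inter> B (e b) = {}" if "a < M" "b < M" "a \<noteq> b" for a b
        proof -
          have "e a \<noteq> e b" using e(1) that by (auto simp: inj_on_def)
          then show ?thesis using bl eN that by (simp add: blocks_def)
        qed
        then have "blocks M (B \<circ> e)" using bl eN by (simp add: blocks_def)
        then have bl': "blocks M B'" by (rule blocks_contr[OF _ ct \<kappa>])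
        have B'n: "B' a \<subseteq> {0..<n}" if "a < M" for a
          using ct that B0[OF eN[OF that]] by (auto simp: contr_def)
        have cB': "\<kappa> * q \<le> card (B' a)" if "a < M" for a using ct that cB by (simp add: contr_def)
        have sp: "\<forall>i<M. \<forall>j<M. i \<noteq> j \<longrightarrow> (\<forall>x\<in>B' i. card {y\<in>B' j. c x y \<noteq> 0} \<le> \<theta> * card (B' j))"
        proof (intro allI impI ballI)
          fix i j x assume "i < M" "j < M" "i \<noteq> j" "x \<in> B' i"
          then have "card {y\<in>B' j. c x y \<noteq> 0} \<le> \<theta>' * card (B' j)" using sparse by (simp add: c0)
          also have "\<dots> \<le> \<theta> * card (B' j)" using \<theta>' by (intro mult_right_mono) auto
          finally show "card {y\<in>B' j. c x y \<noteq> 0} \<le> \<theta> * card (B' j)" .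
        qed
        show ?goal
        proof (cases "\<forall>i<M. \<forall>j<M. i \<noteq> j \<longrightarrow> (\<forall>X Y. X \<subseteq> B' i \<longrightarrow> Y \<subseteq> B' j \<longrightarrow> \<delta> * card (B' i) \<le> card X \<longrightarrow>
            \<delta> * card (B' j) \<le> card Y \<longrightarrow> (\<exists>x\<in>X. \<exists>y\<in>Y. c x y \<noteq> 0))")
          case False
          then obtain i j X Y where ij: "i < M" "j < M" "i \<noteq> j" and XY: "X \<subseteq> B' i" "Y \<subseteq> B' j"
            "\<delta> * card (B' i) \<le> card X" "\<delta> * card (B' j) \<le> card Y" and z: "\<And>x y. x \<in> X \<Longrightarrow> y \<in> Y \<Longrightarrow> c x y = 0" by blast
          have disj: "X \<inter> Y = {}"
          proof -
            have "B' i \<inter> B' j = {}" using bl' ij by (simp add: blocks_def)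
            then show ?thesis using XY(1,2) by blast
          qed
          have sub: "X \<subseteq> {0..<n}" "Y \<subseteq> {0..<n}" using XY(1,2) B'n[OF ij(1)] B'n[OF ij(2)] by (meson subset_trans)+
          have big: "\<epsilon> * n \<le> \<delta> * card (B' a)" if "a < M" for a
          proof -
            have "\<epsilon> * n \<le> (\<delta> * \<kappa> / (2 * N)) * (2 * N * q)" using \<epsilon> nq \<theta>\<delta> \<kappa> by (intro mult_mono) auto
            also have "\<dots> = \<delta> * (\<kappa> * q)" using N by (simp add: field_simps)
            also have "\<dots> \<le> \<delta> * card (B' a)" using cB'[OF that] \<theta>\<delta> by (intro mult_left_mono) auto
            finally show ?thesis .
          qed
          have "{x, y} \<in> G g" if "x \<in> X" "y \<in> Y" for x y
          proof -
            have "x \<noteq> y" "x < n" "y < n" using disj sub that by auto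
            then have "{x, y} \<in> G (col x y)" by (intro col(3))
            then show ?thesis using z[OF that] c0 by simp
          qed
          moreover have "\<epsilon> * n \<le> card X" "\<epsilon> * n \<le> card Y" using XY(3,4) big[OF ij(1)] big[OF ij(2)] by linarith+
          ultimately have "?pair g" using disj sub by - (rule exI[of _ X], rule exI[of _ Y], simp)
          then show ?goal by (rule goal_pair[OF g])
        next
          case True
          have f1: "\<forall>i<M. finite (B' i) \<and> B' i \<noteq> {}" and f2: "\<forall>i<M. \<forall>j<M. i \<noteq> j \<longrightarrow> B' i \<inter> B' j = {}"
            using bl' by (auto simp: blocks_def)
          obtain \<gamma> \<phi> where \<gamma>: "\<gamma> \<in> {1..k}" and \<phi>: "inj_on \<phi> {..h}" "\<phi> ` {..h} \<subseteq> (\<Union>i<M. B' i)"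
            and cp: "\<And>a b. a < b \<Longrightarrow> b \<le> h \<Longrightarrow> c (\<phi> a) (\<phi> b) = (if P b = a then \<gamma> else 0)"
            using tree[OF cc ck f1 f2 sp True]
          proof (elim bexE disjE exE conjE)
            fix \<gamma> x S assume g: "\<gamma> \<in> {1..k}" and S: "coloured.rcopy c \<gamma> r x S" "S \<subseteq> (\<Union>i<M. B' i)"
            obtain \<phi> where "inj_on \<phi> {..h}" "\<phi> ` {..h} \<subseteq> S"
                "\<forall>a b. a < b \<longrightarrow> b \<le> h \<longrightarrow> c (\<phi> a) (\<phi> b) = (if P b = a then \<gamma> else 0)"
              using tree_copy[OF cc S(1)[unfolded r_def]] by blast
            then show thesis using that[OF g, of \<phi>] S(2) by (meson subset_trans)
          next
            fix \<gamma> \<phi> assume "\<gamma> \<in> {1..k}" "inj_on \<phi> {..h}" "\<phi> ` {..h} \<subseteq> (\<Union>i<M. B' i)"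
              "\<forall>a b. a < b \<longrightarrow> b \<le> h \<longrightarrow> c (\<phi> a) (\<phi> b) = (if P b = a then \<gamma> else 0)"
            then show thesis using that[of \<gamma> \<phi>] by simp
          qed
          \<comment> \<open>For nonempty \<open>H\<close> the edge from the additional root to
            vertex 1 has colour \<open>\<gamma>\<close>, which shows
            \<open>\<gamma> \<noteq> g\<close>. For empty \<open>H\<close> there is no such edge,
            and any colour other than \<open>g\<close> will do.\<close>
          obtain i where i: "i \<in> {1..k}" "i \<noteq> g" "1 \<le> h \<longrightarrow> i = \<gamma>"
          proof (cases "1 \<le> h")
            case True
            then have "c (\<phi> 0) (\<phi> 1) = \<gamma>" using cp[of 0 1] P[of 1] by simp
            then have "\<gamma> \<noteq> g" using \<gamma> by (auto simp: c_def split: if_splits)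
            then show ?thesis using that \<gamma> by blast
          next
            case False
            then show ?thesis using that other by blast
          qed
          have \<phi>n: "\<phi> ` {..h} \<subseteq> {0..<n}" using \<phi>(2) B'n by blast
          have "?copy i g"
          proof (rule copy_alternative[OF G i(1) g i(2) f loops])
            \<comment> \<open>Composition with \<open>Suc\<close> discards the additional root and
              undoes the shift of indices.\<close>
            show "inj_on (\<phi> \<circ> Suc) {..<h}" by (rule comp_inj_on) (auto intro: inj_on_subset[OF \<phi>(1)])
            show "(\<phi> \<circ> Suc) ` {..<h} \<subseteq> {0..<n}" using \<phi>n by (auto simp: image_subset_iff)
            fix a b assume ab: "a < b" "b < h"
            have "\<phi> (Suc a) \<noteq> \<phi> (Suc b)" using inj_onD[OF \<phi>(1), of "Suc a" "Suc b"] ab by auto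
            moreover have "\<phi> (Suc a) < n" "\<phi> (Suc b) < n" using \<phi>n ab by (auto simp: image_subset_iff)
            ultimately have "{\<phi> (Suc a), \<phi> (Suc b)} \<in> G (col (\<phi> (Suc a)) (\<phi> (Suc b)))" by (intro col(3))
            moreover have "col (\<phi> (Suc a)) (\<phi> (Suc b)) = (if {f a, f b} \<in> EH then i else g)"
            proof -
              have ig: "i = \<gamma>" using i(3) ab by simp
              have "c (\<phi> (Suc a)) (\<phi> (Suc b)) = (if {f a, f b} \<in> EH then \<gamma> else 0)"
                using cp[of "Suc a" "Suc b"] PE[OF ab] ab by simp
              then show ?thesis using \<gamma> ig col(2)[of "\<phi> (Suc a)" "\<phi> (Suc b)"] by (auto simp: c_def split: if_splits)
            qed
            ultimately show "{(\<phi> \<circ> Suc) a, (\<phi> \<circ> Suc) b} \<in> G (if {f a, f b} \<in> EH then i else g)" by simp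
          qed
          then show ?goal by (rule goal_copy[OF i(1) g i(2)])
        qed
      qed
    qed
  qed
qed

end
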